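(* Let $C$ be a field of characteristic $p$ and $D$ a central division algebra over $C$ of degree $d$. Let $\delta$ be a derivation of $D$ such that $\delta|_C$ is algebraic with minimum polynomial $g(t)=t^{p^e}+c_1t^{p^{e-1}}+\dots+c_et\in F[t]$ of degree $p^e$, where $F={\rm Const}(\delta)\cap C$. Let $d_0\in D$ satisfy $g(\delta)(z)=d_0z-zd_0$ for all $z\in D$ and $\delta(d_0)=0$. Let $R=D[t;\delta]$ and $x=g(t)-d_0$, and let $N$ be the reduced norm of the central simple $F(x)$-algebra $D(t;\delta)$. Assume that $D$ has a subfield $E$ of degree $d$ over $C$. (i) For all $f\in R$ we have $N(f)\in F[x]$. (ii) For all $f\in R$, $f$ divides $N(f)$ in $R$.
   Context: ${\rm Const}(\delta)=\{a\in D:\delta(a)=0\}$. $D[t;\delta]$ is the ring of polynomials $\sum a_it^i$, $a_i\in D$, with $ta=at+\delta(a)$ for $a\in D$. Its center is $F[x]$, $x=g(t)-d_0$. The ring of central quotients $D(t;\delta)=\{f/q: f\in R,\ 0\ne q\in F[x]\}$ is a central simple algebra of degree $p^ed$ over $F(x)$, free of rank $p^e$ as a left $D(x)$-module; $N$ is its reduced norm. "$f$ divides $N(f)$ in $R$" means $N(f)=qf=fq$ for some $q\in R$. *)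

theory Defs
  imports
    "HOL-Algebra.Algebraic_Closure_Type"
    "HOL-Computational_Algebra.Computational_Algebra"
    "Jordan_Normal_Form.Determinant"
begin

text \<open>
  A field extension or algebra structure map is given by a unital ring homomorphism between types.
  For an algebra \<open>\<iota> :: 'c \<Rightarrow> 'd\<close> over a field, \<open>vector_space.dim\<close> is \<open>0\<close> on infinite-dimensional
  spaces, so requiring the value \<open>d\<^sup>2 > 0\<close> includes finite-dimensionality.
\<close>

definition alg_dim :: "('c::field \<Rightarrow> 'd::division_ring) \<Rightarrow> 'd set \<Rightarrow> nat" where
  "alg_dim \<iota> V = vector_space.dim (\<lambda>c a. \<iota> c * a) V"

definition central_division_algebra :: "('c::field \<Rightarrow> 'd::division_ring) \<Rightarrow> nat \<Rightarrow> bool" where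
  "central_division_algebra \<iota> d \<longleftrightarrow>
     Ring_Hom.ring_hom \<iota> \<and> range \<iota> = {z. \<forall>a. z * a = a * z} \<and>
     d > 0 \<and> alg_dim \<iota> UNIV = d\<^sup>2"

definition subfield_of_degree :: "('c::field \<Rightarrow> 'd::division_ring) \<Rightarrow> 'd set \<Rightarrow> nat \<Rightarrow> bool" where
  "subfield_of_degree \<iota> E d \<longleftrightarrow>
     subfield E (ring_of_type_algebra :: 'd ring) \<and> range \<iota> \<subseteq> E \<and> d > 0 \<and> alg_dim \<iota> E = d"

definition is_derivation :: "('d::ring \<Rightarrow> 'd) \<Rightarrow> bool" where
  "is_derivation \<delta> \<longleftrightarrow>
     (\<forall>a b. \<delta> (a + b) = \<delta> a + \<delta> b) \<and> (\<forall>a b. \<delta> (a * b) = \<delta> a * b + a * \<delta> b)"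

definition Const :: "('d::ring \<Rightarrow> 'd) \<Rightarrow> 'd set" where
  "Const \<delta> = {a. \<delta> a = 0}"

text \<open>The operator \<open>g(\<delta>)\<close>, for a polynomial \<open>g\<close> over a field \<open>F\<close> embedded by \<open>j\<close>.\<close>

definition poly_op :: "('f::field \<Rightarrow> 'd::ring_1) \<Rightarrow> ('d \<Rightarrow> 'd) \<Rightarrow> 'f poly \<Rightarrow> 'd \<Rightarrow> 'd" where
  "poly_op j \<delta> g z = (\<Sum>i\<le>Polynomial.degree g. j (Polynomial.coeff g i) * (\<delta> ^^ i) z)"

definition is_min_poly_on ::
  "('f::field \<Rightarrow> 'd::ring_1) \<Rightarrow> ('d \<Rightarrow> 'd) \<Rightarrow> 'd set \<Rightarrow> 'f poly \<Rightarrow> bool" where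
  "is_min_poly_on j \<delta> S g \<longleftrightarrow>
     Polynomial.lead_coeff g = 1 \<and> (\<forall>z\<in>S. poly_op j \<delta> g z = 0) \<and>
     (\<forall>h. h \<noteq> 0 \<and> (\<forall>z\<in>S. poly_op j \<delta> h z = 0) \<longrightarrow> Polynomial.degree g \<le> Polynomial.degree h)"


subsection \<open>The skew polynomial ring\<close>

text \<open>
  An element \<open>\<Sum> a\<^sub>i t\<^sup>i\<close> of \<open>D[t;\<delta>]\<close> is represented by the \<^typ>\<open>'d poly\<close> with coefficients \<open>a\<^sub>i\<close>;
  the commutative multiplication of the type \<open>poly\<close> is not used.  The rule \<open>t a = a t + \<delta> a\<close> gives
  \<open>t \<cdot> (\<Sum> b\<^sub>j t\<^sup>j) = \<Sum> b\<^sub>j t\<^bsup>j+1\<^esup> + \<Sum> \<delta>(b\<^sub>j) t\<^sup>j\<close>, and the product follows by iteration.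
\<close>

definition t_mult :: "('d::division_ring \<Rightarrow> 'd) \<Rightarrow> 'd poly \<Rightarrow> 'd poly" where
  "t_mult \<delta> f = pCons 0 f + map_poly \<delta> f"

definition skew_mult :: "('d::division_ring \<Rightarrow> 'd) \<Rightarrow> 'd poly \<Rightarrow> 'd poly \<Rightarrow> 'd poly" where
  "skew_mult \<delta> f h =
     (\<Sum>i\<le>Polynomial.degree f.
        map_poly (\<lambda>b. Polynomial.coeff f i * b) ((t_mult \<delta> ^^ i) h))"

definition skew_poly_ring :: "('d::division_ring \<Rightarrow> 'd) \<Rightarrow> 'd poly ring" where
  "skew_poly_ring \<delta> =
     \<lparr> carrier = UNIV, monoid.mult = skew_mult \<delta>, one = [:1:], ring.zero = 0, add = (+) \<rparr>"

lemma t_commutation: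
  assumes "is_derivation \<delta>"
  shows "skew_mult \<delta> [:0, 1:] [:a:] = skew_mult \<delta> [:a:] [:0, 1:] + [:\<delta> a:]"
proof -
  have "\<delta> 0 = 0"
    using assms by (metis add_cancel_right_right is_derivation_def)
  then show ?thesis
    by (simp add: skew_mult_def t_mult_def map_poly_pCons)
qed

definition skew_eval ::
  "('f::field \<Rightarrow> 'd::division_ring) \<Rightarrow> ('d \<Rightarrow> 'd) \<Rightarrow> 'd poly \<Rightarrow> 'f poly \<Rightarrow> 'd poly" where
  "skew_eval j \<delta> x h =
     (\<Sum>i\<le>Polynomial.degree h.
        skew_mult \<delta> [:j (Polynomial.coeff h i):] (x [^]\<^bsub>skew_poly_ring \<delta>\<^esub> i))"


subsection \<open>Rings of central quotients\<close>

text \<open>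
  For a multiplicative set \<open>S\<close> of central elements of \<open>R\<close> that are not zero divisors, the fraction
  \<open>f/s\<close> is the class of \<open>(f, s)\<close> under \<open>f/s = f'/s' \<longleftrightarrow> f s' = f' s\<close>.  Operations are defined
  on representatives; the union over all representatives is a union of equal classes.
\<close>

definition quot :: "('a, 'm) ring_scheme \<Rightarrow> 'a set \<Rightarrow> 'a \<Rightarrow> 'a \<Rightarrow> ('a \<times> 'a) set" where
  "quot R S f s = {(f', s'). f' \<in> carrier R \<and> s' \<in> S \<and> f \<otimes>\<^bsub>R\<^esub> s' = f' \<otimes>\<^bsub>R\<^esub> s}"

definition central_quotients :: "('a, 'm) ring_scheme \<Rightarrow> 'a set \<Rightarrow> ('a \<times> 'a) set ring" where
  "central_quotients R S =
     \<lparr> carrier = {quot R S f s | f s. f \<in> carrier R \<and> s \<in> S},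
       monoid.mult = (\<lambda>U V. \<Union>(f, s)\<in>U. \<Union>(f', s')\<in>V. quot R S (f \<otimes>\<^bsub>R\<^esub> f') (s \<otimes>\<^bsub>R\<^esub> s')),
       one = quot R S \<one>\<^bsub>R\<^esub> \<one>\<^bsub>R\<^esub>,
       ring.zero = quot R S \<zero>\<^bsub>R\<^esub> \<one>\<^bsub>R\<^esub>,
       add = (\<lambda>U V. \<Union>(f, s)\<in>U. \<Union>(f', s')\<in>V.
                quot R S (f \<otimes>\<^bsub>R\<^esub> s' \<oplus>\<^bsub>R\<^esub> f' \<otimes>\<^bsub>R\<^esub> s) (s \<otimes>\<^bsub>R\<^esub> s')) \<rparr>"

text \<open>
  If \<open>\<epsilon>\<close> embeds an integral domain \<open>P\<close> into \<open>R\<close> with \<open>\<epsilon> ` (P - {0}) \<subseteq> S\<close>, this is the induced map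
  \<open>a/b \<mapsto> \<epsilon>(a)/\<epsilon>(b)\<close> from the fraction field of \<open>P\<close>.
\<close>

definition fract_hom ::
  "('a, 'm) ring_scheme \<Rightarrow> 'a set \<Rightarrow> ('p::idom \<Rightarrow> 'a) \<Rightarrow> 'p fract \<Rightarrow> ('a \<times> 'a) set" where
  "fract_hom R S \<epsilon> k = \<Union>{quot R S (\<epsilon> a) (\<epsilon> b) | a b. b \<noteq> 0 \<and> k = Fract a b}"


subsection \<open>The reduced norm\<close>

text \<open>
  Let \<open>\<sigma> :: 'k \<Rightarrow> 'a\<close> make the ring \<open>A\<close> an algebra over the field \<open>K\<close>, and let \<open>\<iota> :: 'k \<Rightarrow> 'l\<close> be
  a field extension \<open>L/K\<close>.  By the universal property of the tensor product, an \<open>L\<close>-algebra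
  isomorphism \<open>A \<otimes>\<^sub>K L \<cong> M\<^sub>n(L)\<close> is the same as a \<open>K\<close>-algebra homomorphism \<open>\<phi>: A \<rightarrow> M\<^sub>n(L)\<close>
  mapping a \<open>K\<close>-basis \<open>B\<close> of \<open>A\<close> to a (\<open>B\<close>-indexed) \<open>L\<close>-basis of \<open>M\<^sub>n(L)\<close>; it sends \<open>a \<otimes> 1\<close>
  to \<open>\<phi>(a)\<close>.
\<close>

definition is_alg_basis :: "('a, 'm) ring_scheme \<Rightarrow> ('k::field \<Rightarrow> 'a) \<Rightarrow> 'a set \<Rightarrow> bool" where
  "is_alg_basis A \<sigma> B \<longleftrightarrow> finite B \<and> B \<subseteq> carrier A \<and>
     (\<forall>a\<in>carrier A. \<exists>!c. (\<forall>b. b \<notin> B \<longrightarrow> c b = 0) \<and> a = (\<Oplus>\<^bsub>A\<^esub>b\<in>B. \<sigma> (c b) \<otimes>\<^bsub>A\<^esub> b))"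

definition is_mat_basis :: "nat \<Rightarrow> ('a \<Rightarrow> 'l::field mat) \<Rightarrow> 'a set \<Rightarrow> bool" where
  "is_mat_basis n \<phi> B \<longleftrightarrow> finite B \<and> \<phi> ` B \<subseteq> carrier_mat n n \<and>
     (\<forall>M\<in>carrier_mat n n. \<exists>!c. (\<forall>b. b \<notin> B \<longrightarrow> c b = 0) \<and>
        (\<forall>i<n. \<forall>j<n. M $$ (i, j) = (\<Sum>b\<in>B. c b * \<phi> b $$ (i, j))))"

definition is_splitting ::
  "('a, 'm) ring_scheme \<Rightarrow> ('k::field \<Rightarrow> 'a) \<Rightarrow> ('k \<Rightarrow> 'l::field) \<Rightarrow> nat \<Rightarrow> ('a \<Rightarrow> 'l mat) \<Rightarrow> bool" where
  "is_splitting A \<sigma> \<iota> n \<phi> \<longleftrightarrow>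
     \<phi> \<in> Ring.ring_hom A (ring_mat TYPE('l) n ()) \<and>
     (\<forall>k. \<phi> (\<sigma> k) = \<iota> k \<cdot>\<^sub>m 1\<^sub>m n) \<and>
     (\<exists>B. is_alg_basis A \<sigma> B \<and> is_mat_basis n \<phi> B)"

text \<open>
  For a central simple \<open>K\<close>-algebra \<open>A\<close>, the algebraic closure of \<open>K\<close> is a splitting field, and
  \<open>det(\<phi>(a))\<close> is an element of \<open>K\<close> that does not depend on the choice of \<open>\<phi>\<close>.
\<close>

definition reduced_norm :: "('a, 'm) ring_scheme \<Rightarrow> ('k::field \<Rightarrow> 'a) \<Rightarrow> 'a \<Rightarrow> 'k" where
  "reduced_norm A \<sigma> a =
     (THE c. \<exists>n \<phi>. is_splitting A \<sigma> to_ac n \<phi> \<and> to_ac c = Determinant.det (\<phi> a))"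

end

theory Submission
  imports Defs "HOL-Library.Function_Algebras" "Jordan_Normal_Form.Char_Poly"
begin

text \<open>
  Put \<open>P = F[x]\<close>, \<open>K = F(x)\<close>, and let \<open>L\<close> be the algebraic closure of \<open>K\<close>.  A Wronskian argument bounds
  \<open>[C : F]\<close> by \<open>p\<^sup>e\<close>, so division by the monic central element \<open>x\<close> shows that \<open>R\<close> is a finitely generated
  \<open>P\<close>-module, and the independence of \<open>1, \<delta>, \<delta>\<^sup>2, \<dots>\<close> (below order \<open>p\<^sup>e\<close>) on \<open>C\<close> over \<open>D\<close> shows that \<open>P\<close> is
  the whole center of \<open>R\<close>.  Hence the ring \<open>Q\<close> of central quotients is a finite-dimensional central
  division algebra over \<open>K\<close>.  A minimal left ideal of \<open>Q \<otimes> L\<close> yields a splitting \<open>\<phi>\<close> of \<open>Q\<close> over \<open>L\<close> by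
  Jacobson density, and \<open>det \<phi>\<close> does not depend on \<open>\<phi>\<close> by Skolem-Noether.

  If \<open>\<phi> a\<close> has a fixed vector as cyclic vector, its characteristic polynomial is the minimal
  polynomial of \<open>a\<close> over \<open>K\<close>.  Such \<open>a\<close> form a nonempty Zariski open set, so interpolation along lines
  puts the characteristic polynomial of every \<open>\<phi> b\<close> into \<open>K[y]\<close>; no separability is needed.  An \<open>f \<in> R\<close>
  satisfies a monic equation \<open>h(f) = 0\<close> over \<open>P\<close> by the determinant trick, the characteristic polynomial
  of \<open>\<phi> f\<close> divides \<open>h\<^sup>n\<close>, and Gauss's lemma gives it coefficients in \<open>P\<close>.  Its constant term is \<open>\<plusminus>N(f)\<close>,
  and Cayley-Hamilton writes this term as a product of \<open>f\<close> with a polynomial in \<open>f\<close>.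
\<close>

section \<open>Density over algebraically closed fields\<close>

text \<open>The reduced norm is a \<open>THE\<close> over splittings in L, so it has a value only
  once three things are known: a splitting exists, its determinant does not depend on the splitting,
  and that determinant lies in K. Galois descent does not settle the third point: K = F(x) is
  imperfect, and the automorphisms of L over K fix its whole purely inseparable closure. Instead, a
  K-linear retraction of L onto K is applied to the Cayley-Hamilton relation of a cyclic element.
  The relation stays monic of degree n, and a cyclic vector admits only one such relation, so the
  coefficients were in K all along. The interpolation needs infinitely many points, and F(x) has
  them even when F is finite. The whole characteristic polynomial is carried along, and not only the
  norm, for two reasons. Gauss's lemma concerns monic factors of a monic polynomial. And the
  cofactor of f in N(f) is a polynomial in f built from the other coefficients; it lies in R only
  because these coefficients lie in P.\<close>

lemma homogeneous_system_solution:
  fixes Y :: "'b \<Rightarrow> 'a \<Rightarrow> 'c::field"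
  assumes "finite J" "finite I" "card I > card J"
  shows "\<exists>u. (\<exists>c\<in>I. u c \<noteq> 0) \<and> (\<forall>i\<in>J. (\<Sum>c\<in>I. u c * Y i c) = 0)"
  using assms
proof (induction J arbitrary: I Y rule: finite_induct)
  case empty
  then show ?case by (intro exI[of _ "\<lambda>_. 1"]) (auto simp: card_gt_0_iff)
next
  case (insert m J)
  show ?case
  proof (cases "\<forall>c\<in>I. Y m c = 0")
    case True
    have "card I > card J" using insert.prems insert.hyps by simp
    from insert.IH[OF insert.prems(1) this, of Y] show ?thesis using True by auto
  next
    case False
    then obtain c0 where c0: "c0 \<in> I" "Y m c0 \<noteq> 0" by blast
    let ?I = "I - {c0}"
    have fin: "finite ?I" "card ?I > card J"
      using insert.prems insert.hyps c0 by (auto simp: card_Diff_singleton)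
    obtain u where u: "\<exists>c\<in>?I. u c \<noteq> 0"
      "\<And>i. i \<in> J \<Longrightarrow> (\<Sum>c\<in>?I. u c * (Y i c - Y i c0 * Y m c / Y m c0)) = 0"
      using insert.IH[OF fin, of "\<lambda>i c. Y i c - Y i c0 * Y m c / Y m c0"] by blast
    \<comment> \<open>Equation \<open>m\<close> forces this value at \<open>c0\<close>. Substitution
      turns the other equations into the reduced ones; for \<open>i = m\<close> all reduced
      coefficients are zero.\<close>
    define v where "v = u(c0 := - (\<Sum>c\<in>?I. u c * Y m c) / Y m c0)"
    have v: "(\<Sum>c\<in>I. v c * Y i c) = (\<Sum>c\<in>?I. u c * (Y i c - Y i c0 * Y m c / Y m c0))" for i
    proof -
      have "(\<Sum>c\<in>I. v c * Y i c) = v c0 * Y i c0 + (\<Sum>c\<in>?I. v c * Y i c)"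
        using c0 insert.prems by (simp add: sum.remove)
      also have "(\<Sum>c\<in>?I. v c * Y i c) = (\<Sum>c\<in>?I. u c * Y i c)"
        by (rule sum.cong) (auto simp: v_def)
      also have "v c0 * Y i c0 = - (\<Sum>c\<in>?I. u c * (Y i c0 * Y m c / Y m c0))"
        by (simp add: v_def sum_distrib_left sum_divide_distrib mult_ac)
      finally show ?thesis by (simp add: right_diff_distrib sum_subtractf)
    qed
    have "\<forall>i\<in>insert m J. (\<Sum>c\<in>I. v c * Y i c) = 0"
      using u(2) c0 unfolding v by auto
    moreover have "\<exists>c\<in>I. v c \<noteq> 0" using u(1) by (auto simp: v_def)
    ultimately show ?thesis by blast
  qed
qed

text \<open>Linearity is asked on \<open>W\<close> only, because the operator \<theta> in
  \<open>density\<close> is defined by choice and is meaningless outside \<open>W\<close>.\<close>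

definition linear_on :: "('k \<Rightarrow> 'v \<Rightarrow> 'v) \<Rightarrow> 'v set \<Rightarrow> ('v::plus \<Rightarrow> 'v) \<Rightarrow> bool" where
  "linear_on scale W T \<longleftrightarrow> T ` W \<subseteq> W \<and> (\<forall>y\<in>W. \<forall>z\<in>W. T (y + z) = T y + T z) \<and>
     (\<forall>c. \<forall>y\<in>W. T (scale c y) = scale c (T y))"

lemma linear_onD:
  assumes "linear_on scale W T"
  shows "y \<in> W \<Longrightarrow> T y \<in> W" "y \<in> W \<Longrightarrow> z \<in> W \<Longrightarrow> T (y + z) = T y + T z"
    "y \<in> W \<Longrightarrow> T (scale c y) = scale c (T y)"
  using assms unfolding linear_on_def by auto

locale scalar_space = vector_space scale
  for scale :: "'k::field \<Rightarrow> 'v::ab_group_add \<Rightarrow> 'v"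
begin

lemma linear_on_0:
  assumes "linear_on scale W T" "subspace W"
  shows "T 0 = 0"
  using linear_onD(3)[OF assms(1), of 0 0] subspace_0[OF assms(2)] by simp

lemma linear_on_sum:
  assumes "linear_on scale W T" "subspace W" "\<And>i. i \<in> I \<Longrightarrow> f i \<in> W"
  shows "T (sum f I) = (\<Sum>i\<in>I. T (f i))"
  using assms(3)
proof (induction I rule: infinite_finite_induct)
  case (insert i I)
  then show ?case
    using linear_onD(2)[OF assms(1), of "f i" "sum f I"] subspace_sum[OF assms(2), of I f]
    by simp
qed (auto simp: linear_on_0[OF assms(1,2)])

text \<open>The coordinates with respect to \<open>F\<close> give \<open>card F\<close> equations in
  \<open>card F + 1\<close> unknowns. The relation is indexed by \<open>i\<close>, not by vectors,
  since the \<open>y i\<close> may repeat.\<close>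

lemma finite_dim_relation:
  assumes F: "finite F" and y: "\<And>i. i \<le> card F \<Longrightarrow> y i \<in> span F"
  shows "\<exists>u. (\<exists>i\<le>card F. u i \<noteq> 0) \<and> (\<Sum>i\<le>card F. scale (u i) (y i)) = 0"
proof -
  have "\<exists>r. i \<le> card F \<longrightarrow> y i = (\<Sum>v\<in>F. scale (r v) v)" for i
    using y[of i] unfolding span_finite[OF F] by auto
  then obtain r where r: "\<And>i. i \<le> card F \<Longrightarrow> y i = (\<Sum>v\<in>F. scale (r i v) v)" by metis
  obtain u where u: "\<exists>i\<in>{..card F}. u i \<noteq> 0" "\<forall>v\<in>F. (\<Sum>i\<le>card F. u i * r i v) = 0"
    using homogeneous_system_solution[of F "{..card F}" "\<lambda>v i. r i v"] F by auto
  have "(\<Sum>i\<le>card F. scale (u i) (y i)) = (\<Sum>i\<le>card F. \<Sum>v\<in>F. scale (u i * r i v) v)"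
    by (intro sum.cong refl) (simp add: r scale_sum_right)
  also have "\<dots> = (\<Sum>v\<in>F. scale (\<Sum>i\<le>card F. u i * r i v) v)"
    by (subst sum.swap) (simp add: scale_sum_left)
  also have "\<dots> = 0" using u(2) by (intro sum.neutral) simp
  finally show ?thesis using u(1) by auto
qed

definition op_eval :: "('v \<Rightarrow> 'v) \<Rightarrow> 'k poly \<Rightarrow> 'v \<Rightarrow> 'v" where
  "op_eval T q y = (\<Sum>i\<le>degree q. scale (coeff q i) ((T ^^ i) y))"

lemma op_eval_bound:
  assumes "degree q \<le> N"
  shows "op_eval T q y = (\<Sum>i\<le>N. scale (coeff q i) ((T ^^ i) y))"
  unfolding op_eval_def using assms
  by (intro sum.mono_neutral_left) (auto simp: coeff_eq_0)

lemma op_eval_add: "op_eval T (q + r) y = op_eval T q y + op_eval T r y"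
proof -
  let ?N = "max (degree q) (degree r)"
  have "op_eval T (q + r) y = (\<Sum>i\<le>?N. scale (coeff (q + r) i) ((T ^^ i) y))"
    by (rule op_eval_bound) (rule degree_add_le_max)
  then show ?thesis
    by (simp add: op_eval_bound[of q ?N] op_eval_bound[of r ?N] scale_left_distrib sum.distrib)
qed

lemma op_eval_smult: "op_eval T (smult a q) y = scale a (op_eval T q y)"
  by (subst op_eval_bound[where N = "degree q"]) (auto simp: op_eval_def scale_sum_right degree_smult_le)

context
  fixes W T assumes T: "linear_on scale W T" and W: "subspace W"
begin

lemma funpow_in: "y \<in> W \<Longrightarrow> (T ^^ i) y \<in> W"
  by (induction i) (auto intro: linear_onD[OF T])

lemma op_eval_in: "y \<in> W \<Longrightarrow> op_eval T q y \<in> W"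
  unfolding op_eval_def by (intro subspace_sum[OF W] subspace_scale[OF W] funpow_in)

lemma op_eval_pCons_0:
  assumes y: "y \<in> W"
  shows "op_eval T (pCons 0 q) y = T (op_eval T q y)"
proof -
  have "op_eval T (pCons 0 q) y = (\<Sum>i\<le>Suc (degree q). scale (coeff (pCons 0 q) i) ((T ^^ i) y))"
    by (rule op_eval_bound) (rule degree_pCons_le)
  also have "\<dots> = (\<Sum>i\<le>degree q. scale (coeff q i) (T ((T ^^ i) y)))"
    by (subst sum.atMost_Suc_shift) simp
  also have "\<dots> = (\<Sum>i\<le>degree q. T (scale (coeff q i) ((T ^^ i) y)))"
    by (simp add: linear_onD(3)[OF T] funpow_in[OF y])
  also have "\<dots> = T (op_eval T q y)" unfolding op_eval_def
    by (rule linear_on_sum[OF T W, symmetric]) (intro subspace_scale[OF W] funpow_in y)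
  finally show ?thesis .
qed

end

end

text \<open>By finite dimension some nonzero polynomial in \<open>T\<close> kills some nonzero
  vector \<open>z\<close> of \<open>W\<close>. For one of least degree, splitting off a linear
  factor \<open>[:- c, 1:]\<close> leaves a cofactor that kills no nonzero vector, and the cofactor
  maps \<open>z\<close> to an eigenvector.\<close>

lemma eigenvector_exists:
  fixes scale :: "'l::alg_closed_field \<Rightarrow> 'v::ab_group_add \<Rightarrow> 'v"
  assumes "vector_space scale"
    and W: "module.subspace scale W" and F: "finite F" "W \<subseteq> module.span scale F"
    and T: "linear_on scale W T" and y: "y \<in> W" "y \<noteq> 0"
  shows "\<exists>c. \<exists>z\<in>W. z \<noteq> 0 \<and> T z = scale c z"
proof -
  interpret scalar_space scale using assms(1) by (rule scalar_space.intro)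
  define P where "P n \<longleftrightarrow> (\<exists>q. q \<noteq> 0 \<and> degree q = n \<and> (\<exists>y\<in>W. y \<noteq> 0 \<and> op_eval T q y = 0))" for n
  obtain u where u: "\<exists>i\<le>card F. u i \<noteq> 0" "(\<Sum>i\<le>card F. scale (u i) ((T ^^ i) y)) = 0"
    using finite_dim_relation[OF F(1), of "\<lambda>i. (T ^^ i) y"] funpow_in[OF T W y(1)] F(2) by blast
  define q where "q = (\<Sum>i\<le>card F. Polynomial.monom (u i) i)"
  have cq: "coeff q i = (if i \<le> card F then u i else 0)" for i
    by (simp add: q_def coeff_sum)
  have "degree q \<le> card F" by (rule degree_le) (simp add: cq)
  then have "op_eval T q y = 0" using u(2) by (simp add: op_eval_bound cq)
  moreover have "q \<noteq> 0" using u(1) cq by (metis coeff_0)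
  ultimately have "P (degree q)" using y by (auto simp: P_def)
  then have "P (LEAST n. P n)" by (rule LeastI)
  then obtain r z where r: "r \<noteq> 0" "degree r = (LEAST n. P n)" and z: "z \<in> W" "z \<noteq> 0" "op_eval T r z = 0"
    by (auto simp: P_def)
  have "degree r > 0"
  proof (rule ccontr)
    assume "\<not> degree r > 0"
    then obtain a where "r = [:a:]" by (metis degree_0_id gr0I)
    then show False using r z by (simp add: op_eval_def)
  qed
  then obtain c where "poly r c = 0" using alg_closed_imp_poly_has_root by blast
  then obtain s where s: "r = [:- c, 1:] * s" by (auto simp: poly_eq_0_iff_dvd)
  have s0: "s \<noteq> 0" using r s by auto
  have ds: "degree s < degree r" unfolding s using s0 by (subst degree_mult_eq) auto
  let ?y = "op_eval T s z"
  have "?y \<noteq> 0"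
  proof
    assume "?y = 0"
    then have "P (degree s)" using s0 z by (auto simp: P_def)
    then show False using ds r(2) not_less_Least by metis
  qed
  moreover have "?y \<in> W" by (rule op_eval_in[OF T W z(1)])
  moreover have "r = smult (- c) s + pCons 0 s" by (simp add: s)
  then have "0 = scale (- c) ?y + T ?y"
    using z(3) by (simp only: op_eval_add op_eval_smult op_eval_pCons_0[OF T W z(1)])
  then have "T ?y = scale c ?y" by (simp add: eq_neg_iff_add_eq_0 add.commute)
  ultimately show ?thesis by blast
qed

text \<open>
  Jacobson density over an algebraically closed field.  If every \<open>U \<in> S\<close> killing \<open>Xs \<union> {x}\<close> also kills
  \<open>w\<close>, then \<open>U x \<mapsto> U w\<close> (for \<open>U\<close> killing \<open>Xs\<close>) commutes with \<open>S\<close>, hence is a scalar by Schur's lemma.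
\<close>
lemma density:
  fixes scale :: "'l::alg_closed_field \<Rightarrow> 'v::ab_group_add \<Rightarrow> 'v"
  assumes "vector_space scale"
    and W: "module.subspace scale W" and F: "finite F" "W \<subseteq> module.span scale F"
    and lin: "\<And>U. U \<in> S \<Longrightarrow> linear_on scale W U"
    and add: "\<And>U V. U \<in> S \<Longrightarrow> V \<in> S \<Longrightarrow> (\<lambda>w. U w + V w) \<in> S"
    and scl: "\<And>c U. U \<in> S \<Longrightarrow> (\<lambda>w. scale c (U w)) \<in> S"
    and comp: "\<And>U V. U \<in> S \<Longrightarrow> V \<in> S \<Longrightarrow> (\<lambda>w. U (V w)) \<in> S"
    and irred: "\<And>w y. w \<in> W \<Longrightarrow> w \<noteq> 0 \<Longrightarrow> y \<in> W \<Longrightarrow> \<exists>U\<in>S. U w = y"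
    and Xs: "finite Xs" "Xs \<subseteq> W" and w: "w \<in> W" "w \<notin> module.span scale Xs"
  shows "\<exists>U\<in>S. (\<forall>x\<in>Xs. U x = 0) \<and> U w \<noteq> 0"
  using Xs w
proof -
  interpret scalar_space scale using assms(1) by (rule scalar_space.intro)
  have diff: "(\<lambda>w. U w - V w) \<in> S" if "U \<in> S" "V \<in> S" for U V
    using add[OF that(1) scl[OF that(2), of "- 1"]] by simp
  have in_W: "U y \<in> W" if "U \<in> S" "y \<in> W" for U y
    using linear_onD(1)[OF lin] that .
  have U0: "U 0 = 0" if "U \<in> S" for U
    using linear_on_0[OF lin[OF that] W] .
  show ?thesis using Xs w
  proof (induction Xs arbitrary: w rule: finite_induct)
    case empty
    then have "w \<noteq> 0" by auto
    then obtain U where "U \<in> S" "U w = w" using irred[of w w] empty by blast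
    with \<open>w \<noteq> 0\<close> show ?case by (intro bexI[of _ U]) auto
  next
    case (insert x Xs)
    have x: "x \<in> W" and XW: "Xs \<subseteq> W" using insert.prems by auto
    show ?case
    proof (cases "x \<in> span Xs")
      case True
      then have "w \<notin> span Xs" using insert.prems span_redundant by auto
      then obtain U where U: "U \<in> S" "\<forall>x\<in>Xs. U x = 0" "U w \<noteq> 0"
        using insert.IH[OF XW] insert.prems by blast
      obtain r where "x = (\<Sum>v\<in>Xs. scale (r v) v)"
        using True unfolding span_finite[OF insert.hyps(1)] by auto
      then have "U x = (\<Sum>v\<in>Xs. U (scale (r v) v))"
        using linear_on_sum[OF lin[OF U(1)] W, of Xs "\<lambda>v. scale (r v) v"] XW subspace_scale[OF W] by auto
      also have "\<dots> = 0"
        using U(2) XW linear_onD(3)[OF lin[OF U(1)]] by (intro sum.neutral) auto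
      finally show ?thesis using U by auto
    next
      case False
      define J where "J = {U\<in>S. \<forall>x\<in>Xs. U x = 0}"
      have J_S: "U \<in> S" if "U \<in> J" for U using that by (simp add: J_def)
      have J_comp: "(\<lambda>w. V (U w)) \<in> J" if "V \<in> S" "U \<in> J" for U V
        using that comp U0 by (auto simp: J_def)
      obtain U0 where U0: "U0 \<in> J" "U0 x \<noteq> 0"
        using insert.IH[OF XW x False] by (auto simp: J_def)
      \<comment> \<open>\<open>J\<close> absorbs \<open>S\<close> from the left, so it suffices to
        move the one nonzero image \<open>U0 x\<close> to \<open>y\<close> by an element of
        \<open>S\<close>.\<close>
      have onto: "\<exists>U\<in>J. U x = y" if y: "y \<in> W" for y
        proof -
          obtain V where V: "V \<in> S" "V (U0 x) = y"
            using irred[OF in_W[OF J_S[OF U0(1)] x] U0(2) y] by blast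
          then show ?thesis using J_comp[OF V(1) U0(1)] by (intro bexI[of _ "\<lambda>w. V (U0 w)"])
        qed
      show ?thesis
      proof (rule ccontr)
        assume contra: "\<not> ?thesis"
        have contraD: "U w = 0" if "U \<in> S" "\<forall>y\<in>insert x Xs. U y = 0" for U
          using contra that by blast
        have kills: "U w = V w" if "U \<in> J" "V \<in> J" "U x = V x" for U V
        proof -
          have "U w - V w = 0"
          proof (rule contraD)
            show "(\<lambda>w. U w - V w) \<in> S" using that by (intro diff J_S)
            show "\<forall>y\<in>insert x Xs. U y - V y = 0" using that by (auto simp: J_def)
          qed
          then show ?thesis by simp
        qed
        \<comment> \<open>The choice does not matter: by \<open>kills\<close>, members of
          \<open>J\<close> that agree at \<open>x\<close> agree at \<open>w\<close>.\<close>
        define \<theta> where "\<theta> y = (SOME U. U \<in> J \<and> U x = y) w" for y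
        have \<theta>: "\<theta> (U x) = U w" if "U \<in> J" for U
        proof -
          let ?V = "SOME V. V \<in> J \<and> V x = U x"
          have V: "?V \<in> J \<and> ?V x = U x" by (rule someI[of _ U]) (use that in simp)
          show ?thesis unfolding \<theta>_def
            by (rule kills[OF conjunct1[OF V] that conjunct2[OF V]])
        qed
        have J_add: "(\<lambda>w. U w + V w) \<in> J" if "U \<in> J" "V \<in> J" for U V
          using that add by (auto simp: J_def)
        have J_scl: "(\<lambda>w. scale c (U w)) \<in> J" if "U \<in> J" for U c
          using that scl by (auto simp: J_def)
        have "linear_on scale W \<theta>"
          unfolding linear_on_def
        proof (intro conjI ballI allI)
          show "\<theta> ` W \<subseteq> W"
          proof
            fix v assume "v \<in> \<theta> ` W"
            then obtain y where y: "y \<in> W" "v = \<theta> y" by auto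
            then obtain U where "U \<in> J" "U x = y" using onto by blast
            then show "v \<in> W" using y \<theta>[of U] in_W[OF J_S] insert.prems by auto
          qed
        next
          fix y z assume "y \<in> W" "z \<in> W"
          then obtain U V where "U \<in> J" "U x = y" "V \<in> J" "V x = z" using onto by metis
          then show "\<theta> (y + z) = \<theta> y + \<theta> z"
            using \<theta>[OF J_add[of U V]] \<theta>[of U] \<theta>[of V] by simp
        next
          fix c y assume "y \<in> W"
          then obtain U where "U \<in> J" "U x = y" using onto by metis
          then show "\<theta> (scale c y) = scale c (\<theta> y)"
            using \<theta>[OF J_scl[of U c]] \<theta>[of U] by simp
        qed
        then obtain c z where z: "z \<in> W" "z \<noteq> 0" "\<theta> z = scale c z"
          using eigenvector_exists[OF assms(1) W F _ in_W[OF J_S[OF U0(1)] x] U0(2)] by blast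
        obtain U1 where U1: "U1 \<in> J" "U1 x = z" using onto z by blast
        have U1w: "U1 w = scale c z" using \<theta>[OF U1(1)] U1(2) z by simp
        have scalar: "U w = scale c (U x)" if U: "U \<in> J" for U
        proof -
          obtain V where V: "V \<in> S" "V z = U x"
            using irred[OF z(1,2) in_W[OF J_S[OF U] x]] by blast
          \<comment> \<open>Both \<open>U\<close> and the composite of \<open>V\<close> with
            \<open>U1\<close> lie in \<open>J\<close>, and they agree at \<open>x\<close>.\<close>
          have "U w = V (U1 w)"
            using kills[OF U J_comp[OF V(1) U1(1)]] V U1 by simp
          also have "\<dots> = scale c (U x)"
            using linear_onD(3)[OF lin[OF V(1)] z(1)] V U1w by simp
          finally show ?thesis .
        qed
        \<comment> \<open>Every \<open>U\<close> that kills \<open>Xs\<close> satisfies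
          \<open>U w = scale c (U x)\<close> and so kills this difference. The induction hypothesis
          then puts the difference into the span of \<open>Xs\<close>, against the choice of
          \<open>w\<close>.\<close>
        let ?w = "w - scale c x"
        have w': "?w \<in> W" using insert.prems x by (intro subspace_diff[OF W] subspace_scale[OF W]) auto
        have "\<not> (\<exists>U\<in>S. (\<forall>x\<in>Xs. U x = 0) \<and> U ?w \<noteq> 0)"
        proof (intro notI, elim bexE conjE)
          fix U assume U: "U \<in> S" "\<forall>x\<in>Xs. U x = 0" "U ?w \<noteq> 0"
          have "U w = U (?w + scale c x)" by simp
          also have "\<dots> = U ?w + scale c (U x)"
            by (simp only: linear_onD(2)[OF lin[OF U(1)] w' subspace_scale[OF W x]]
                linear_onD(3)[OF lin[OF U(1)] x])
          finally show False using scalar[of U] U by (simp add: J_def)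
        qed
        then have "?w \<in> span Xs" using insert.IH[OF XW w'] by blast
        then have "?w + scale c x \<in> span (insert x Xs)"
          by (intro span_add span_scale) (auto intro: span_base set_mp[OF span_mono])
        then show False using insert.prems by simp
      qed
    qed
  qed
qed

section \<open>Splitting central division algebras\<close>

lemma sum_fun_apply: "sum f I x = (\<Sum>i\<in>I. f i x)"
  by (induction I rule: infinite_finite_induct) simp_all

section \<open>Coordinates in finite-dimensional algebras\<close>

locale scalar_algebra = Ring.ring A for A :: "('a, 'm) ring_scheme" (structure) +
  fixes \<sigma> :: "'k::field \<Rightarrow> 'a"
  assumes scalar_closed [simp, intro]: "\<sigma> k \<in> carrier A"
    and scalar_add: "\<sigma> (k + l) = \<sigma> k \<oplus> \<sigma> l"
    and scalar_mult: "\<sigma> (k * l) = \<sigma> k \<otimes> \<sigma> l"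
    and scalar_1 [simp]: "\<sigma> 1 = \<one>"
    and scalar_central: "x \<in> carrier A \<Longrightarrow> \<sigma> k \<otimes> x = x \<otimes> \<sigma> k"
    and one_neq_zero_alg: "\<one> \<noteq> \<zero>"
begin

lemma scalar_0 [simp]: "\<sigma> 0 = \<zero>"
  using scalar_add[of 0 0] by (metis add.r_cancel_one' add_0 scalar_closed)

lemma scalar_eq_0_iff [simp]: "\<sigma> k = \<zero> \<longleftrightarrow> k = 0"
proof
  assume k: "\<sigma> k = \<zero>"
  show "k = 0"
  proof (rule ccontr)
    assume "k \<noteq> 0"
    then have "\<one> = \<sigma> (inverse k * k)" by simp
    also have "\<dots> = \<zero>" by (simp only: scalar_mult k) simp
    finally show False using one_neq_zero_alg by simp
  qed
qed simp

end

locale fd_algebra = scalar_algebra A \<sigma>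
  for A :: "('a, 'm) ring_scheme" (structure) and \<sigma> :: "'k::field \<Rightarrow> 'a" +
  fixes B :: "'a set"
  assumes basis: "is_alg_basis A \<sigma> B"
begin

lemma fin_B [simp]: "finite B" and B_carrier: "b \<in> B \<Longrightarrow> b \<in> carrier A"
  and B_unique: "x \<in> carrier A \<Longrightarrow>
    \<exists>!c. (\<forall>b. b \<notin> B \<longrightarrow> c b = 0) \<and> x = (\<Oplus>b\<in>B. \<sigma> (c b) \<otimes> b)"
  using basis by (auto simp: is_alg_basis_def)

definition coord :: "'a \<Rightarrow> 'a \<Rightarrow> 'k" where
  "coord x = (THE c. (\<forall>b. b \<notin> B \<longrightarrow> c b = 0) \<and> x = (\<Oplus>b\<in>B. \<sigma> (c b) \<otimes> b))"

lemma lincomb_closed: "(\<lambda>b. \<sigma> (c b) \<otimes> b) \<in> B \<rightarrow> carrier A"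
  using B_carrier by auto

lemma lincomb_in: "(\<Oplus>b\<in>B. \<sigma> (c b) \<otimes> b) \<in> carrier A"
  using lincomb_closed by (rule finsum_closed)

lemma coord_outside: "x \<in> carrier A \<Longrightarrow> b \<notin> B \<Longrightarrow> coord x b = 0"
  and coord_sum: "x \<in> carrier A \<Longrightarrow> (\<Oplus>b\<in>B. \<sigma> (coord x b) \<otimes> b) = x"
  using theI'[OF B_unique, of x] unfolding coord_def by auto

lemma coord_eqI:
  assumes "\<And>b. b \<notin> B \<Longrightarrow> c b = 0" "x = (\<Oplus>b\<in>B. \<sigma> (c b) \<otimes> b)"
  shows "coord x = c"
  unfolding coord_def using assms lincomb_in[of c] by (intro the1_equality B_unique) auto

lemma coord_lincomb:
  assumes "\<And>b. b \<notin> B \<Longrightarrow> c b = 0"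
  shows "coord (\<Oplus>b\<in>B. \<sigma> (c b) \<otimes> b) = c"
  by (rule coord_eqI) (use assms in auto)

lemma coord_add:
  assumes "x \<in> carrier A" "y \<in> carrier A"
  shows "coord (x \<oplus> y) b = coord x b + coord y b"
proof -
  have "coord (x \<oplus> y) = (\<lambda>b. coord x b + coord y b)"
  proof (rule coord_eqI)
    have "x \<oplus> y = (\<Oplus>b\<in>B. \<sigma> (coord x b) \<otimes> b) \<oplus> (\<Oplus>b\<in>B. \<sigma> (coord y b) \<otimes> b)"
      using assms by (simp add: coord_sum)
    also have "\<dots> = (\<Oplus>b\<in>B. \<sigma> (coord x b) \<otimes> b \<oplus> \<sigma> (coord y b) \<otimes> b)"
      by (rule finsum_addf[symmetric]; rule lincomb_closed)
    also have "\<dots> = (\<Oplus>b\<in>B. \<sigma> (coord x b + coord y b) \<otimes> b)"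
      by (rule finsum_cong') (auto simp: scalar_add l_distr B_carrier)
    finally show "x \<oplus> y = \<dots>" .
  qed (use assms in \<open>simp add: coord_outside\<close>)
  then show ?thesis by simp
qed

lemma coord_scale:
  assumes "x \<in> carrier A"
  shows "coord (\<sigma> k \<otimes> x) b = k * coord x b"
proof -
  have "coord (\<sigma> k \<otimes> x) = (\<lambda>b. k * coord x b)"
  proof (rule coord_eqI)
    have "\<sigma> k \<otimes> x = \<sigma> k \<otimes> (\<Oplus>b\<in>B. \<sigma> (coord x b) \<otimes> b)"
      using assms by (simp add: coord_sum)
    also have "\<dots> = (\<Oplus>b\<in>B. \<sigma> k \<otimes> (\<sigma> (coord x b) \<otimes> b))"
      by (rule finsum_rdistr) (auto simp: B_carrier)
    also have "\<dots> = (\<Oplus>b\<in>B. \<sigma> (k * coord x b) \<otimes> b)"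
      by (rule finsum_cong') (auto simp: scalar_mult m_assoc B_carrier)
    finally show "\<sigma> k \<otimes> x = \<dots>" .
  qed (use assms in \<open>simp add: coord_outside\<close>)
  then show ?thesis by simp
qed

lemma coord_zero: "coord \<zero> b = 0"
  using coord_scale[of \<zero> 0 b] by simp

lemma coord_finsum:
  assumes "finite I" "f \<in> I \<rightarrow> carrier A"
  shows "coord (\<Oplus>i\<in>I. f i) b = (\<Sum>i\<in>I. coord (f i) b)"
  using assms
  by (induction I rule: finite_induct) (simp_all add: coord_zero coord_add finsum_closed Pi_def)

lemma coord_mult:
  assumes x: "x \<in> carrier A" and y: "y \<in> carrier A"
  shows "coord (x \<otimes> y) c = (\<Sum>b\<in>B. coord y b * coord (x \<otimes> b) c)"
proof -
  have "x \<otimes> y = x \<otimes> (\<Oplus>b\<in>B. \<sigma> (coord y b) \<otimes> b)"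
    using y by (simp add: coord_sum)
  also have "\<dots> = (\<Oplus>b\<in>B. x \<otimes> (\<sigma> (coord y b) \<otimes> b))"
    using x by (intro finsum_rdistr) (auto simp: B_carrier)
  also have "\<dots> = (\<Oplus>b\<in>B. \<sigma> (coord y b) \<otimes> (x \<otimes> b))"
    using x by (intro finsum_cong')
      (auto simp: B_carrier m_assoc[symmetric] scalar_central[OF x, symmetric])
  finally show ?thesis
    using x by (simp add: coord_finsum coord_scale B_carrier Pi_def)
qed

lemma coord_mult_left:
  assumes x: "x \<in> carrier A" and y: "y \<in> carrier A"
  shows "coord (x \<otimes> y) c = (\<Sum>b\<in>B. coord x b * coord (b \<otimes> y) c)"
proof -
  have "x \<otimes> y = (\<Oplus>b\<in>B. \<sigma> (coord x b) \<otimes> b) \<otimes> y"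
    using x by (simp add: coord_sum)
  also have "\<dots> = (\<Oplus>b\<in>B. \<sigma> (coord x b) \<otimes> b \<otimes> y)"
    using y by (intro finsum_ldistr) (auto simp: B_carrier)
  also have "\<dots> = (\<Oplus>b\<in>B. \<sigma> (coord x b) \<otimes> (b \<otimes> y))"
    using y by (intro finsum_cong') (auto simp: B_carrier m_assoc)
  finally show ?thesis
    using y by (simp add: coord_finsum coord_scale B_carrier Pi_def)
qed

end

text \<open>
  An element of \<open>A \<otimes> L\<close> is represented by its coordinate function with respect to \<open>B\<close>; functions not
  vanishing outside \<open>B\<close> are junk.
\<close>

locale fd_algebra_ext = fd_algebra A \<sigma> B + field_hom \<iota>
  for A :: "('a, 'm) ring_scheme" (structure) and \<sigma> :: "'k::field \<Rightarrow> 'a" and B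
    and \<iota> :: "'k \<Rightarrow> 'l::alg_closed_field"
begin

definition scale :: "'l \<Rightarrow> ('a \<Rightarrow> 'l) \<Rightarrow> 'a \<Rightarrow> 'l" where
  "scale c f = (\<lambda>x. c * f x)"

text \<open>Left multiplication by x \<otimes> 1 on A \<otimes> L, in coordinates.\<close>

definition act :: "'a \<Rightarrow> ('a \<Rightarrow> 'l) \<Rightarrow> 'a \<Rightarrow> 'l" where
  "act x f = (\<lambda>c. \<Sum>b\<in>B. f b * \<iota> (coord (x \<otimes> b) c))"

text \<open>Left multiplication by the general element of A \<otimes> L, the sum of the a \<otimes>
  \<open>l a\<close> over \<open>a\<close> in \<open>B\<close>.\<close>

definition act_comb :: "('a \<Rightarrow> 'l) \<Rightarrow> ('a \<Rightarrow> 'l) \<Rightarrow> 'a \<Rightarrow> 'l" where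
  "act_comb l f = (\<lambda>c. \<Sum>a\<in>B. l a * act a f c)"

sublocale V: scalar_space scale
  by unfold_locales (auto simp: scale_def fun_eq_iff algebra_simps)

lemma act_add: "act x (f + h) = act x f + act x h"
  and act_scale: "act x (scale k f) = scale k (act x f)"
  by (simp_all add: act_def scale_def fun_eq_iff algebra_simps sum.distrib sum_distrib_left)

lemma act_sum: "act x (sum f I) = (\<Sum>i\<in>I. act x (f i))"
proof (induction I rule: infinite_finite_induct)
  case (insert i I)
  show ?case by (simp only: sum.insert[OF insert.hyps] act_add insert.IH)
qed (simp_all add: act_def fun_eq_iff)

lemma act_mult:
  assumes x: "x \<in> carrier A" and y: "y \<in> carrier A"
  shows "act x (act y f) = act (x \<otimes> y) f"
proof
  fix c
  have "act (x \<otimes> y) f c = (\<Sum>b\<in>B. f b * (\<Sum>b'\<in>B. \<iota> (coord (y \<otimes> b) b') * \<iota> (coord (x \<otimes> b') c)))"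
    unfolding act_def
  proof (rule sum.cong)
    fix b assume b: "b \<in> B"
    have "\<iota> (coord (x \<otimes> y \<otimes> b) c) = \<iota> (coord (x \<otimes> (y \<otimes> b)) c)"
      using x y b by (simp add: m_assoc B_carrier)
    then show "f b * \<iota> (coord (x \<otimes> y \<otimes> b) c)
        = f b * (\<Sum>b'\<in>B. \<iota> (coord (y \<otimes> b) b') * \<iota> (coord (x \<otimes> b') c))"
      using x y b by (simp add: coord_mult[of x "y \<otimes> b"] B_carrier hom_sum hom_mult)
  qed simp
  also have "\<dots> = (\<Sum>b\<in>B. \<Sum>b'\<in>B. f b * \<iota> (coord (y \<otimes> b) b') * \<iota> (coord (x \<otimes> b') c))"
    by (simp add: sum_distrib_left mult.assoc)
  also have "\<dots> = act x (act y f) c"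
    unfolding act_def by (subst sum.swap) (simp add: sum_distrib_right)
  finally show "act x (act y f) c = act (x \<otimes> y) f c" by simp
qed

lemma act_expand:
  assumes "x \<in> carrier A"
  shows "act x f = act_comb (\<lambda>a. \<iota> (coord x a)) f"
proof
  fix c
  have "act x f c = (\<Sum>b\<in>B. \<Sum>a\<in>B. f b * (\<iota> (coord x a) * \<iota> (coord (a \<otimes> b) c)))"
    unfolding act_def using assms
    by (intro sum.cong refl) (simp add: coord_mult_left B_carrier hom_sum hom_mult sum_distrib_left)
  also have "\<dots> = act_comb (\<lambda>a. \<iota> (coord x a)) f c"
    unfolding act_comb_def act_def
    by (subst sum.swap) (simp add: sum_distrib_left mult_ac)
  finally show "act x f c = act_comb (\<lambda>a. \<iota> (coord x a)) f c" .
qed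

lemma act_plus: "x \<in> carrier A \<Longrightarrow> y \<in> carrier A \<Longrightarrow> act (x \<oplus> y) f = act x f + act y f"
  by (simp add: act_expand fun_eq_iff act_comb_def coord_add hom_add algebra_simps sum.distrib)

lemma act_scalar_mult: "x \<in> carrier A \<Longrightarrow> act (\<sigma> k \<otimes> x) f = scale (\<iota> k) (act x f)"
  by (simp add: act_expand fun_eq_iff act_comb_def coord_scale hom_mult scale_def sum_distrib_left mult.assoc)

text \<open>The coordinate functions without junk: this is A \<otimes> L itself.\<close>

definition W0 :: "('a \<Rightarrow> 'l) set" where "W0 = {f. \<forall>b. b \<notin> B \<longrightarrow> f b = 0}"

lemma act_in_W0:
  assumes "x \<in> carrier A"
  shows "act x f \<in> W0"
  using assms by (auto simp: W0_def act_def coord_outside B_carrier)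

lemma coord_basis:
  assumes "b \<in> B"
  shows "coord b = (\<lambda>c. if c = b then 1 else 0)"
proof (rule coord_eqI)
  have "(\<Oplus>c\<in>B. \<sigma> (if c = b then 1 else 0) \<otimes> c) = (\<Oplus>c\<in>B. if b = c then c else \<zero>)"
    by (rule finsum_cong') (auto simp: B_carrier)
  also have "\<dots> = b"
    using assms by (intro add.finprod_singleton) (auto simp: B_carrier)
  finally show "b = (\<Oplus>c\<in>B. \<sigma> (if c = b then 1 else 0) \<otimes> c)" by simp
qed (use assms in auto)

lemma act_one:
  assumes "f \<in> W0"
  shows "act \<one> f = f"
proof
  fix c
  have "act \<one> f c = (\<Sum>b\<in>B. if c = b then f b else 0)"
    unfolding act_def by (intro sum.cong refl) (simp add: B_carrier coord_basis)
  then show "act \<one> f c = f c" using assms by (simp add: W0_def)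
qed

lemma W0_subspace: "V.subspace W0"
  by (rule V.subspaceI) (auto simp: W0_def scale_def)

lemma W0_span: "W0 \<subseteq> V.span ((\<lambda>b c. if c = b then 1 else 0) ` B)"
proof
  fix f assume f: "f \<in> W0"
  have "f = (\<Sum>b\<in>B. scale (f b) (\<lambda>c. if c = b then 1 else 0))"
  proof
    fix c
    have "(\<Sum>b\<in>B. scale (f b) (\<lambda>c. if c = b then 1 else 0)) c = (\<Sum>b\<in>B. if c = b then f b else 0)"
      unfolding sum_fun_apply scale_def by (intro sum.cong refl) simp
    then show "f c = (\<Sum>b\<in>B. scale (f b) (\<lambda>c. if c = b then 1 else 0)) c"
      using f by (simp add: W0_def)
  qed
  also have "\<dots> \<in> V.span ((\<lambda>b c. if c = b then 1 else 0) ` B)"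
    by (intro V.span_sum V.span_scale V.span_base) simp
  finally show "f \<in> \<dots>" .
qed

lemma act_comb_in_W0: "act_comb l f \<in> W0"
  using act_in_W0[OF B_carrier] by (auto simp: W0_def act_comb_def)

lemma act_comb_eq: "act_comb l f = (\<Sum>a\<in>B. scale (l a) (act a f))"
  by (simp add: act_comb_def fun_eq_iff sum_fun_apply scale_def)

lemma act_comb_add_left: "act_comb l f + act_comb k f = act_comb (l + k) f"
  and act_comb_scale_left: "scale r (act_comb l f) = act_comb (scale r l) f"
  by (simp_all add: act_comb_def fun_eq_iff scale_def algebra_simps sum.distrib sum_distrib_left)

lemma act_comb_sum_left: "(\<Sum>i\<in>I. act_comb (l i) f) = act_comb (\<Sum>i\<in>I. l i) f"
proof (induction I rule: infinite_finite_induct)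
  case (insert i I)
  show ?case by (simp only: sum.insert[OF insert.hyps] act_comb_add_left[symmetric] insert.IH)
qed (simp_all add: act_comb_def fun_eq_iff)

text \<open>Closure of A \<otimes> L under multiplication; the witness \<open>r\<close> is read off
  from the structure constants \<open>coord (a \<otimes> b)\<close>. Later steps use only that such
  an \<open>r\<close> exists.\<close>

lemma act_comb_comp: "\<exists>r. \<forall>f. act_comb l (act_comb k f) = act_comb r f"
proof (intro exI allI)
  fix f
  have "act_comb l (act_comb k f) = (\<Sum>a\<in>B. scale (l a) (\<Sum>b\<in>B. scale (k b) (act a (act b f))))"
    by (simp add: act_comb_eq act_sum act_scale)
  also have "\<dots> = (\<Sum>a\<in>B. scale (l a) (\<Sum>b\<in>B. scale (k b) (act_comb (\<lambda>c. \<iota> (coord (a \<otimes> b) c)) f)))"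
    by (intro sum.cong refl arg_cong[of _ _ "scale _"])
       (simp only: act_mult[OF B_carrier B_carrier] act_expand[OF m_closed[OF B_carrier B_carrier]])
  also have "\<dots> = act_comb (\<Sum>a\<in>B. scale (l a) (\<Sum>b\<in>B. scale (k b) (\<lambda>c. \<iota> (coord (a \<otimes> b) c)))) f"
    by (simp add: act_comb_scale_left act_comb_sum_left)
  finally show "act_comb l (act_comb k f) = \<dots>" .
qed

end

section \<open>Minimal left ideals of A \<otimes> L\<close>

context fd_algebra_ext
begin

text \<open>These are the nonzero left ideals of A \<otimes> L: the subspace condition takes care of
  L, so stability is stated for elements of A only.\<close>

definition submodule :: "('a \<Rightarrow> 'l) set \<Rightarrow> bool" where
  "submodule W \<longleftrightarrow> V.subspace W \<and> W \<subseteq> W0 \<and> W \<noteq> {0} \<and> (\<forall>x\<in>carrier A. \<forall>w\<in>W. act x w \<in> W)"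

lemma submodule_W0: "submodule W0"
proof -
  have "B \<noteq> {}"
  proof
    assume "B = {}"
    then have "\<one> = \<zero>" using coord_sum[OF one_closed] by simp
    then show False using one_neq_zero_alg by simp
  qed
  then obtain b where b: "b \<in> B" by blast
  define f where "f = (\<lambda>c. if c = b then 1 else (0::'l))"
  have "f \<in> W0" "f \<noteq> 0" using b by (auto simp: f_def W0_def fun_eq_iff)
  then show ?thesis unfolding submodule_def using W0_subspace act_in_W0 by auto
qed

lemma finite_basis_in_W0:
  assumes "W \<subseteq> W0" "V.independent b" "b \<subseteq> W"
  shows "finite b"
  using V.independent_span_bound[OF _ assms(2), of "(\<lambda>b c. if c = b then 1 else 0) ` B"]
    assms W0_span by auto

text \<open>A left ideal of least dimension works: a basis of a proper subideal, together with a
  vector outside it, would be too large an independent subset of \<open>W\<close>.\<close>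

lemma minimal_submodule: "\<exists>W. submodule W \<and> (\<forall>W'. submodule W' \<and> W' \<subseteq> W \<longrightarrow> W' = W)"
proof -
  define P where "P n \<longleftrightarrow> (\<exists>W. submodule W \<and> V.dim W = n)" for n
  have "P (V.dim W0)" using submodule_W0 by (auto simp: P_def)
  then have "P (LEAST n. P n)" by (rule LeastI)
  then obtain W where W: "submodule W" "V.dim W = (LEAST n. P n)" by (auto simp: P_def)
  have "W' = W" if W': "submodule W'" "W' \<subseteq> W" for W'
  proof (rule ccontr)
    assume "W' \<noteq> W"
    then obtain w where w: "w \<in> W" "w \<notin> W'" using W' by blast
    have "P (V.dim W')" using W' by (auto simp: P_def)
    then have le: "V.dim W \<le> V.dim W'" unfolding W(2) by (rule Least_le)
    obtain b where b: "b \<subseteq> W" "V.independent b" "W \<subseteq> V.span b" "card b = V.dim W"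
      using V.basis_exists by blast
    obtain b' where b': "b' \<subseteq> W'" "V.independent b'" "W' \<subseteq> V.span b'" "card b' = V.dim W'"
      using V.basis_exists by blast
    have fin: "finite b" "finite b'"
      using finite_basis_in_W0[of W b] finite_basis_in_W0[of W' b'] W(1) W'(1) b b'
      by (auto simp: submodule_def)
    have "V.span b' \<subseteq> W'"
      using W'(1) b'(1) by (intro V.span_minimal) (auto simp: submodule_def)
    then have w': "w \<notin> V.span b'" using w by blast
    then have "V.independent (insert w b')" using b' by (intro V.independent_insertI)
    then have "card (insert w b') \<le> card b"
      using V.independent_span_bound[OF fin(1), of "insert w b'"] b(3) b'(1) W'(2) w(1) by blast
    moreover have "w \<notin> b'" using w b' by blast
    ultimately show False using le b b' fin by simp
  qed
  then show ?thesis using W by blast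
qed

lemma act_comb_in:
  assumes "submodule W" "w \<in> W"
  shows "act_comb l w \<in> W"
  unfolding act_comb_eq using assms B_carrier
  by (intro V.subspace_sum V.subspace_scale) (auto simp: submodule_def)

lemma act_comb_linear: "act_comb l (f + h) = act_comb l f + act_comb l h"
  "act_comb l (scale k f) = scale k (act_comb l f)"
  by (simp_all only: act_comb_eq act_add act_scale V.scale_right_distrib sum.distrib
      V.scale_sum_right V.scale_left_commute)

text \<open>The multiples of \<open>w\<close> form a left ideal inside \<open>W\<close> that
  contains \<open>w\<close>, so minimality makes it all of \<open>W\<close>. This is the
  irreducibility required by \<open>density\<close>.\<close>

lemma minimal_submodule_cyclic:
  assumes W: "submodule W" and min: "\<And>W'. submodule W' \<Longrightarrow> W' \<subseteq> W \<Longrightarrow> W' = W"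
    and w: "w \<in> W" "w \<noteq> 0" and y: "y \<in> W"
  shows "\<exists>l. act_comb l w = y"
proof -
  let ?W = "range (\<lambda>l. act_comb l w)"
  have one: "w = act_comb (\<lambda>a. \<iota> (coord \<one> a)) w"
    using W w act_one[of w] act_expand[of \<one> w] by (auto simp: submodule_def)
  have "submodule ?W"
    unfolding submodule_def
  proof (intro conjI ballI)
    show "V.subspace ?W"
    proof (rule V.subspaceI)
      show "0 \<in> ?W" by (rule range_eqI[of _ _ 0]) (simp add: act_comb_def fun_eq_iff)
    qed (auto simp: act_comb_add_left act_comb_scale_left)
    show "?W \<subseteq> W0" using act_comb_in_W0 by auto
    have "w \<in> ?W" by (rule range_eqI) (rule one)
    then show "?W \<noteq> {0}" using w by auto
    fix x v assume x: "x \<in> carrier A" and "v \<in> ?W"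
    then obtain l where l: "v = act_comb l w" by auto
    obtain r where "\<forall>f. act_comb (\<lambda>a. \<iota> (coord x a)) (act_comb l f) = act_comb r f"
      using act_comb_comp by blast
    then have "act x v = act_comb r w" using x l by (simp add: act_expand)
    then show "act x v \<in> ?W" by simp
  qed
  moreover have "?W \<subseteq> W" using act_comb_in[OF W w(1)] by auto
  ultimately have "?W = W" by (rule min)
  then have "y \<in> ?W" using y by simp
  then show ?thesis by blast
qed

end

section \<open>Central division algebras: faithfulness and splitting\<close>

locale central_division_fd_algebra = fd_algebra_ext A \<sigma> B \<iota>
  for A :: "('a, 'm) ring_scheme" (structure) and \<sigma> :: "'k::field \<Rightarrow> 'a" and B
    and \<iota> :: "'k \<Rightarrow> 'l::alg_closed_field" +
  assumes division: "x \<in> carrier A \<Longrightarrow> x \<noteq> \<zero> \<Longrightarrow> \<exists>y\<in>carrier A. y \<otimes> x = \<one>"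
    and center: "x \<in> carrier A \<Longrightarrow> (\<And>y. y \<in> carrier A \<Longrightarrow> x \<otimes> y = y \<otimes> x) \<Longrightarrow> \<exists>k. x = \<sigma> k"
begin

text \<open>
  Faithfulness of the action of \<open>A \<otimes> L\<close>: normalising one coefficient of a relation to \<open>1\<close> and taking
  commutators produces a shorter relation, so all coefficients are central.
\<close>
lemma act_faithful:
  fixes \<Lambda> :: "'l set"
  assumes W: "submodule W" and "finite \<Lambda>"
    and indep: "\<And>k. (\<Sum>l\<in>\<Lambda>. \<iota> (k l) * l) = 0 \<Longrightarrow> \<forall>l\<in>\<Lambda>. k l = 0"
    and "a \<in> \<Lambda> \<rightarrow> carrier A" "\<And>w. w \<in> W \<Longrightarrow> (\<Sum>l\<in>\<Lambda>. scale l (act (a l) w)) = 0"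
  shows "\<forall>l\<in>\<Lambda>. a l = \<zero>"
  using assms(2-)
proof (induction \<Lambda> arbitrary: a rule: finite_induct)
  case (insert l0 \<Lambda>)
  have IH_indep: "\<forall>l\<in>\<Lambda>. k l = 0" if "(\<Sum>l\<in>\<Lambda>. \<iota> (k l) * l) = 0" for k
  proof -
    have "(\<Sum>l\<in>\<Lambda>. \<iota> ((k(l0 := 0)) l) * l) = (\<Sum>l\<in>\<Lambda>. \<iota> (k l) * l)"
      using insert.hyps by (intro sum.cong) auto
    then have "(\<Sum>l\<in>insert l0 \<Lambda>. \<iota> ((k(l0 := 0)) l) * l) = 0"
      using that insert.hyps by simp
    from insert.prems(1)[OF this] show ?thesis using insert.hyps by (auto split: if_splits)
  qed
  have a0: "a l0 \<in> carrier A" and aL: "a \<in> \<Lambda> \<rightarrow> carrier A" using insert.prems(2) by auto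
  have act_0: "act \<zero> w = 0" for w by (simp add: act_def coord_zero fun_eq_iff B_carrier)
  show ?case
  proof (cases "a l0 = \<zero>")
    case True
    have "\<forall>l\<in>\<Lambda>. a l = \<zero>"
    proof (rule insert.IH[OF IH_indep aL])
      fix w assume "w \<in> W"
      from insert.prems(3)[OF this] show "(\<Sum>l\<in>\<Lambda>. scale l (act (a l) w)) = 0"
        by (simp only: sum.insert[OF insert.hyps] True act_0 V.scale_zero_right add_0)
    qed
    then show ?thesis using True by simp
  next
    case False
    then obtain y where y: "y \<in> carrier A" "y \<otimes> a l0 = \<one>" using division[OF a0] by blast
    define b where "b l = y \<otimes> a l" for l
    have b: "b l \<in> carrier A" if "l \<in> insert l0 \<Lambda>" for l
      using that y a0 aL by (auto simp: b_def)
    have b0: "b l0 = \<one>" using y by (simp add: b_def)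
    have rel: "(\<Sum>l\<in>insert l0 \<Lambda>. scale l (act (b l) w)) = 0" if w: "w \<in> W" for w
    proof -
      have "(\<Sum>l\<in>insert l0 \<Lambda>. scale l (act (b l) w)) = act y (\<Sum>l\<in>insert l0 \<Lambda>. scale l (act (a l) w))"
        unfolding act_sum act_scale b_def
        by (intro sum.cong refl arg_cong[of _ _ "scale _"] act_mult[symmetric] y)
           (use insert.prems(2) in auto)
      also have "\<dots> = 0" unfolding insert.prems(3)[OF w] by (simp add: act_def fun_eq_iff)
      finally show ?thesis .
    qed
    have comm: "b l \<otimes> z = z \<otimes> b l" if l: "l \<in> \<Lambda>" and z: "z \<in> carrier A" for l z
    proof -
      have "\<forall>l\<in>\<Lambda>. b l \<otimes> z \<ominus> z \<otimes> b l = \<zero>"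
      proof (rule insert.IH[OF IH_indep])
        show "(\<lambda>l. b l \<otimes> z \<ominus> z \<otimes> b l) \<in> \<Lambda> \<rightarrow> carrier A" using b z by auto
        fix w assume w: "w \<in> W"
        have zw: "act z w \<in> W" using W w z by (auto simp: submodule_def)
        have m: "act (b l \<otimes> z \<ominus> z \<otimes> b l) w = act (b l) (act z w) - act z (act (b l) w)"
          if "l \<in> insert l0 \<Lambda>" for l
        proof -
          have "act (b l \<otimes> z) w = act ((b l \<otimes> z \<ominus> z \<otimes> b l) \<oplus> z \<otimes> b l) w"
            using b[OF that] z by (simp add: a_minus_def a_assoc l_neg)
          also have "\<dots> = act (b l \<otimes> z \<ominus> z \<otimes> b l) w + act (z \<otimes> b l) w"
            using b[OF that] z by (intro act_plus) auto
          finally show ?thesis using b[OF that] z by (simp add: act_mult)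
        qed
        have "(\<Sum>l\<in>insert l0 \<Lambda>. scale l (act (b l \<otimes> z \<ominus> z \<otimes> b l) w))
            = (\<Sum>l\<in>insert l0 \<Lambda>. scale l (act (b l) (act z w)) - scale l (act z (act (b l) w)))"
          by (intro sum.cong refl) (simp only: m V.scale_right_diff_distrib)
        also have "\<dots> = (\<Sum>l\<in>insert l0 \<Lambda>. scale l (act (b l) (act z w)))
            - act z (\<Sum>l\<in>insert l0 \<Lambda>. scale l (act (b l) w))"
          by (simp only: sum_subtractf act_sum act_scale)
        also have "\<dots> = 0" unfolding rel[OF zw] rel[OF w] by (simp add: act_def fun_eq_iff)
        finally have "(\<Sum>l\<in>insert l0 \<Lambda>. scale l (act (b l \<otimes> z \<ominus> z \<otimes> b l) w)) = 0" .
        moreover have "b l0 \<otimes> z \<ominus> z \<otimes> b l0 = \<zero>" using z b0 by (simp add: a_minus_def r_neg)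
        ultimately show "(\<Sum>l\<in>\<Lambda>. scale l (act (b l \<otimes> z \<ominus> z \<otimes> b l) w)) = 0"
          by (simp only: sum.insert[OF insert.hyps] act_0 V.scale_zero_right add_0)
      qed
      then have "b l \<otimes> z \<ominus> z \<otimes> b l = \<zero>" using l by blast
      then show ?thesis using b l z by (simp add: r_right_minus_eq)
    qed
    have "\<exists>k. l \<in> insert l0 \<Lambda> \<longrightarrow> b l = \<sigma> k" for l
    proof (cases "l = l0")
      case True
      then show ?thesis using b0 by (intro exI[of _ 1]) simp
    next
      case False
      then show ?thesis using center[OF b[of l] comm[of l]] by blast
    qed
    then obtain k where k: "\<And>l. l \<in> insert l0 \<Lambda> \<Longrightarrow> b l = \<sigma> (k l)" by metis
    obtain w where w: "w \<in> W" "w \<noteq> 0"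
      using W V.subspace_0[of W] by (auto simp: submodule_def)
    have act_b: "act (b l) w = scale (\<iota> (k l)) w" if "l \<in> insert l0 \<Lambda>" for l
    proof -
      have "w \<in> W0" using W w by (auto simp: submodule_def)
      then show ?thesis using act_scalar_mult[OF one_closed, of "k l" w] k[OF that] by (simp add: act_one)
    qed
    \<comment> \<open>Once all \<open>b l\<close> are scalars, the relation at a single nonzero
      \<open>w\<close> is a relation over K among the elements of the independent set. It forces
      \<open>k l0 = 0\<close>, although \<open>b l0\<close> is the unit.\<close>
    have "0 = (\<Sum>l\<in>insert l0 \<Lambda>. scale l (act (b l) w))" using rel[OF w(1)] by simp
    also have "\<dots> = (\<Sum>l\<in>insert l0 \<Lambda>. scale (\<iota> (k l) * l) w)"
      by (intro sum.cong refl) (simp add: act_b mult.commute)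
    also have "\<dots> = scale (\<Sum>l\<in>insert l0 \<Lambda>. \<iota> (k l) * l) w"
      by (simp only: V.scale_sum_left)
    finally have "(\<Sum>l\<in>insert l0 \<Lambda>. \<iota> (k l) * l) = 0"
      using w(2) by (metis V.scale_eq_0_iff)
    from insert.prems(1)[OF this] have "k l0 = 0" by simp
    then show ?thesis using k[of l0] b0 one_neq_zero_alg by simp
  qed
qed simp

text \<open>A K-basis \<Lambda> chosen among the coefficients \<open>c b\<close> regroups the sum of
  the b \<otimes> \<open>c b\<close> as the sum of the \<open>a l\<close> \<otimes> l over l in
  \<Lambda>, with every \<open>a l\<close> in A. This is the form that \<open>act_faithful\<close>
  treats.\<close>

lemma act_comb_faithful:
  assumes W: "submodule W" and zero: "\<And>w. w \<in> W \<Longrightarrow> act_comb c w = 0"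
  shows "\<forall>b\<in>B. c b = 0"
proof -
  interpret K: vector_space "\<lambda>k l. \<iota> k * l"
    by unfold_locales (auto simp: algebra_simps hom_add hom_mult)
  obtain \<Lambda> where \<Lambda>: "\<Lambda> \<subseteq> c ` B" "K.independent \<Lambda>" "c ` B \<subseteq> K.span \<Lambda>"
    using K.maximal_independent_subset[of "c ` B"] by blast
  have fin: "finite \<Lambda>" using \<Lambda>(1) by (rule finite_subset) simp
  have "\<exists>k. b \<in> B \<longrightarrow> c b = (\<Sum>l\<in>\<Lambda>. \<iota> (k l) * l)" for b
    using \<Lambda>(3) unfolding K.span_finite[OF fin] by auto
  then obtain k where k: "\<And>b. b \<in> B \<Longrightarrow> c b = (\<Sum>l\<in>\<Lambda>. \<iota> (k b l) * l)" by metis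
  define a where "a l = (\<Oplus>b\<in>B. \<sigma> (if b \<in> B then k b l else 0) \<otimes> b)" for l
  have a: "a l \<in> carrier A" for l unfolding a_def by (rule lincomb_in)
  have coord_a: "coord (a l) b = k b l" if "b \<in> B" for l b
    unfolding a_def by (subst coord_lincomb) (use that in auto)
  have "\<forall>l\<in>\<Lambda>. a l = \<zero>"
  proof (rule act_faithful[OF W fin])
    show "\<forall>l\<in>\<Lambda>. r l = 0" if "(\<Sum>l\<in>\<Lambda>. \<iota> (r l) * l) = 0" for r
      using K.independentD[OF \<Lambda>(2) fin subset_refl that] by blast
    show "a \<in> \<Lambda> \<rightarrow> carrier A" using a by simp
    fix w assume w: "w \<in> W"
    have "(\<Sum>l\<in>\<Lambda>. scale l (act (a l) w)) = (\<Sum>l\<in>\<Lambda>. \<Sum>b\<in>B. scale (\<iota> (k b l) * l) (act b w))"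
      by (intro sum.cong refl)
         (simp add: act_expand[OF a] act_comb_eq V.scale_sum_right coord_a mult.commute)
    also have "\<dots> = (\<Sum>b\<in>B. scale (c b) (act b w))"
      by (subst sum.swap) (intro sum.cong refl, simp only: k V.scale_sum_left)
    also have "\<dots> = 0" using zero[OF w] by (simp only: act_comb_eq)
    finally show "(\<Sum>l\<in>\<Lambda>. scale l (act (a l) w)) = 0" .
  qed
  then have "k b l = 0" if "b \<in> B" "l \<in> \<Lambda>" for b l
    using coord_a[OF that(1), of l] that by (simp add: coord_zero)
  then show ?thesis using k by simp
qed

end

context central_division_fd_algebra
begin

lemma act_comb_0: "act_comb r 0 = 0"
  using act_comb_linear(2)[of r 0 0] by (simp only: V.scale_zero_left)

text \<open>Here \<open>n\<close> is the dimension of a minimal left ideal \<open>W\<close>, and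
  \<open>\<phi> a\<close> is the matrix of \<open>act a\<close> on \<open>W\<close> in the basis
  \<open>ws\<close>.\<close>

theorem splitting_exists: "\<exists>n \<phi>. is_splitting A \<sigma> \<iota> n \<phi>"
proof -
  obtain W where W: "submodule W" and min: "\<And>W'. submodule W' \<Longrightarrow> W' \<subseteq> W \<Longrightarrow> W' = W"
    using minimal_submodule by blast
  have subsp: "V.subspace W" and WW0: "W \<subseteq> W0" using W by (auto simp: submodule_def)
  have act_W: "act x w \<in> W" if "x \<in> carrier A" "w \<in> W" for x w
    using W that by (auto simp: submodule_def)
  obtain b where b: "b \<subseteq> W" "V.independent b" "W \<subseteq> V.span b"
    by (rule V.basis_exists[of W])
  have fin_b: "finite b" using finite_basis_in_W0[OF WW0 b(2,1)] .
  define n where "n = card b"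
  obtain ws where "bij_betw ws {0..<card b} b" using ex_bij_betw_nat_finite[OF fin_b] by blast
  then have ws: "bij_betw ws {..<n} b" by (simp add: n_def lessThan_atLeast0)
  have ws_b: "ws k \<in> b" if "k < n" for k using bij_betwE[OF ws] that by simp
  have ws_W: "ws k \<in> W" if "k < n" for k using ws_b[OF that] b(1) by blast
  define comb where "comb v = (\<Sum>i<n. scale (v i) (ws i))" for v
  have comb_inj: "\<forall>i<n. v i = u i" if eq: "comb v = comb u" for v u
  proof (intro allI impI)
    fix i assume i: "i < n"
    define inv_ws where "inv_ws = the_inv_into {..<n} ws"
    have inv_ws: "inv_ws (ws i) = i" if "i < n" for i
      unfolding inv_ws_def using ws that by (intro the_inv_into_f_f) (auto simp: bij_betw_def)
    have "(\<Sum>y\<in>b. scale (v (inv_ws y) - u (inv_ws y)) y)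
        = (\<Sum>i<n. scale (v (inv_ws (ws i)) - u (inv_ws (ws i))) (ws i))"
      by (rule sum.reindex_bij_betw[OF ws, symmetric])
    also have "\<dots> = (\<Sum>i<n. scale (v i) (ws i) - scale (u i) (ws i))"
      by (intro sum.cong refl) (simp only: lessThan_iff inv_ws V.scale_left_diff_distrib)
    also have "\<dots> = 0" using eq by (simp only: sum_subtractf comb_def) simp
    finally have "v (inv_ws (ws i)) - u (inv_ws (ws i)) = 0"
      by (rule V.independentD[OF b(2) fin_b subset_refl]) (rule ws_b[OF i])
    then show "v i = u i" using inv_ws[OF i] by simp
  qed
  have comb_onto: "\<exists>v. w = comb v" if w: "w \<in> W" for w
  proof -
    have "w \<in> range (\<lambda>u. \<Sum>v\<in>b. scale (u v) v)"
      using b(3) w unfolding V.span_finite[OF fin_b] by blast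
    then obtain u where "w = (\<Sum>v\<in>b. scale (u v) v)" by blast
    also have "\<dots> = comb (\<lambda>i. u (ws i))"
      unfolding comb_def by (rule sum.reindex_bij_betw[OF ws, symmetric])
    finally show ?thesis by blast
  qed
  define cf where "cf w = (SOME v. w = comb v)" for w
  have cf: "comb (cf w) = w" if "w \<in> W" for w
    using someI_ex[OF comb_onto[OF that]] unfolding cf_def by simp
  \<comment> \<open>The vector of \<open>W\<close> whose coordinates form column \<open>k\<close>. A
    matrix is thus read as the linear map sending \<open>ws k\<close> to \<open>col M k\<close>, and
    matrix identities are checked inside \<open>W\<close>.\<close>
  define col where "col M k = comb (\<lambda>i. M $$ (i, k))" for M k
  have mat_eq: "M = N" if MN: "M \<in> carrier_mat n n" "N \<in> carrier_mat n n"
    and eq: "\<And>k. k < n \<Longrightarrow> col M k = col N k" for M N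
    by (rule eq_matI) (use comb_inj[OF eq[unfolded col_def]] MN in auto)
  define \<phi> where "\<phi> a = mat n n (\<lambda>(i, k). cf (act a (ws k)) i)" for a
  have \<phi>_carrier [simp]: "\<phi> a \<in> carrier_mat n n" for a by (simp add: \<phi>_def)
  have col_\<phi>: "col (\<phi> a) k = act a (ws k)" if a: "a \<in> carrier A" and k: "k < n" for a k
  proof -
    have "col (\<phi> a) k = comb (cf (act a (ws k)))"
      unfolding col_def comb_def \<phi>_def using k by (intro sum.cong refl) simp
    then show ?thesis using cf[OF act_W[OF a ws_W[OF k]]] by simp
  qed
  have \<phi>_mult: "\<phi> (x \<otimes> y) = \<phi> x * \<phi> y" if x: "x \<in> carrier A" and y: "y \<in> carrier A" for x y
  proof (rule mat_eq)
    fix k assume k: "k < n"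
    have "col (\<phi> x * \<phi> y) k = (\<Sum>i<n. \<Sum>r<n. scale (\<phi> y $$ (r, k)) (scale (\<phi> x $$ (i, r)) (ws i)))"
      unfolding col_def comb_def
    proof (intro sum.cong refl)
      fix i assume "i \<in> {..<n}"
      then have "(\<phi> x * \<phi> y) $$ (i, k) = (\<Sum>r<n. \<phi> x $$ (i, r) * \<phi> y $$ (r, k))"
        using k by (simp add: times_mat_def scalar_prod_def lessThan_atLeast0 \<phi>_def)
      then show "scale ((\<phi> x * \<phi> y) $$ (i, k)) (ws i)
          = (\<Sum>r<n. scale (\<phi> y $$ (r, k)) (scale (\<phi> x $$ (i, r)) (ws i)))"
        by (simp add: V.scale_sum_left mult.commute)
    qed
    also have "\<dots> = (\<Sum>r<n. scale (\<phi> y $$ (r, k)) (col (\<phi> x) r))"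
      by (subst sum.swap) (simp only: col_def comb_def V.scale_sum_right)
    also have "\<dots> = (\<Sum>r<n. scale (\<phi> y $$ (r, k)) (act x (ws r)))"
      by (intro sum.cong refl) (simp add: col_\<phi>[OF x])
    also have "\<dots> = act x (col (\<phi> y) k)"
      by (simp only: col_def comb_def act_sum act_scale)
    also have "\<dots> = col (\<phi> (x \<otimes> y)) k"
      using x y k by (simp add: col_\<phi> act_mult)
    finally show "col (\<phi> (x \<otimes> y)) k = col (\<phi> x * \<phi> y) k" by simp
  qed (use mult_carrier_mat[OF \<phi>_carrier \<phi>_carrier] in auto)
  have \<phi>_add: "\<phi> (x \<oplus> y) = \<phi> x + \<phi> y" if x: "x \<in> carrier A" and y: "y \<in> carrier A" for x y
  proof (rule mat_eq)
    fix k assume k: "k < n"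
    have "col (\<phi> x + \<phi> y) k = (\<Sum>i<n. scale (\<phi> x $$ (i, k)) (ws i) + scale (\<phi> y $$ (i, k)) (ws i))"
      unfolding col_def comb_def
      by (intro sum.cong refl) (use k in \<open>simp add: \<phi>_def V.scale_left_distrib\<close>)
    also have "\<dots> = act x (ws k) + act y (ws k)"
      unfolding sum.distrib using col_\<phi>[OF x k] col_\<phi>[OF y k] unfolding col_def comb_def by simp
    also have "\<dots> = col (\<phi> (x \<oplus> y)) k"
      using x y k by (simp add: col_\<phi> act_plus)
    finally show "col (\<phi> (x \<oplus> y)) k = col (\<phi> x + \<phi> y) k" by simp
  qed auto
  have \<phi>_scalar: "\<phi> (\<sigma> k) = \<iota> k \<cdot>\<^sub>m 1\<^sub>m n" for k
  proof (rule mat_eq)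
    fix r assume r: "r < n"
    have "col (\<iota> k \<cdot>\<^sub>m 1\<^sub>m n) r = (\<Sum>i<n. if i = r then scale (\<iota> k) (ws r) else 0)"
      unfolding col_def comb_def
      by (intro sum.cong refl) (use r in auto)
    also have "\<dots> = scale (\<iota> k) (ws r)" using r by (subst sum.delta) auto
    also have "\<dots> = act (\<sigma> k) (ws r)"
      using act_scalar_mult[OF one_closed, of k "ws r"] act_one[of "ws r"] ws_W[OF r] WW0 by auto
    finally show "col (\<phi> (\<sigma> k)) r = col (\<iota> k \<cdot>\<^sub>m 1\<^sub>m n) r"
      using r by (simp add: col_\<phi>)
  qed auto
  have hom: "\<phi> \<in> Ring.ring_hom A (ring_mat TYPE('l) n ())"
  proof (rule ring_hom_memI)
    have "\<phi> \<one> = 1 \<cdot>\<^sub>m 1\<^sub>m n" using \<phi>_scalar[of 1] by simp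
    also have "\<dots> = 1\<^sub>m n" by (rule eq_matI) auto
    finally show "\<phi> \<one> = \<one>\<^bsub>ring_mat TYPE('l) n ()\<^esub>" by (simp add: ring_mat_def)
  qed (auto simp: ring_mat_def \<phi>_mult \<phi>_add)
  \<comment> \<open>Translates the condition of \<open>is_mat_basis\<close> into one on the images
    of the basis vectors. Faithfulness then yields uniqueness of the coefficients, and density their
    existence.\<close>
  have expand_iff: "(\<forall>i<n. \<forall>k<n. M $$ (i, k) = (\<Sum>a\<in>B. c a * \<phi> a $$ (i, k))) \<longleftrightarrow>
      (\<forall>k<n. col M k = act_comb c (ws k))" for M c
  proof -
    have "act_comb c (ws k) = comb (\<lambda>i. \<Sum>a\<in>B. c a * \<phi> a $$ (i, k))" if k: "k < n" for k
    proof -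
      have "act_comb c (ws k) = (\<Sum>a\<in>B. scale (c a) (col (\<phi> a) k))"
        unfolding act_comb_eq by (intro sum.cong refl) (use k in \<open>simp add: col_\<phi> B_carrier\<close>)
      also have "\<dots> = (\<Sum>a\<in>B. \<Sum>i<n. scale (c a * \<phi> a $$ (i, k)) (ws i))"
        unfolding col_def comb_def by (simp add: V.scale_sum_right)
      also have "\<dots> = comb (\<lambda>i. \<Sum>a\<in>B. c a * \<phi> a $$ (i, k))"
        by (subst sum.swap) (simp only: comb_def V.scale_sum_left)
      finally show ?thesis .
    qed
    note AC = this
    have comb_iff: "comb v = comb u \<longleftrightarrow> (\<forall>i<n. v i = u i)" for v u
    proof
      assume "\<forall>i<n. v i = u i"
      then show "comb v = comb u" unfolding comb_def by (intro sum.cong refl) simp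
    qed (rule comb_inj)
    show ?thesis unfolding col_def by (simp add: AC comb_iff) blast
  qed
  have uniq: "c = c'" if c: "\<forall>a. a \<notin> B \<longrightarrow> c a = 0" "\<forall>a. a \<notin> B \<longrightarrow> c' a = 0"
    and eq: "\<forall>k<n. col M k = act_comb c (ws k)" "\<forall>k<n. col M k = act_comb c' (ws k)" for c c' M
  proof -
    have zero: "act_comb (c - c') w = 0" if w: "w \<in> W" for w
    proof -
      have diff: "act_comb (c - c') w = act_comb c w - act_comb c' w" for w
        by (simp add: act_comb_def fun_eq_iff algebra_simps sum_subtractf)
      obtain v where v: "w = comb v" using comb_onto[OF w] by blast
      have lin: "act_comb r w = (\<Sum>i<n. scale (v i) (act_comb r (ws i)))" for r
      proof -
        have "act_comb r (sum f I) = (\<Sum>i\<in>I. act_comb r (f i))" if "finite I" for f and I :: "nat set"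
          using that
        proof (induction I rule: finite_induct)
          case empty
          show ?case by (simp only: sum.empty act_comb_0)
        next
          case (insert i I)
          show ?case by (simp only: sum.insert[OF insert.hyps] act_comb_linear(1) insert.IH)
        qed
        then show ?thesis unfolding v comb_def by (simp only: finite_lessThan act_comb_linear(2))
      qed
      have "act_comb c w = act_comb c' w"
        unfolding lin by (intro sum.cong refl arg_cong[of _ _ "scale _"]) (simp add: eq[rule_format, symmetric])
      then show ?thesis unfolding diff by simp
    qed
    have "\<forall>a\<in>B. (c - c') a = 0" by (rule act_comb_faithful[OF W zero])
    then show ?thesis using c by (auto simp: fun_eq_iff)
  qed
  have exist: "\<exists>c. (\<forall>a. a \<notin> B \<longrightarrow> c a = 0) \<and> (\<forall>k<n. col M k = act_comb c (ws k))" for M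
  proof -
    \<comment> \<open>Density supplies an element that kills all basis vectors except
      \<open>ws k\<close>; irreducibility moves its value at \<open>ws k\<close> to the prescribed
      column. Summing over \<open>k\<close> produces the whole matrix.\<close>
    have "\<exists>s. (\<forall>j<n. j \<noteq> k \<longrightarrow> act_comb s (ws j) = 0) \<and> act_comb s (ws k) = col M k" if k: "k < n" for k
    proof -
      let ?Xs = "b - {ws k}"
      have "\<exists>U\<in>range act_comb. (\<forall>x\<in>?Xs. U x = 0) \<and> U (ws k) \<noteq> 0"
      proof (rule density[of scale W b])
        show "vector_space scale" by unfold_locales
        show "linear_on scale W U" if "U \<in> range act_comb" for U
          using that act_comb_in[OF W] act_comb_linear by (auto simp: linear_on_def)
        show "(\<lambda>w. U w + V w) \<in> range act_comb"
          if "U \<in> range act_comb" "V \<in> range act_comb" for U V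
        proof -
          from that obtain l r where "U = act_comb l" "V = act_comb r" by auto
          then have "(\<lambda>w. U w + V w) = act_comb (l + r)"
            by (intro ext) (simp only: act_comb_add_left)
          then show ?thesis by simp
        qed
        show "(\<lambda>w. scale r (U w)) \<in> range act_comb" if "U \<in> range act_comb" for U r
        proof -
          from that obtain l where "U = act_comb l" by auto
          then have "(\<lambda>w. scale r (U w)) = act_comb (scale r l)"
            by (intro ext) (simp only: act_comb_scale_left)
          then show ?thesis by simp
        qed
        show "(\<lambda>w. U (V w)) \<in> range act_comb"
          if "U \<in> range act_comb" "V \<in> range act_comb" for U V
        proof -
          from that obtain l r where "U = act_comb l" "V = act_comb r" by auto
          moreover obtain s where "\<forall>f. act_comb l (act_comb r f) = act_comb s f"
            using act_comb_comp by blast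
          ultimately have "(\<lambda>w. U (V w)) = act_comb s" by (intro ext) simp
          then show ?thesis by simp
        qed
        show "\<exists>U\<in>range act_comb. U w = y" if "w \<in> W" "w \<noteq> 0" "y \<in> W" for w y
          using minimal_submodule_cyclic[OF W min that] by auto
        show "ws k \<notin> V.span ?Xs"
          using b(2) ws_b[OF k] unfolding V.dependent_def by blast
      qed (use subsp fin_b b ws_W[OF k] in auto)
      then obtain l where l: "\<forall>x\<in>?Xs. act_comb l x = 0" "act_comb l (ws k) \<noteq> 0" by auto
      have "col M k \<in> W" unfolding col_def comb_def
        by (intro V.subspace_sum[OF subsp] V.subspace_scale[OF subsp] ws_W) simp
      then obtain r where r: "act_comb r (act_comb l (ws k)) = col M k"
        using minimal_submodule_cyclic[OF W min act_comb_in[OF W ws_W[OF k]] l(2)] by blast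
      obtain s where s: "\<forall>f. act_comb r (act_comb l f) = act_comb s f"
        using act_comb_comp by blast
      have "act_comb s (ws j) = 0" if "j < n" "j \<noteq> k" for j
      proof -
        have "ws j \<in> ?Xs" using ws that k ws_b[OF that(1)] by (auto simp: bij_betw_def inj_on_def)
        then have "act_comb s (ws j) = act_comb r 0" using s l(1) by metis
        also have "\<dots> = 0" by (rule act_comb_0)
        finally show ?thesis .
      qed
      then show ?thesis using s r by (intro exI[of _ s]) auto
    qed
    then obtain s where s: "\<And>k j. k < n \<Longrightarrow> j < n \<Longrightarrow> j \<noteq> k \<Longrightarrow> act_comb (s k) (ws j) = 0"
      "\<And>k. k < n \<Longrightarrow> act_comb (s k) (ws k) = col M k" by metis
    \<comment> \<open>\<open>act_comb\<close> reads coefficients on \<open>B\<close> only, so they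
      can be cut off outside \<open>B\<close> as \<open>is_mat_basis\<close> demands.\<close>
    define c where "c = (\<lambda>a. if a \<in> B then (\<Sum>k<n. s k) a else 0)"
    have "col M k = act_comb c (ws k)" if k: "k < n" for k
    proof -
      have "act_comb c (ws k) = act_comb (\<Sum>k<n. s k) (ws k)"
        unfolding act_comb_def c_def by (intro ext sum.cong refl) simp
      also have "\<dots> = (\<Sum>r<n. act_comb (s r) (ws k))" by (simp only: act_comb_sum_left)
      also have "\<dots> = (\<Sum>r<n. if r = k then col M k else 0)"
        by (intro sum.cong refl) (use s k in auto)
      also have "\<dots> = col M k" using k by (subst sum.delta) auto
      finally show ?thesis by simp
    qed
    then show ?thesis by (intro exI[of _ c]) (auto simp: c_def)
  qed
  have "is_mat_basis n \<phi> B"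
    unfolding is_mat_basis_def expand_iff
  proof (intro conjI ballI)
    fix M :: "'l mat" assume "M \<in> carrier_mat n n"
    show "\<exists>!c. (\<forall>a. a \<notin> B \<longrightarrow> c a = 0) \<and> (\<forall>k<n. col M k = act_comb c (ws k))"
      using exist[of M] uniq[of _ _ M] by (intro ex_ex1I) blast+
  qed auto
  then show ?thesis unfolding is_splitting_def using hom \<phi>_scalar basis by blast
qed

end

section \<open>Characteristic polynomials\<close>

lemma mult_mat_index:
  assumes "A \<in> carrier_mat n k" "C \<in> carrier_mat k m" "i < n" "j < m"
  shows "(A * C) $$ (i, j) = (\<Sum>r<k. A $$ (i, r) * C $$ (r, j))"
  using assms by (simp add: times_mat_def scalar_prod_def lessThan_atLeast0)

lemma char_poly_matrix_index:
  assumes "M \<in> carrier_mat n n" "i < n" "j < n"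
  shows "char_poly_matrix M $$ (i, j) = (if i = j then [:- (M $$ (i, j)), 1:] else [:- (M $$ (i, j)):])"
  using assms by (auto simp: char_poly_matrix_def)

text \<open>
  Cayley-Hamilton: writing \<open>adj (x - M) = \<Sum> x\<^sup>i B\<^sub>i\<close>, comparison of coefficients in
  \<open>(x - M) adj (x - M) = \<chi>(x)\<close> gives \<open>\<chi>\<^sub>i = B\<^sub>i\<^sub>-\<^sub>1 - M B\<^sub>i\<close>, so that \<open>\<Sum> M\<^sup>i \<chi>\<^sub>i\<close> telescopes.
\<close>
theorem cayley_hamilton:
  fixes M :: "'a::comm_ring_1 mat"
  assumes M: "M \<in> carrier_mat n n" and rs: "r < n" "s < n"
  shows "(\<Sum>i\<le>n. coeff (char_poly M) i * (M ^\<^sub>m i) $$ (r, s)) = 0"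
proof -
  let ?C = "char_poly_matrix M" and ?\<chi> = "char_poly M"
  let ?adj = "adj_mat ?C"
  have C: "?C \<in> carrier_mat n n" using M by simp
  have adj: "?adj \<in> carrier_mat n n" "?C * ?adj = ?\<chi> \<cdot>\<^sub>m 1\<^sub>m n"
    using adj_mat[OF C] by (auto simp: char_poly_def)
  define Bc where "Bc i = mat n n (\<lambda>(u, v). coeff (?adj $$ (u, v)) i)" for i
  have Bc [simp]: "Bc i \<in> carrier_mat n n" for i by (simp add: Bc_def)
  have pow [simp]: "M ^\<^sub>m i \<in> carrier_mat n n" for i using M by simp
  have coeffs: "(case i of 0 \<Rightarrow> 0 | Suc i' \<Rightarrow> Bc i' $$ (u, v)) - (M * Bc i) $$ (u, v)
      = (if u = v then coeff ?\<chi> i else 0)" if uv: "u < n" "v < n" for u v i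
  proof -
    have "(?C * ?adj) $$ (u, v) = (\<Sum>k<n. ?C $$ (u, k) * ?adj $$ (k, v))"
      using C adj uv by (intro mult_mat_index) auto
    also have "\<dots> = (\<Sum>k<n. (if u = k then pCons 0 (?adj $$ (u, v)) else 0) - smult (M $$ (u, k)) (?adj $$ (k, v)))"
      by (intro sum.cong refl) (use M uv in \<open>simp add: char_poly_matrix_index\<close>)
    also have "\<dots> = pCons 0 (?adj $$ (u, v)) - (\<Sum>k<n. smult (M $$ (u, k)) (?adj $$ (k, v)))"
      using uv by (simp add: sum_subtractf)
    finally have "coeff ((?\<chi> \<cdot>\<^sub>m 1\<^sub>m n) $$ (u, v)) i
        = coeff (pCons 0 (?adj $$ (u, v))) i - (\<Sum>k<n. M $$ (u, k) * coeff (?adj $$ (k, v)) i)"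
      by (simp add: adj coeff_sum)
    also have "(\<Sum>k<n. M $$ (u, k) * coeff (?adj $$ (k, v)) i) = (M * Bc i) $$ (u, v)"
      using M uv by (subst mult_mat_index[OF M Bc]) (auto simp: Bc_def)
    finally show ?thesis using uv by (auto simp: Bc_def coeff_pCons split: nat.splits)
  qed
  have term_eq: "coeff ?\<chi> i * (M ^\<^sub>m i) $$ (r, s)
      = (case i of 0 \<Rightarrow> 0 | Suc i' \<Rightarrow> (M ^\<^sub>m i * Bc i') $$ (r, s)) - (M ^\<^sub>m Suc i * Bc i) $$ (r, s)" for i
  proof -
    have "coeff ?\<chi> i * (M ^\<^sub>m i) $$ (r, s)
        = (\<Sum>u<n. (M ^\<^sub>m i) $$ (r, u) * (if u = s then coeff ?\<chi> i else 0))"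
      using rs by (simp add: if_distrib mult.commute cong: if_cong)
    also have "\<dots> = (\<Sum>u<n. (M ^\<^sub>m i) $$ (r, u) * (case i of 0 \<Rightarrow> 0 | Suc i' \<Rightarrow> Bc i' $$ (u, s)))
        - (\<Sum>u<n. (M ^\<^sub>m i) $$ (r, u) * (M * Bc i) $$ (u, s))"
      using rs by (simp add: coeffs[symmetric] right_diff_distrib sum_subtractf)
    also have "(\<Sum>u<n. (M ^\<^sub>m i) $$ (r, u) * (M * Bc i) $$ (u, s)) = (M ^\<^sub>m i * (M * Bc i)) $$ (r, s)"
      using M rs by (intro mult_mat_index[symmetric, OF pow]) auto
    also have "M ^\<^sub>m i * (M * Bc i) = M ^\<^sub>m Suc i * Bc i"
      using M by (simp add: assoc_mult_mat[OF pow M Bc])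
    also have "(\<Sum>u<n. (M ^\<^sub>m i) $$ (r, u) * (case i of 0 \<Rightarrow> 0 | Suc i' \<Rightarrow> Bc i' $$ (u, s)))
        = (case i of 0 \<Rightarrow> 0 | Suc i' \<Rightarrow> (M ^\<^sub>m i * Bc i') $$ (r, s))"
      using mult_mat_index[OF pow Bc rs] by (auto split: nat.splits simp del: pow_mat.simps)
    finally show ?thesis .
  qed
  \<comment> \<open>The telescoping sum up to \<open>N\<close> leaves the boundary term with
    \<open>Bc N\<close>. Taking \<open>N\<close> above all degrees in the adjugate makes this term
    zero, and \<open>N \<ge> n\<close> keeps every coefficient of the characteristic polynomial in
    the sum.\<close>
  obtain N where N: "N \<ge> n" "\<And>u v. u < n \<Longrightarrow> v < n \<Longrightarrow> degree (?adj $$ (u, v)) < N"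
  proof -
    define m where "m = Max (insert n ((\<lambda>(u, v). degree (?adj $$ (u, v))) ` ({..<n} \<times> {..<n})))"
    have "degree (?adj $$ (u, v)) \<le> m" if "u < n" "v < n" for u v
      unfolding m_def using that by (intro Max_ge) auto
    moreover have "n \<le> m" unfolding m_def by (intro Max_ge) auto
    ultimately show ?thesis by (intro that[of "Suc m"]) (auto simp: less_Suc_eq_le)
  qed
  have partial: "(\<Sum>i\<le>k. coeff ?\<chi> i * (M ^\<^sub>m i) $$ (r, s)) = - (M ^\<^sub>m Suc k * Bc k) $$ (r, s)" for k
    by (induction k) (simp_all add: term_eq del: pow_mat.simps)
  have "(\<Sum>i\<le>n. coeff ?\<chi> i * (M ^\<^sub>m i) $$ (r, s)) = (\<Sum>i\<le>N. coeff ?\<chi> i * (M ^\<^sub>m i) $$ (r, s))"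
    using N(1) degree_monic_char_poly[OF M] by (intro sum.mono_neutral_left) (auto simp: coeff_eq_0)
  also have "\<dots> = - (M ^\<^sub>m Suc N * Bc N) $$ (r, s)" by (rule partial)
  also have "Bc N = 0\<^sub>m n n"
    using N(2) by (intro eq_matI) (auto simp: Bc_def coeff_eq_0)
  also have "- (M ^\<^sub>m Suc N * 0\<^sub>m n n) $$ (r, s) = 0"
    using rs right_mult_zero_mat[OF pow[of "Suc N"]] by (simp del: pow_mat.simps)
  finally show ?thesis .
qed

text \<open>Over a domain \<open>P\<close> may fail to be invertible. Taking determinants in (y - M)
  P = P (y - C) and cancelling the nonzero constant \<open>det P\<close> makes do without an
  inverse.\<close>

lemma char_poly_intertwine:
  fixes M :: "'a::idom mat"
  assumes M: "M \<in> carrier_mat n n" and C: "C \<in> carrier_mat n n" and P: "P \<in> carrier_mat n n"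
    and eq: "M * P = P * C" and det: "det P \<noteq> 0"
  shows "char_poly M = char_poly C"
proof -
  let ?h = "\<lambda>a::'a. [:a:]"
  interpret h: comm_ring_hom ?h by unfold_locales (auto simp: one_pCons)
  let ?P = "map_mat ?h P"
  have P': "?P \<in> carrier_mat n n" using P by simp
  have "char_poly_matrix M * ?P = ?P * char_poly_matrix C"
  proof (rule eq_matI)
    fix i j assume "i < dim_row (?P * char_poly_matrix C)" "j < dim_col (?P * char_poly_matrix C)"
    then have ij: "i < n" "j < n" using P C by (auto simp: char_poly_matrix_def)
    have "(char_poly_matrix M * ?P) $$ (i, j)
        = (\<Sum>k<n. (if i = k then pCons 0 [:P $$ (i, j):] else 0) - [:M $$ (i, k) * P $$ (k, j):])"
      unfolding mult_mat_index[OF char_poly_matrix_closed[OF M] P' ij]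
      by (intro sum.cong refl) (use M P ij in \<open>auto simp: char_poly_matrix_index\<close>)
    also have "\<dots> = pCons 0 [:P $$ (i, j):] - [:(M * P) $$ (i, j):]"
      using ij by (simp add: sum_subtractf mult_mat_index[OF M P] h.hom_sum)
    also have "\<dots> = pCons 0 [:P $$ (i, j):] - [:(P * C) $$ (i, j):]" by (simp add: eq)
    also have "\<dots> = (\<Sum>k<n. (if k = j then pCons 0 [:P $$ (i, j):] else 0) - [:P $$ (i, k) * C $$ (k, j):])"
      using ij by (simp add: sum_subtractf mult_mat_index[OF P C] h.hom_sum)
    also have "\<dots> = (?P * char_poly_matrix C) $$ (i, j)"
      unfolding mult_mat_index[OF P' char_poly_matrix_closed[OF C] ij]
      by (intro sum.cong refl) (use C P ij in \<open>auto simp: char_poly_matrix_index\<close>)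
    finally show "(char_poly_matrix M * ?P) $$ (i, j) = (?P * char_poly_matrix C) $$ (i, j)" .
  qed (use M C P in \<open>auto simp: char_poly_matrix_def\<close>)
  then have "det (char_poly_matrix M) * det ?P = det ?P * det (char_poly_matrix C)"
    using det_mult[OF char_poly_matrix_closed[OF M] P'] det_mult[OF P' char_poly_matrix_closed[OF C]]
    by simp
  then have "char_poly M * [:det P:] = char_poly C * [:det P:]"
    by (simp add: char_poly_def h.hom_det mult.commute)
  then show ?thesis using det by (metis mult_right_cancel pCons_eq_0_iff)
qed

text \<open>The columns are the vectors M^j e with e the basis vector of index 0; over a field the
  determinant is nonzero exactly when e is a cyclic vector of \<open>M\<close>.\<close>

definition krylov :: "nat \<Rightarrow> 'a::comm_ring_1 mat \<Rightarrow> 'a mat" where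
  "krylov n M = mat n n (\<lambda>(i, j). (M ^\<^sub>m j) $$ (i, 0))"

text \<open>The matrix of multiplication by y modulo y^n - (k 0 + ... + k (n-1) y^(n-1)) in the
  basis of powers of y; for \<open>k = 0\<close> it is the nilpotent shift.\<close>

definition companion :: "nat \<Rightarrow> (nat \<Rightarrow> 'a::comm_ring_1) \<Rightarrow> 'a mat" where
  "companion n k = mat n n (\<lambda>(i, j). if j = n - 1 then k i else if i = Suc j then 1 else 0)"

lemma krylov_carrier [simp]: "krylov n M \<in> carrier_mat n n"
  and companion_carrier [simp]: "companion n k \<in> carrier_mat n n"
  by (simp_all add: krylov_def companion_def)

lemma pow_mat_Suc_left:
  assumes "M \<in> carrier_mat n n"
  shows "M ^\<^sub>m Suc j = M * M ^\<^sub>m j"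
proof (induction j)
  case (Suc j)
  have "M ^\<^sub>m Suc (Suc j) = M * M ^\<^sub>m j * M" using Suc by simp
  also have "\<dots> = M * (M ^\<^sub>m j * M)"
    using assms by (intro assoc_mult_mat) auto
  finally show ?case by simp
qed (use assms in simp)

text \<open>The Krylov matrix intertwines \<open>M\<close> with the companion matrix of the relation
  satisfied by the cyclic vector. This is why the relation is needed in column 0 only.\<close>

lemma char_poly_companion:
  fixes M :: "'a::idom mat"
  assumes M: "M \<in> carrier_mat n n" and det: "det (krylov n M) \<noteq> 0"
    and rel: "\<And>i. i < n \<Longrightarrow> (M ^\<^sub>m n) $$ (i, 0) = (\<Sum>j<n. k j * (M ^\<^sub>m j) $$ (i, 0))"
  shows "char_poly M = char_poly (companion n k)"
proof (rule char_poly_intertwine[OF M companion_carrier krylov_carrier _ det])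
  show "M * krylov n M = krylov n M * companion n k"
  proof (rule eq_matI)
    fix i j assume "i < dim_row (krylov n M * companion n k)" "j < dim_col (krylov n M * companion n k)"
    then have ij: "i < n" "j < n" by (auto simp: krylov_def companion_def)
    have "(M * krylov n M) $$ (i, j) = (\<Sum>r<n. M $$ (i, r) * (M ^\<^sub>m j) $$ (r, 0))"
      unfolding mult_mat_index[OF M krylov_carrier ij] using ij by (simp add: krylov_def)
    also have "\<dots> = (M ^\<^sub>m Suc j) $$ (i, 0)"
      unfolding pow_mat_Suc_left[OF M] using M ij by (intro mult_mat_index[symmetric]) auto
    also have "\<dots> = (\<Sum>r<n. (M ^\<^sub>m r) $$ (i, 0) * companion n k $$ (r, j))"
    proof (cases "j = n - 1")
      case True
      then show ?thesis using rel[OF ij(1)] ij by (simp add: companion_def mult.commute del: pow_mat.simps)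
    next
      case False
      then have "(\<Sum>r<n. (M ^\<^sub>m r) $$ (i, 0) * companion n k $$ (r, j))
          = (\<Sum>r<n. if r = Suc j then (M ^\<^sub>m r) $$ (i, 0) else 0)"
        using ij by (intro sum.cong refl) (auto simp: companion_def)
      also have "\<dots> = (M ^\<^sub>m Suc j) $$ (i, 0)"
        using False ij by (subst sum.delta) auto
      finally show ?thesis by simp
    qed
    also have "\<dots> = (krylov n M * companion n k) $$ (i, j)"
      unfolding mult_mat_index[OF krylov_carrier companion_carrier ij] using ij by (simp add: krylov_def)
    finally show "(M * krylov n M) $$ (i, j) = (krylov n M * companion n k) $$ (i, j)" .
  qed (use M in \<open>auto simp: krylov_def companion_def\<close>)
qed

text \<open>A matrix for which the basis vector of index 0 is cyclic, in every size and over every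
  ring: the starting point of the search in \<open>cyclic_element_exists\<close>.\<close>

lemma det_krylov_shift: "det (krylov n (companion n (\<lambda>_. 0 :: 'a::comm_ring_1))) = 1"
proof -
  let ?S = "companion n (\<lambda>_. 0 :: 'a)"
  have pow: "(?S ^\<^sub>m j) $$ (i, 0) = (if i = j then 1 else 0)" if "j < n" "i < n" for i j
    using that
  proof (induction j arbitrary: i)
    case 0
    then show ?case by (simp add: companion_def)
  next
    case (Suc j)
    have "(?S ^\<^sub>m Suc j) $$ (i, 0) = (\<Sum>r<n. ?S $$ (i, r) * (?S ^\<^sub>m j) $$ (r, 0))"
      unfolding pow_mat_Suc_left[OF companion_carrier] using Suc.prems
      by (intro mult_mat_index) (auto intro: pow_carrier_mat)
    also have "\<dots> = (\<Sum>r<n. if r = j then ?S $$ (i, j) else 0)"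
      using Suc by (intro sum.cong refl) auto
    also have "\<dots> = ?S $$ (i, j)" using Suc.prems by simp
    also have "\<dots> = (if i = Suc j then 1 else 0)" using Suc.prems by (auto simp: companion_def)
    finally show ?case .
  qed
  have "krylov n ?S = 1\<^sub>m n"
    by (rule eq_matI) (auto simp: krylov_def pow)
  then show ?thesis by simp
qed

lemma (in comm_ring_hom) krylov_hom:
  assumes "M \<in> carrier_mat n n"
  shows "krylov n (map_mat hom M) = map_mat hom (krylov n M)"
proof (rule eq_matI)
  fix i j assume "i < dim_row (map_mat hom (krylov n M))" "j < dim_col (map_mat hom (krylov n M))"
  then have ij: "i < n" "j < n" by (auto simp: krylov_def)
  have "M ^\<^sub>m j \<in> carrier_mat n n" using assms by simp
  then show "krylov n (map_mat hom M) $$ (i, j) = map_mat hom (krylov n M) $$ (i, j)"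
    using ij assms by (simp add: krylov_def mat_hom_pow[OF assms, symmetric])
qed (auto simp: krylov_def)

text \<open>Both quantities are computed once for the matrix M + y N over the polynomial ring.
  Evaluation at \<open>s\<close> is a ring homomorphism and therefore commutes with determinants and
  characteristic polynomials.\<close>

lemma pencil_polynomials:
  fixes M :: "'a::comm_ring_1 mat"
  assumes M: "M \<in> carrier_mat n n" and N: "N \<in> carrier_mat n n"
  obtains q Q where "\<And>s. poly q s = det (krylov n (M + s \<cdot>\<^sub>m N))"
    and "\<And>s i. coeff (char_poly (M + s \<cdot>\<^sub>m N)) i = poly (coeff Q i) s"
proof -
  define L where "L = mat n n (\<lambda>ij. [:M $$ ij, N $$ ij:])"
  have L: "L \<in> carrier_mat n n" by (simp add: L_def)
  show ?thesis
  proof (rule that[of "det (krylov n L)" "char_poly L"])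
    fix s :: 'a
    have h: "comm_ring_hom (\<lambda>p. poly p s)" by unfold_locales auto
    have eval: "map_mat (\<lambda>p. poly p s) L = M + s \<cdot>\<^sub>m N"
      using M N by (intro eq_matI) (auto simp: L_def)
    show "poly (det (krylov n L)) s = det (krylov n (M + s \<cdot>\<^sub>m N))"
      using comm_ring_hom.krylov_hom[OF h L] comm_ring_hom.hom_det[OF h] by (simp only: eval)
    show "coeff (char_poly (M + s \<cdot>\<^sub>m N)) i = poly (coeff (char_poly L) i) s" for i
      using comm_ring_hom.char_poly_hom[OF h L] by (simp add: eval)
  qed
qed

text \<open>Newton interpolation. The divided difference (q - q(s1)) / (y - s1) has smaller degree
  and still takes values in the subfield on \<open>S - {s1}\<close>, although the coefficients of
  \<open>q\<close> are only known to lie in the large field.\<close>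

lemma poly_value_in_subfield:
  fixes q :: "'l::field poly"
  assumes "field_hom \<iota>" "infinite S" "S \<subseteq> range \<iota>" "\<And>s. s \<in> S \<Longrightarrow> poly q s \<in> range \<iota>" "s0 \<in> range \<iota>"
  shows "poly q s0 \<in> range \<iota>"
  using assms(2-)
proof (induction "degree q" arbitrary: q S)
  case 0
  then obtain a where "q = [:a:]" by (metis degree_eq_zeroE)
  moreover obtain s where "s \<in> S" using 0 by (metis finite.emptyI ex_in_conv)
  ultimately show ?case using 0(4)[of s] by simp
next
  case (Suc d)
  interpret field_hom \<iota> by fact
  have diff: "a - b \<in> range \<iota>" if "a \<in> range \<iota>" "b \<in> range \<iota>" for a b
    using that by (auto simp: hom_minus[symmetric])
  have add: "a + b \<in> range \<iota>" if "a \<in> range \<iota>" "b \<in> range \<iota>" for a b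
    using that by (auto simp: hom_add[symmetric])
  have mult: "a * b \<in> range \<iota>" if "a \<in> range \<iota>" "b \<in> range \<iota>" for a b
    using that by (auto simp: hom_mult[symmetric])
  have div: "a / b \<in> range \<iota>" if "a \<in> range \<iota>" "b \<in> range \<iota>" for a b
    using that by (auto simp: hom_div[symmetric])
  obtain s1 where s1: "s1 \<in> S" using Suc.prems by (metis finite.emptyI ex_in_conv)
  have "poly (q - [:poly q s1:]) s1 = 0" by simp
  then obtain r where r: "q - [:poly q s1:] = [:- s1, 1:] * r"
    unfolding poly_eq_0_iff_dvd by (rule dvdE)
  have val: "poly q s = poly q s1 + (s - s1) * poly r s" for s
  proof -
    have "poly (q - [:poly q s1:]) s = poly ([:- s1, 1:] * r) s" by (simp only: r)
    then show ?thesis by (simp add: algebra_simps)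
  qed
  have "degree (q + [:- poly q s1:]) = degree q"
    by (rule degree_add_eq_left) (use Suc.hyps(2) in simp)
  moreover have "q + [:- poly q s1:] = q - [:poly q s1:]" by (rule poly_eqI) (simp add: coeff_pCons split: nat.split)
  ultimately have "degree (q - [:poly q s1:]) = Suc d" using Suc.hyps(2) by simp
  moreover have "r \<noteq> 0" using calculation r by auto
  ultimately have "degree r = d" using r by (simp add: degree_mult_eq del: mult_pCons_left)
  moreover have "poly r s \<in> range \<iota>" if s: "s \<in> S - {s1}" for s
  proof -
    have "poly r s = (poly q s - poly q s1) / (s - s1)" using val[of s] s by simp
    then show ?thesis using s s1 Suc.prems by (auto intro!: div diff)
  qed
  ultimately have "poly r s0 \<in> range \<iota>"
    using Suc.prems by (intro Suc.hyps(1)[of r "S - {s1}"]) auto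
  then show ?case
    unfolding val[of s0] using Suc.prems s1 by (auto intro!: add mult diff)
qed

section \<open>Uniqueness and rationality of the reduced characteristic polynomial\<close>

locale fd_algebra_hom = fd_algebra A \<sigma> B + field_hom \<iota>
  for A :: "('a, 'm) ring_scheme" (structure) and \<sigma> :: "'k::field \<Rightarrow> 'a" and B
    and \<iota> :: "'k \<Rightarrow> 'l::field"
begin

text \<open>Representations that need not be splittings with respect to \<open>B\<close>. When two
  splittings are compared, the second enters only in this role, since the basis belonging to it may
  differ from \<open>B\<close>.\<close>

definition rep :: "nat \<Rightarrow> ('a \<Rightarrow> 'l mat) \<Rightarrow> bool" where
  "rep n \<phi> \<longleftrightarrow> \<phi> \<in> Ring.ring_hom A (ring_mat TYPE('l) n ()) \<and> (\<forall>k. \<phi> (\<sigma> k) = \<iota> k \<cdot>\<^sub>m 1\<^sub>m n)"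

context
  fixes n \<phi> assumes rep: "rep n \<phi>"
begin

lemma rep_carrier: "x \<in> carrier A \<Longrightarrow> \<phi> x \<in> carrier_mat n n"
  and rep_mult: "x \<in> carrier A \<Longrightarrow> y \<in> carrier A \<Longrightarrow> \<phi> (x \<otimes> y) = \<phi> x * \<phi> y"
  and rep_add: "x \<in> carrier A \<Longrightarrow> y \<in> carrier A \<Longrightarrow> \<phi> (x \<oplus> y) = \<phi> x + \<phi> y"
  and rep_one: "\<phi> \<one> = 1\<^sub>m n"
  and rep_scalar: "\<phi> (\<sigma> k) = \<iota> k \<cdot>\<^sub>m 1\<^sub>m n"
  using rep by (auto simp: rep_def Ring.ring_hom_def ring_mat_def)

lemma rep_scalar_mult: "x \<in> carrier A \<Longrightarrow> \<phi> (\<sigma> k \<otimes> x) = \<iota> k \<cdot>\<^sub>m \<phi> x"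
  using rep_mult[of "\<sigma> k" x] mult_smult_assoc_mat[OF one_carrier_mat rep_carrier[of x]] rep_carrier[of x]
  by (simp add: rep_scalar)

lemma rep_expand:
  assumes x: "x \<in> carrier A" and ij: "i < n" "j < n"
  shows "\<phi> x $$ (i, j) = (\<Sum>b\<in>B. \<iota> (coord x b) * \<phi> b $$ (i, j))"
proof -
  have "\<phi> (\<Oplus>b\<in>I. \<sigma> (c b) \<otimes> b) $$ (i, j) = (\<Sum>b\<in>I. \<iota> (c b) * \<phi> b $$ (i, j))"
    if "finite I" "I \<subseteq> B" for I c
    using that
  proof (induction I rule: finite_induct)
    case empty
    show ?case using rep_scalar[of 0] ij by simp
  next
    case (insert b I)
    have cl: "(\<lambda>b. \<sigma> (c b) \<otimes> b) \<in> I \<rightarrow> carrier A" "b \<in> carrier A"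
      using insert.prems B_carrier by auto
    have "\<phi> (\<Oplus>b\<in>insert b I. \<sigma> (c b) \<otimes> b) = \<phi> (\<sigma> (c b) \<otimes> b) + \<phi> (\<Oplus>b\<in>I. \<sigma> (c b) \<otimes> b)"
      using insert.hyps cl by (simp add: rep_add finsum_closed)
    moreover have "\<phi> (\<Oplus>b\<in>I. \<sigma> (c b) \<otimes> b) \<in> carrier_mat n n"
      using cl by (intro rep_carrier finsum_closed)
    moreover have "\<phi> (\<sigma> (c b) \<otimes> b) $$ (i, j) = \<iota> (c b) * \<phi> b $$ (i, j)"
      using rep_carrier[OF cl(2)] ij by (simp add: rep_scalar_mult[OF cl(2)])
    ultimately show ?case
      using insert ij by simp
  qed
  from this[OF fin_B subset_refl, of "coord x"] show ?thesis using x by (simp add: coord_sum)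
qed

lemma rep_pow: "x \<in> carrier A \<Longrightarrow> \<phi> (x [^] (i::nat)) = \<phi> x ^\<^sub>m i"
proof (induction i)
  case 0
  then show ?case using rep_carrier[of x] by (simp add: rep_one)
qed (simp add: rep_mult)

end

section \<open>Comparison of a splitting with another representation\<close>

context
  fixes n \<phi> assumes rep: "rep n \<phi>" and mat_basis: "is_mat_basis n \<phi> B"
begin

lemmas split_carrier = rep_carrier[OF rep]
  and split_mult = rep_mult[OF rep]
  and split_one = rep_one[OF rep]
  and split_expand = rep_expand[OF rep]

lemma mat_basis_unique:
  assumes "\<And>i j. i < n \<Longrightarrow> j < n \<Longrightarrow> (\<Sum>b\<in>B. c b * \<phi> b $$ (i, j)) = (\<Sum>b\<in>B. c' b * \<phi> b $$ (i, j))"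
    and b: "b \<in> B"
  shows "c b = c' b"
proof -
  define M where "M = mat n n (\<lambda>(i, j). \<Sum>b\<in>B. c b * \<phi> b $$ (i, j))"
  have "M \<in> carrier_mat n n" by (simp add: M_def)
  then have ex1: "\<exists>!c. (\<forall>b. b \<notin> B \<longrightarrow> c b = 0) \<and>
      (\<forall>i<n. \<forall>j<n. M $$ (i, j) = (\<Sum>b\<in>B. c b * \<phi> b $$ (i, j)))"
    using mat_basis unfolding is_mat_basis_def by blast
  \<comment> \<open>Uniqueness in \<open>is_mat_basis\<close> concerns families that vanish outside
    \<open>B\<close>, hence the truncation.\<close>
  define r where "r c = (\<lambda>b. if b \<in> B then c b else (0::'l))" for c
  have r_sum: "(\<Sum>b\<in>B. r c b * \<phi> b $$ ij) = (\<Sum>b\<in>B. c b * \<phi> b $$ ij)" for c ij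
    by (intro sum.cong) (auto simp: r_def)
  obtain z where z: "\<And>c. (\<forall>b. b \<notin> B \<longrightarrow> c b = 0) \<and>
      (\<forall>i<n. \<forall>j<n. M $$ (i, j) = (\<Sum>b\<in>B. c b * \<phi> b $$ (i, j))) \<Longrightarrow> c = z"
    using ex1 by (elim ex1E) blast
  have "r c = z" by (rule z) (simp add: r_sum, simp add: r_def M_def)
  moreover have "r c' = z" by (rule z) (simp add: r_sum, simp add: r_def M_def assms(1))
  ultimately have "r c = r c'" by simp
  then show ?thesis using b by (metis r_def)
qed

lemma mat_basis_expand:
  assumes "M \<in> carrier_mat n n"
  shows "\<exists>c. \<forall>i<n. \<forall>j<n. M $$ (i, j) = (\<Sum>b\<in>B. c b * \<phi> b $$ (i, j))"
  using mat_basis assms unfolding is_mat_basis_def by blast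

text \<open>
  The elementary Skolem-Noether argument: for the linear map \<open>\<psi>\<close> with \<open>\<psi>(\<phi> a) = \<phi>' a\<close>, the matrix
  with columns \<open>\<psi>(E\<^sub>i\<^sub>j) e\<^sub>k\<close> (\<open>i\<close> varying) intertwines \<open>\<phi>\<close> and \<open>\<phi>'\<close>.
\<close>
lemma intertwiner_exists:
  assumes rep': "rep n' \<phi>'" and n': "n' > 0"
  shows "\<exists>P\<in>carrier_mat n' n. P \<noteq> 0\<^sub>m n' n \<and> (\<forall>a\<in>carrier A. P * \<phi> a = \<phi>' a * P)"
proof -
  note rep'_carrier = rep_carrier[OF rep'] and rep'_expand = rep_expand[OF rep']
  define E where "E i j = mat n n (\<lambda>(r, s). if r = i \<and> s = j then 1 else (0::'l))" for i j
  have "E i j \<in> carrier_mat n n" for i j by (simp add: E_def)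
  then have "\<exists>c. \<forall>r<n. \<forall>s<n. E i j $$ (r, s) = (\<Sum>b\<in>B. c b * \<phi> b $$ (r, s))" for i j
    by (rule mat_basis_expand)
  then obtain e where "\<And>i j. \<forall>r<n. \<forall>s<n. E i j $$ (r, s) = (\<Sum>b\<in>B. e i j b * \<phi> b $$ (r, s))"
    by metis
  then have e: "(\<Sum>b\<in>B. e i j b * \<phi> b $$ (r, s)) = (if r = i \<and> s = j then 1 else 0)"
    if "r < n" "s < n" for i j r s using that by (simp add: E_def)
  define P where "P j k = mat n' n (\<lambda>(r, i). \<Sum>b\<in>B. e i j b * \<phi>' b $$ (r, k))" for j k
  have P [simp]: "P j k \<in> carrier_mat n' n" for j k by (simp add: P_def)
  \<comment> \<open>Both sides are the coefficients of \<phi> a times the matrix unit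
    \<open>E i j\<close>. The left side uses that this product is the sum of
    \<open>\<phi> a $$ (l, i)\<close> times \<open>E l j\<close>; the right side first expands
    \<open>E i j\<close> and then uses the structure constants of A.\<close>
  have coeffs: "(\<Sum>l<n. \<phi> a $$ (l, i) * e l j b') = (\<Sum>b\<in>B. e i j b * \<iota> (coord (a \<otimes> b) b'))"
    if a: "a \<in> carrier A" and i: "i < n" and b': "b' \<in> B" for a i j b'
  proof (rule mat_basis_unique[OF _ b'])
    fix u v assume uv: "u < n" "v < n"
    have "(\<Sum>b'\<in>B. (\<Sum>l<n. \<phi> a $$ (l, i) * e l j b') * \<phi> b' $$ (u, v))
        = (\<Sum>l<n. \<phi> a $$ (l, i) * (\<Sum>b'\<in>B. e l j b' * \<phi> b' $$ (u, v)))"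
      by (simp only: sum_distrib_left sum_distrib_right mult.assoc) (rule sum.swap)
    also have "\<dots> = (\<Sum>l<n. if l = u then (if v = j then \<phi> a $$ (u, i) else 0) else 0)"
      by (intro sum.cong refl) (auto simp: e[OF uv])
    also have "\<dots> = (if v = j then \<phi> a $$ (u, i) else 0)" using uv by (subst sum.delta) auto
    also have "\<dots> = (\<Sum>s<n. if s = i then (if v = j then \<phi> a $$ (u, s) else 0) else 0)"
      using i by (subst sum.delta) auto
    also have "\<dots> = (\<Sum>s<n. \<phi> a $$ (u, s) * (\<Sum>b\<in>B. e i j b * \<phi> b $$ (s, v)))"
      by (intro sum.cong refl) (use uv in \<open>auto simp: e\<close>)
    also have "\<dots> = (\<Sum>b\<in>B. e i j b * (\<Sum>s<n. \<phi> a $$ (u, s) * \<phi> b $$ (s, v)))"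
      by (simp only: sum_distrib_left mult.left_commute) (rule sum.swap)
    also have "\<dots> = (\<Sum>b\<in>B. e i j b * (\<Sum>b'\<in>B. \<iota> (coord (a \<otimes> b) b') * \<phi> b' $$ (u, v)))"
    proof (intro sum.cong refl arg_cong2[of _ _ _ _ "(*)"])
      fix b assume b: "b \<in> B"
      show "(\<Sum>s<n. \<phi> a $$ (u, s) * \<phi> b $$ (s, v)) = (\<Sum>b'\<in>B. \<iota> (coord (a \<otimes> b) b') * \<phi> b' $$ (u, v))"
        using a B_carrier[OF b] uv
        by (simp add: split_expand[symmetric] split_mult mult_mat_index[OF split_carrier split_carrier])
    qed
    also have "\<dots> = (\<Sum>b'\<in>B. (\<Sum>b\<in>B. e i j b * \<iota> (coord (a \<otimes> b) b')) * \<phi> b' $$ (u, v))"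
      by (simp only: sum_distrib_left sum_distrib_right mult.assoc) (rule sum.swap)
    finally show "(\<Sum>b'\<in>B. (\<Sum>l<n. \<phi> a $$ (l, i) * e l j b') * \<phi> b' $$ (u, v)) = \<dots>" .
  qed
  have inter: "P j k * \<phi> a = \<phi>' a * P j k" if a: "a \<in> carrier A" and k: "k < n'" for a j k
  proof (rule eq_matI)
    fix r i assume "r < dim_row (\<phi>' a * P j k)" "i < dim_col (\<phi>' a * P j k)"
    then have ri: "r < n'" "i < n" using rep'_carrier[OF a] by (auto simp: P_def)
    have "(P j k * \<phi> a) $$ (r, i) = (\<Sum>l<n. (\<Sum>b\<in>B. e l j b * \<phi>' b $$ (r, k)) * \<phi> a $$ (l, i))"
      unfolding mult_mat_index[OF P split_carrier[OF a] ri]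
      by (intro sum.cong refl) (use ri in \<open>simp add: P_def\<close>)
    also have "\<dots> = (\<Sum>b\<in>B. (\<Sum>l<n. \<phi> a $$ (l, i) * e l j b) * \<phi>' b $$ (r, k))"
      by (simp only: sum_distrib_left sum_distrib_right mult_ac) (rule sum.swap)
    also have "\<dots> = (\<Sum>b'\<in>B. (\<Sum>b\<in>B. e i j b * \<iota> (coord (a \<otimes> b) b')) * \<phi>' b' $$ (r, k))"
      by (intro sum.cong refl) (simp only: coeffs[OF a ri(2)])
    also have "\<dots> = (\<Sum>b\<in>B. e i j b * (\<Sum>b'\<in>B. \<iota> (coord (a \<otimes> b) b') * \<phi>' b' $$ (r, k)))"
      by (simp only: sum_distrib_left sum_distrib_right mult.assoc) (rule sum.swap)
    also have "\<dots> = (\<Sum>b\<in>B. e i j b * (\<Sum>s<n'. \<phi>' a $$ (r, s) * \<phi>' b $$ (s, k)))"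
    proof (intro sum.cong refl arg_cong2[of _ _ _ _ "(*)"])
      fix b assume b: "b \<in> B"
      show "(\<Sum>b'\<in>B. \<iota> (coord (a \<otimes> b) b') * \<phi>' b' $$ (r, k)) = (\<Sum>s<n'. \<phi>' a $$ (r, s) * \<phi>' b $$ (s, k))"
        using a B_carrier[OF b] ri k
        by (simp add: rep'_expand[symmetric] rep_mult[OF rep'] mult_mat_index[OF rep'_carrier rep'_carrier])
    qed
    also have "\<dots> = (\<Sum>s<n'. \<phi>' a $$ (r, s) * (\<Sum>b\<in>B. e i j b * \<phi>' b $$ (s, k)))"
      by (simp only: sum_distrib_left mult.left_commute) (rule sum.swap)
    also have "\<dots> = (\<phi>' a * P j k) $$ (r, i)"
      unfolding mult_mat_index[OF rep'_carrier[OF a] P ri]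
      by (intro sum.cong refl) (use ri in \<open>simp add: P_def\<close>)
    finally show "(P j k * \<phi> a) $$ (r, i) = (\<phi>' a * P j k) $$ (r, i)" .
  qed (use split_carrier[OF a] rep'_carrier[OF a] in \<open>auto simp: P_def\<close>)
  \<comment> \<open>If all these matrices were zero, so would be the entry at (0, 0) of the sum of
    the \<psi>(E i i). But that sum is \<psi>(1), the unit matrix.\<close>
  have "\<exists>j<n. P j 0 \<noteq> 0\<^sub>m n' n"
  proof (rule ccontr)
    assume "\<not> ?thesis"
    then have zero: "P j 0 $$ (0, i) = 0" if "i < n" "j < n" for i j using that n' by simp
    have one: "\<iota> (coord \<one> b) = (\<Sum>i<n. e i i b)" if b: "b \<in> B" for b
    proof (rule mat_basis_unique[OF _ b])
      fix u v assume uv: "u < n" "v < n"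
      have "(\<Sum>b\<in>B. (\<Sum>i<n. e i i b) * \<phi> b $$ (u, v)) = (\<Sum>i<n. \<Sum>b\<in>B. e i i b * \<phi> b $$ (u, v))"
        by (simp only: sum_distrib_right) (rule sum.swap)
      also have "\<dots> = (\<Sum>i<n. if i = u then (if v = u then 1 else 0) else 0)"
        by (intro sum.cong refl) (auto simp: e[OF uv])
      also have "\<dots> = 1\<^sub>m n $$ (u, v)" using uv by (subst sum.delta) auto
      also have "\<dots> = (\<Sum>b\<in>B. \<iota> (coord \<one> b) * \<phi> b $$ (u, v))"
        using split_expand[OF one_closed uv] by (simp add: split_one)
      finally show "(\<Sum>b\<in>B. \<iota> (coord \<one> b) * \<phi> b $$ (u, v))
          = (\<Sum>b\<in>B. (\<Sum>i<n. e i i b) * \<phi> b $$ (u, v))" by simp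
    qed
    have "1 = \<phi>' \<one> $$ (0, 0)" using n' by (simp add: rep_one[OF rep'])
    also have "\<dots> = (\<Sum>b\<in>B. (\<Sum>i<n. e i i b) * \<phi>' b $$ (0, 0))"
      unfolding rep'_expand[OF one_closed n' n'] by (intro sum.cong refl) (simp only: one)
    also have "\<dots> = (\<Sum>i<n. \<Sum>b\<in>B. e i i b * \<phi>' b $$ (0, 0))"
      by (simp only: sum_distrib_right) (rule sum.swap)
    also have "\<dots> = 0"
      by (rule sum.neutral, rule ballI) (use zero n' in \<open>auto simp: P_def\<close>)
    finally show False by simp
  qed
  then show ?thesis using inter[OF _ n'] P by blast
qed

text \<open>The kernel of \<open>P\<close> is stable under every \<open>\<phi> a\<close>, hence
  under all matrices, because these are L-combinations of the \<open>\<phi> b\<close>. Applying to a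
  kernel vector \<open>w\<close> the matrix unit with entry 1 at (l, i0) shows that
  \<open>w i0\<close> times column \<open>l\<close> of \<open>P\<close> is zero.\<close>

lemma intertwiner_injective:
  assumes rep': "rep n' \<phi>'" and P: "P \<in> carrier_mat n' n" "P \<noteq> 0\<^sub>m n' n"
    and inter: "\<And>a. a \<in> carrier A \<Longrightarrow> P * \<phi> a = \<phi>' a * P"
    and w: "\<And>r. r < n' \<Longrightarrow> (\<Sum>i<n. P $$ (r, i) * w i) = 0" and i0: "i0 < n"
  shows "w i0 = 0"
proof (rule ccontr)
  assume w0: "w i0 \<noteq> 0"
  have "P $$ (r, l) = 0" if rl: "r < n'" "l < n" for r l
  proof -
    define M where "M = mat n n (\<lambda>(u, v). if u = l \<and> v = i0 then 1 else (0::'l))"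
    have "M \<in> carrier_mat n n" by (simp add: M_def)
    then obtain c where c: "\<forall>u<n. \<forall>v<n. M $$ (u, v) = (\<Sum>b\<in>B. c b * \<phi> b $$ (u, v))"
      using mat_basis_expand by blast
    have "P $$ (r, l) * w i0 = (\<Sum>u<n. if u = l then P $$ (r, l) * w i0 else 0)"
      using rl by (subst sum.delta) auto
    also have "\<dots> = (\<Sum>u<n. P $$ (r, u) * (\<Sum>v<n. M $$ (u, v) * w v))"
    proof (intro sum.cong refl)
      fix u assume "u \<in> {..<n}"
      then have "(\<Sum>v<n. M $$ (u, v) * w v) = (\<Sum>v<n. if v = i0 then (if u = l then w i0 else 0) else 0)"
        by (intro sum.cong refl) (auto simp: M_def)
      also have "\<dots> = (if u = l then w i0 else 0)" using i0 by (subst sum.delta) auto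
      finally show "(if u = l then P $$ (r, l) * w i0 else 0) = P $$ (r, u) * (\<Sum>v<n. M $$ (u, v) * w v)"
        by simp
    qed
    also have "\<dots> = (\<Sum>u<n. P $$ (r, u) * (\<Sum>v<n. (\<Sum>b\<in>B. c b * \<phi> b $$ (u, v)) * w v))"
      using c by simp
    also have "\<dots> = (\<Sum>u<n. \<Sum>v<n. \<Sum>b\<in>B. c b * (P $$ (r, u) * \<phi> b $$ (u, v) * w v))"
      by (simp add: sum_distrib_left sum_distrib_right mult_ac)
    also have "\<dots> = (\<Sum>b\<in>B. \<Sum>v<n. \<Sum>u<n. c b * (P $$ (r, u) * \<phi> b $$ (u, v) * w v))"
    proof -
      let ?f = "\<lambda>u v b. c b * (P $$ (r, u) * \<phi> b $$ (u, v) * w v)"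
      have "(\<Sum>u<n. \<Sum>v<n. \<Sum>b\<in>B. ?f u v b) = (\<Sum>u<n. \<Sum>b\<in>B. \<Sum>v<n. ?f u v b)"
        by (intro sum.cong refl sum.swap)
      also have "\<dots> = (\<Sum>b\<in>B. \<Sum>u<n. \<Sum>v<n. ?f u v b)" by (rule sum.swap)
      also have "\<dots> = (\<Sum>b\<in>B. \<Sum>v<n. \<Sum>u<n. ?f u v b)" by (intro sum.cong refl sum.swap)
      finally show ?thesis .
    qed
    also have "\<dots> = (\<Sum>b\<in>B. c b * (\<Sum>v<n. (P * \<phi> b) $$ (r, v) * w v))"
      by (intro sum.cong refl) (use rl in \<open>simp add: mult_mat_index[OF P(1) split_carrier[OF B_carrier]] sum_distrib_left sum_distrib_right\<close>)
    also have "\<dots> = 0"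
    proof (intro sum.neutral ballI)
      fix b assume b: "b \<in> B"
      have "(\<Sum>v<n. (P * \<phi> b) $$ (r, v) * w v) = (\<Sum>v<n. (\<Sum>t<n'. \<phi>' b $$ (r, t) * P $$ (t, v)) * w v)"
        by (intro sum.cong refl)
           (use rl in \<open>simp add: inter[OF B_carrier[OF b]] mult_mat_index[OF rep_carrier[OF rep' B_carrier[OF b]] P(1)]\<close>)
      also have "\<dots> = (\<Sum>t<n'. \<phi>' b $$ (r, t) * (\<Sum>v<n. P $$ (t, v) * w v))"
        by (simp only: sum_distrib_left sum_distrib_right mult.assoc) (rule sum.swap)
      also have "\<dots> = 0" using w by simp
      finally show "c b * (\<Sum>v<n. (P * \<phi> b) $$ (r, v) * w v) = 0" by simp
    qed
    finally show ?thesis using w0 by simp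
  qed
  then have "P = 0\<^sub>m n' n" using P(1) by (intro eq_matI) auto
  then show False using P(2) by simp
qed

lemma splitting_dim_le:
  assumes "rep n' \<phi>'" "n' > 0"
  shows "n \<le> n'"
proof (rule ccontr)
  assume "\<not> n \<le> n'"
  obtain P where P: "P \<in> carrier_mat n' n" "P \<noteq> 0\<^sub>m n' n" "\<And>a. a \<in> carrier A \<Longrightarrow> P * \<phi> a = \<phi>' a * P"
    using intertwiner_exists[OF assms] by blast
  obtain w where "\<exists>i<n. w i \<noteq> 0" "\<And>r. r < n' \<Longrightarrow> (\<Sum>i<n. w i * P $$ (r, i)) = 0"
    using homogeneous_system_solution[of "{..<n'}" "{..<n}" "\<lambda>r i. P $$ (r, i)"] \<open>\<not> n \<le> n'\<close> by auto
  then show False using intertwiner_injective[OF assms(1) P, of w] by (auto simp: mult.commute)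
qed

lemma splitting_det_eq:
  assumes rep': "rep n \<phi>'" and n: "n > 0" and a: "a \<in> carrier A"
  shows "det (\<phi> a) = det (\<phi>' a)"
proof -
  obtain P where P: "P \<in> carrier_mat n n" "P \<noteq> 0\<^sub>m n n" "\<And>a. a \<in> carrier A \<Longrightarrow> P * \<phi> a = \<phi>' a * P"
    using intertwiner_exists[OF rep' n] by blast
  have "det P \<noteq> 0"
  proof
    assume "det P = 0"
    then obtain v where v: "v \<in> carrier_vec n" "v \<noteq> 0\<^sub>v n" "P *\<^sub>v v = 0\<^sub>v n"
      using det_0_iff_vec_prod_zero_field[OF P(1)] by blast
    have "(\<Sum>i<n. P $$ (r, i) * v $ i) = 0" if r: "r < n" for r
    proof -
      have "(P *\<^sub>v v) $ r = 0" using v r by simp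
      then show ?thesis using P(1) v(1) r by (simp add: scalar_prod_def lessThan_atLeast0)
    qed
    then have "v $ i = 0" if "i < n" for i
      using intertwiner_injective[OF rep' P, of "\<lambda>i. v $ i"] that by blast
    then have "v = 0\<^sub>v n" using v(1) by (intro eq_vecI) auto
    then show False using v(2) by simp
  qed
  moreover have "det P * det (\<phi> a) = det (\<phi>' a) * det P"
    unfolding det_mult[OF P(1) split_carrier[OF a], symmetric] det_mult[OF rep_carrier[OF rep' a] P(1), symmetric]
    by (simp only: P(3)[OF a])
  ultimately show ?thesis by auto
qed

lemma splitting_pos: "n > 0"
proof (rule ccontr)
  assume "\<not> n > 0"
  then have n: "n = 0" by simp
  have "B = {}"
  proof (rule ccontr)
    assume "B \<noteq> {}"
    then obtain b where b: "b \<in> B" by blast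
    have "(0::'l) = 1" by (rule mat_basis_unique[OF _ b, of "\<lambda>_. 0" "\<lambda>_. 1"]) (simp add: n)
    then show False by simp
  qed
  then have "\<one> = \<zero>" using coord_sum[OF one_closed] by simp
  then show False using one_neq_zero_alg by simp
qed

end
end

text \<open>The two splittings may come with different bases of A. The dimension inequality is
  therefore used in both directions, each time with the basis of the splitting that serves as
  source.\<close>

lemma (in scalar_algebra) splitting_det_unique:
  fixes \<iota> :: "'k \<Rightarrow> 'l::field"
  assumes "field_hom \<iota>" and s: "is_splitting A \<sigma> \<iota> n \<phi>" and s': "is_splitting A \<sigma> \<iota> n' \<phi>'"
    and a: "a \<in> carrier A"
  shows "det (\<phi> a) = det (\<phi>' a)"
proof -
  interpret field_hom \<iota> by fact
  obtain B where B: "is_alg_basis A \<sigma> B" "is_mat_basis n \<phi> B"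
    using s by (auto simp: is_splitting_def)
  obtain B' where B': "is_alg_basis A \<sigma> B'" "is_mat_basis n' \<phi>' B'"
    using s' by (auto simp: is_splitting_def)
  interpret F: fd_algebra_hom A \<sigma> B \<iota> by unfold_locales (rule B)
  interpret F': fd_algebra_hom A \<sigma> B' \<iota> by unfold_locales (rule B')
  have rep: "F.rep n \<phi>" "F.rep n' \<phi>'" "F'.rep n \<phi>" "F'.rep n' \<phi>'"
    using s s' by (auto simp: is_splitting_def F.rep_def F'.rep_def)
  have pos: "n > 0" "n' > 0"
    using F.splitting_pos[OF rep(1) B(2)] F'.splitting_pos[OF rep(4) B'(2)] .
  have "n = n'"
    using F.splitting_dim_le[OF rep(1) B(2) rep(2) pos(2)]
      F'.splitting_dim_le[OF rep(4) B'(2) rep(3) pos(1)] by simp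
  then show ?thesis using F.splitting_det_eq[OF rep(1) B(2) _ pos(1) a] rep(2) by simp
qed

lemma (in fd_algebra_hom) inj_hom: "inj \<iota>"
  by (rule injI) simp

text \<open>The map is only linear, not multiplicative. That is enough to turn a linear relation
  with coefficients in L between elements of K into one with coefficients in K, keeping every
  coefficient equal to 1.\<close>

lemma (in fd_algebra_hom) retraction_exists:
  "\<exists>f :: 'l \<Rightarrow> 'k. (\<forall>k. f (\<iota> k) = k) \<and> (\<forall>x y. f (x + y) = f x + f y) \<and> (\<forall>k x. f (\<iota> k * x) = k * f x)"
proof -
  interpret K: vector_space "(*) :: 'k \<Rightarrow> 'k \<Rightarrow> 'k"
    by unfold_locales (auto simp: algebra_simps)
  interpret L: vector_space "\<lambda>k x. \<iota> k * x"
    by unfold_locales (auto simp: algebra_simps hom_add hom_mult)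
  interpret P: vector_space_pair "(*) :: 'k \<Rightarrow> 'k \<Rightarrow> 'k" "\<lambda>k x. \<iota> k * x"
    by unfold_locales
  have "Vector_Spaces.linear ((*) :: 'k \<Rightarrow> 'k \<Rightarrow> 'k) (\<lambda>k x. \<iota> k * x) \<iota>"
    by unfold_locales (auto simp: hom_add hom_mult)
  with inj_hom obtain f where "Vector_Spaces.linear (\<lambda>k x. \<iota> k * x) ((*) :: 'k \<Rightarrow> 'k \<Rightarrow> 'k) f" and f: "f \<circ> \<iota> = id"
    using P.linear_injective_left_inverse by blast
  then interpret f: Vector_Spaces.linear "\<lambda>k x. \<iota> k * x" "(*) :: 'k \<Rightarrow> 'k \<Rightarrow> 'k" f by simp
  show ?thesis using f f.add f.scale by (intro exI[of _ f]) (auto simp: fun_eq_iff)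
qed

section \<open>Rationality of the characteristic polynomial\<close>

context fd_algebra_hom
begin

context
  fixes n \<phi> assumes rep: "rep n \<phi>" and mat_basis: "is_mat_basis n \<phi> B"
begin

text \<open>Read in coordinates with respect to \<open>B\<close>, the Cayley-Hamilton theorem is a
  system of relations between the \<open>coord (a [^] r) b\<close>, which lie in K. The retraction
  replaces it by a monic relation of the same degree over K. Cyclicity then identifies the
  characteristic polynomial with that of a companion matrix with entries in K.\<close>

lemma char_poly_rational_cyclic:
  assumes a: "a \<in> carrier A" and cyclic: "det (krylov n (\<phi> a)) \<noteq> 0"
  shows "poly.coeff (char_poly (\<phi> a)) i \<in> range \<iota>"
proof -
  let ?M = "\<phi> a" and ?\<chi> = "char_poly (\<phi> a)"
  have M: "?M \<in> carrier_mat n n" using rep_carrier[OF rep a] .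
  have n: "n > 0" by (rule splitting_pos[OF rep mat_basis])
  obtain f :: "'l \<Rightarrow> 'k" where f: "\<And>k. f (\<iota> k) = k" "\<And>x y. f (x + y) = f x + f y"
      "\<And>k x. f (\<iota> k * x) = k * f x"
    using retraction_exists by blast
  have f_sum: "f (sum g I) = (\<Sum>i\<in>I. f (g i))" for g and I :: "nat set"
    using f(1)[of 0] by (induction I rule: infinite_finite_induct) (auto simp: f(2))
  have pow: "?M ^\<^sub>m r = \<phi> (a [^] r)" for r :: nat by (simp add: rep_pow[OF rep a])
  have pow_index: "(?M ^\<^sub>m r) $$ (u, v) = (\<Sum>b\<in>B. \<iota> (coord (a [^] r) b) * \<phi> b $$ (u, v))"
    if "u < n" "v < n" for r u v
    unfolding pow using a that by (intro rep_expand[OF rep]) auto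
  have swap: "(\<Sum>r\<le>n. c r * (?M ^\<^sub>m r) $$ (u, v))
      = (\<Sum>b\<in>B. (\<Sum>r\<le>n. c r * \<iota> (coord (a [^] r) b)) * \<phi> b $$ (u, v))"
    if "u < n" "v < n" for c u v
    by (simp only: pow_index[OF that] sum_distrib_left sum_distrib_right mult.assoc) (rule sum.swap)
  have rel: "(\<Sum>r\<le>n. poly.coeff ?\<chi> r * \<iota> (coord (a [^] r) b)) = 0" if b: "b \<in> B" for b
  proof (rule mat_basis_unique[OF rep mat_basis _ b])
    fix u v assume uv: "u < n" "v < n"
    show "(\<Sum>b\<in>B. (\<Sum>r\<le>n. poly.coeff ?\<chi> r * \<iota> (coord (a [^] r) b)) * \<phi> b $$ (u, v))
        = (\<Sum>b\<in>B. 0 * \<phi> b $$ (u, v))"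
      unfolding swap[OF uv, symmetric] using cayley_hamilton[OF M uv] by simp
  qed
  define k where "k r = f (poly.coeff ?\<chi> r)" for r
  have kn: "k n = 1" using degree_monic_char_poly[OF M] f(1)[of 1] by (simp add: k_def)
  have rel_k: "(\<Sum>r\<le>n. \<iota> (k r) * \<iota> (coord (a [^] r) b)) = 0" if b: "b \<in> B" for b
  proof -
    have "0 = f (\<Sum>r\<le>n. poly.coeff ?\<chi> r * \<iota> (coord (a [^] r) b))" using rel[OF b] f(1)[of 0] by simp
    also have "\<dots> = (\<Sum>r\<le>n. k r * coord (a [^] r) b)"
      unfolding f_sum k_def by (intro sum.cong refl) (metis f(3) mult.commute)
    finally have "\<iota> (\<Sum>r\<le>n. k r * coord (a [^] r) b) = 0" by simp
    then show ?thesis by (simp add: hom_sum hom_mult)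
  qed
  have "(\<Sum>r\<le>n. \<iota> (k r) * (?M ^\<^sub>m r) $$ (u, v)) = 0" if uv: "u < n" "v < n" for u v
    unfolding swap[OF uv] using rel_k by simp
  then have M_rel: "(?M ^\<^sub>m n) $$ (u, v) = (\<Sum>r<n. \<iota> (- k r) * (?M ^\<^sub>m r) $$ (u, v))"
    if "u < n" "v < n" for u v
    using that kn
    by (simp add: lessThan_Suc_atMost[symmetric] hom_uminus sum_negf eq_neg_iff_add_eq_0 add.commute)
  have "?\<chi> = char_poly (companion n (\<lambda>r. \<iota> (- k r)))"
    by (rule char_poly_companion[OF M cyclic]) (rule M_rel[OF _ n])
  also have "companion n (\<lambda>r. \<iota> (- k r)) = map_mat \<iota> (companion n (\<lambda>r. - k r))"
    by (rule eq_matI) (auto simp: companion_def)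
  also have "char_poly \<dots> = map_poly \<iota> (char_poly (companion n (\<lambda>r. - k r)))"
    by (rule char_poly_hom[OF companion_carrier])
  finally show ?thesis by simp
qed

text \<open>The shift matrix is an L-combination of the \<open>\<phi> b\<close> and has a cyclic
  vector. Its coefficients are replaced one after the other by elements of K; each replacement has
  to avoid only the finitely many roots of a nonzero polynomial. \<open>I\<close> collects the
  indices already treated.\<close>

lemma cyclic_element_exists:
  assumes inf: "infinite (UNIV :: 'k set)"
  shows "\<exists>a\<in>carrier A. det (krylov n (\<phi> a)) \<noteq> 0"
proof -
  define lin where "lin l = mat n n (\<lambda>ij. \<Sum>b\<in>B. l b * \<phi> b $$ ij)" for l
  have lin [simp]: "lin l \<in> carrier_mat n n" for l by (simp add: lin_def)
  have inf': "infinite (range \<iota>)"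
    using inf finite_imageD[OF _ inj_hom] by blast
  have "\<exists>l. (\<forall>b\<in>I. l b \<in> range \<iota>) \<and> det (krylov n (lin l)) \<noteq> 0" if "finite I" "I \<subseteq> B" for I
    using that
  proof (induction I rule: finite_induct)
    case empty
    obtain l where l: "\<forall>i<n. \<forall>j<n. companion n (\<lambda>_. 0) $$ (i, j) = (\<Sum>b\<in>B. l b * \<phi> b $$ (i, j))"
      using mat_basis_expand[OF rep mat_basis companion_carrier] by blast
    then have "lin l = companion n (\<lambda>_. 0)"
      by (intro eq_matI) (auto simp: lin_def companion_def)
    then show ?case using det_krylov_shift[where 'a = 'l, of n] by (intro exI[of _ l]) simp
  next
    case (insert b I)
    then obtain l where l: "\<forall>b\<in>I. l b \<in> range \<iota>" "det (krylov n (lin l)) \<noteq> 0" by auto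
    have b: "b \<in> B" "\<phi> b \<in> carrier_mat n n"
      using insert.prems rep_carrier[OF rep B_carrier] by auto
    have upd: "lin (l(b := 0)) + s \<cdot>\<^sub>m \<phi> b = lin (l(b := s))" for s
    proof (rule eq_matI)
      fix i j assume "i < dim_row (lin (l(b := s)))" "j < dim_col (lin (l(b := s)))"
      then have ij: "i < n" "j < n" by (auto simp: lin_def)
      have "(\<Sum>c\<in>B. (l(b := s)) c * \<phi> c $$ (i, j))
          = (\<Sum>c\<in>B. (l(b := 0)) c * \<phi> c $$ (i, j) + (if c = b then s * \<phi> b $$ (i, j) else 0))"
        by (intro sum.cong refl) auto
      also have "\<dots> = (\<Sum>c\<in>B. (l(b := 0)) c * \<phi> c $$ (i, j)) + s * \<phi> b $$ (i, j)"
        using b(1) by (subst sum.distrib) (simp add: sum.delta del: fun_upd_apply)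
      finally show "(lin (l(b := 0)) + s \<cdot>\<^sub>m \<phi> b) $$ (i, j) = lin (l(b := s)) $$ (i, j)"
        using ij b(2) by (simp add: lin_def del: fun_upd_apply)
    qed (use b(2) in \<open>auto simp: lin_def\<close>)
    obtain q where q: "\<And>s. poly q s = det (krylov n (lin (l(b := s))))"
      using pencil_polynomials[OF lin[of "l(b := 0)"] b(2)] unfolding upd by metis
    have "poly q (l b) \<noteq> 0" using l(2) by (simp add: q)
    then have "q \<noteq> 0" by auto
    then have "finite {s. poly q s = 0}" by (rule poly_roots_finite)
    then obtain s where s: "s \<in> range \<iota>" "poly q s \<noteq> 0"
      using inf' by (metis (mono_tags, lifting) finite_subset mem_Collect_eq subsetI)
    have "\<forall>c\<in>insert b I. (l(b := s)) c \<in> range \<iota>" using l(1) s(1) by auto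
    moreover have "det (krylov n (lin (l(b := s)))) \<noteq> 0" using s(2) unfolding q .
    ultimately show ?case by blast
  qed
  from this[OF fin_B subset_refl]
  obtain l where l: "\<forall>b\<in>B. l b \<in> range \<iota>" "det (krylov n (lin l)) \<noteq> 0" by blast
  have "\<forall>b. \<exists>k. b \<in> B \<longrightarrow> l b = \<iota> k" using l(1) by blast
  then obtain k where k: "\<And>b. b \<in> B \<Longrightarrow> l b = \<iota> (k b)" by metis
  define a where "a = (\<Oplus>b\<in>B. \<sigma> (if b \<in> B then k b else 0) \<otimes> b)"
  have a: "a \<in> carrier A" unfolding a_def by (rule lincomb_in)
  have "coord a = (\<lambda>b. if b \<in> B then k b else 0)" unfolding a_def by (rule coord_lincomb) simp
  then have "\<phi> a = lin l"
    using rep_carrier[OF rep a] k by (intro eq_matI) (auto simp: lin_def rep_expand[OF rep a] intro!: sum.cong)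
  then show ?thesis using a l(2) by (intro bexI[of _ a]) simp_all
qed

theorem char_poly_rational:
  assumes inf: "infinite (UNIV :: 'k set)" and b: "b \<in> carrier A"
  shows "poly.coeff (char_poly (\<phi> b)) i \<in> range \<iota>"
proof -
  obtain a where a: "a \<in> carrier A" "det (krylov n (\<phi> a)) \<noteq> 0"
    using cyclic_element_exists[OF inf] by blast
  define N where "N = \<phi> a - \<phi> b"
  have carr: "\<phi> a \<in> carrier_mat n n" "\<phi> b \<in> carrier_mat n n" "N \<in> carrier_mat n n"
    using rep_carrier[OF rep a(1)] rep_carrier[OF rep b] by (auto simp: N_def)
  obtain q Q where q: "\<And>s. poly q s = det (krylov n (\<phi> b + s \<cdot>\<^sub>m N))"
    and Q: "\<And>s i. poly.coeff (char_poly (\<phi> b + s \<cdot>\<^sub>m N)) i = poly (poly.coeff Q i) s"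
    using pencil_polynomials[OF carr(2,3)] by metis
  have "\<phi> b + 1 \<cdot>\<^sub>m N = \<phi> a" using carr by (intro eq_matI) (auto simp: N_def)
  \<comment> \<open>The parameter 1 gives the cyclic element \<open>a\<close>, so \<open>q\<close>
    is not the zero polynomial. The parameter 0, which gives \<open>b\<close>, may be a root of
    \<open>q\<close>; its value is therefore reached by interpolation.\<close>
  then have "poly q 1 \<noteq> 0" using a(2) by (simp add: q)
  then have "q \<noteq> 0" by auto
  then have fin: "finite {s. poly q s = 0}" by (rule poly_roots_finite)
  have inf': "infinite (range \<iota>)"
    using inf finite_imageD[OF _ inj_hom] by blast
  let ?S = "range \<iota> - {s. poly q s = 0}"
  have "poly (poly.coeff Q i) 0 \<in> range \<iota>"
  proof (rule poly_value_in_subfield[of \<iota> ?S])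
    show "infinite ?S" using inf' fin by simp
    fix s assume s: "s \<in> ?S"
    then obtain k where k: "s = \<iota> k" by blast
    \<comment> \<open>Since \<open>k\<close> lies in K, the point of the line with parameter
      \<open>\<iota> k\<close> is the image of an element of A.\<close>
    define x where "x = b \<oplus> \<sigma> k \<otimes> a \<oplus> \<sigma> (- k) \<otimes> b"
    have x: "x \<in> carrier A" using a b by (simp add: x_def)
    have "\<phi> x = \<phi> b + \<iota> k \<cdot>\<^sub>m \<phi> a + \<iota> (- k) \<cdot>\<^sub>m \<phi> b"
      using a b by (simp add: x_def rep_add[OF rep] rep_scalar_mult[OF rep])
    also have "\<dots> = \<phi> b + s \<cdot>\<^sub>m N"
      using carr by (intro eq_matI) (auto simp: N_def k hom_uminus algebra_simps)
    finally have "\<phi> x = \<phi> b + s \<cdot>\<^sub>m N" .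
    then show "poly (poly.coeff Q i) s \<in> range \<iota>"
      using char_poly_rational_cyclic[OF x] s by (simp add: q Q[symmetric])
  next
    have "\<iota> 0 \<in> range \<iota>" by (rule rangeI)
    then show "0 \<in> range \<iota>" by simp
  qed (unfold_locales, auto)
  moreover have "\<phi> b + 0 \<cdot>\<^sub>m N = \<phi> b" using carr by (intro eq_matI) auto
  ultimately show ?thesis using Q[of 0 i] by simp
qed

end
end

text \<open>\<open>h(x) - h(M)\<close> is a multiple of \<open>x - M\<close>, so \<open>h(M) = 0\<close> makes \<open>h(x)\<close> a multiple of \<open>x - M\<close>;
  take determinants.\<close>

lemma char_poly_dvd_power:
  fixes M :: "'a::idom mat"
  assumes M: "M \<in> carrier_mat n n"
    and h: "\<And>i j. i < n \<Longrightarrow> j < n \<Longrightarrow> (\<Sum>r\<le>degree h. coeff h r * (M ^\<^sub>m r) $$ (i, j)) = 0"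
  shows "char_poly M dvd h ^ n"
proof -
  define ev where "ev h = mat n n (\<lambda>(i, j). \<Sum>r\<le>degree h. coeff h r * (M ^\<^sub>m r) $$ (i, j))" for h
  have pow: "M ^\<^sub>m r \<in> carrier_mat n n" for r using M by simp
  have "\<exists>D\<in>carrier_mat n n. \<forall>i<n. \<forall>j<n.
      (if i = j then h else 0) - [:ev h $$ (i, j):] = (char_poly_matrix M * D) $$ (i, j)" for h
  proof (induction h)
    case 0
    show ?case using right_mult_zero_mat[OF char_poly_matrix_closed[OF M], of n]
      by (intro bexI[of _ "0\<^sub>m n n"]) (auto simp: ev_def)
  next
    case (pCons a h)
    then obtain D where D: "D \<in> carrier_mat n n" "\<And>i j. i < n \<Longrightarrow> j < n \<Longrightarrow>
      (if i = j then h else 0) - [:ev h $$ (i, j):] = (char_poly_matrix M * D) $$ (i, j)" by blast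
    let ?c = "\<lambda>a::'a. [:a:]"
    interpret c: comm_ring_hom ?c by unfold_locales (auto simp: one_pCons)
    have ev_c: "ev h \<in> carrier_mat n n" by (simp add: ev_def)
    have ev_pCons: "ev (pCons a h) $$ (i, j) = (if i = j then a else 0) + (M * ev h) $$ (i, j)"
      if ij: "i < n" "j < n" for i j
    proof -
      have "(\<Sum>r\<le>degree (pCons a h). coeff (pCons a h) r * (M ^\<^sub>m r) $$ (i, j))
          = (\<Sum>r\<le>Suc (degree h). coeff (pCons a h) r * (M ^\<^sub>m r) $$ (i, j))"
        by (intro sum.mono_neutral_left) (auto simp: coeff_eq_0 intro: degree_pCons_le[THEN le_trans])
      also have "\<dots> = (if i = j then a else 0) + (\<Sum>r\<le>degree h. coeff h r * (M ^\<^sub>m Suc r) $$ (i, j))"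
        using ij M by (subst sum.atMost_Suc_shift) (simp del: pow_mat.simps(2))
      also have "(\<Sum>r\<le>degree h. coeff h r * (M ^\<^sub>m Suc r) $$ (i, j))
          = (\<Sum>r\<le>degree h. \<Sum>u<n. M $$ (i, u) * (coeff h r * (M ^\<^sub>m r) $$ (u, j)))"
        unfolding pow_mat_Suc_left[OF M] mult_mat_index[OF M pow ij]
        by (simp add: sum_distrib_left mult.left_commute)
      also have "\<dots> = (M * ev h) $$ (i, j)"
        unfolding mult_mat_index[OF M ev_c ij]
        by (subst sum.swap) (use ij in \<open>simp add: ev_def sum_distrib_left\<close>)
      finally show ?thesis using ij by (simp add: ev_def)
    qed
    \<comment> \<open>Horner step: y h - M h(M) = y (h - h(M)) + (y - M) h(M), so the quotient for
      \<open>pCons a h\<close> is y D + h(M).\<close>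
    define D' where "D' = [:0, 1:] \<cdot>\<^sub>m D + map_mat ?c (ev h)"
    have D': "D' \<in> carrier_mat n n" using D(1) by (simp add: D'_def ev_def)
    have "(if i = j then pCons a h else 0) - [:ev (pCons a h) $$ (i, j):] = (char_poly_matrix M * D') $$ (i, j)"
      if ij: "i < n" "j < n" for i j
    proof -
      have "(char_poly_matrix M * D') $$ (i, j)
          = (\<Sum>u<n. [:0, 1:] * (char_poly_matrix M $$ (i, u) * D $$ (u, j))
            + char_poly_matrix M $$ (i, u) * [:ev h $$ (u, j):])"
        unfolding mult_mat_index[OF char_poly_matrix_closed[OF M] D' ij]
        by (intro sum.cong refl) (use ij D(1) ev_c in \<open>simp add: D'_def algebra_simps\<close>)
      also have "\<dots> = [:0, 1:] * (char_poly_matrix M * D) $$ (i, j)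
          + (\<Sum>u<n. char_poly_matrix M $$ (i, u) * [:ev h $$ (u, j):])"
        unfolding sum.distrib mult_mat_index[OF char_poly_matrix_closed[OF M] D(1) ij] sum_distrib_left ..
      also have "(\<Sum>u<n. char_poly_matrix M $$ (i, u) * [:ev h $$ (u, j):])
          = (\<Sum>u<n. (if i = u then [:0, 1:] * [:ev h $$ (i, j):] else 0) - [:M $$ (i, u) * ev h $$ (u, j):])"
        by (intro sum.cong refl) (use M ij in \<open>auto simp: char_poly_matrix_index\<close>)
      also have "\<dots> = [:0, 1:] * [:ev h $$ (i, j):] - [:(M * ev h) $$ (i, j):]"
        using ij by (simp add: sum_subtractf mult_mat_index[OF M ev_c] c.hom_sum)
      finally show ?thesis
        using ij by (auto simp: D(2)[symmetric] ev_pCons algebra_simps)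
    qed
    then show ?case using D' by blast
  qed
  then obtain D where D: "D \<in> carrier_mat n n" "\<forall>i<n. \<forall>j<n.
      (if i = j then h else 0) - [:ev h $$ (i, j):] = (char_poly_matrix M * D) $$ (i, j)" by blast
  have "char_poly_matrix M * D = h \<cdot>\<^sub>m 1\<^sub>m n"
  proof (rule eq_matI)
    fix i j assume "i < dim_row (h \<cdot>\<^sub>m 1\<^sub>m n)" "j < dim_col (h \<cdot>\<^sub>m 1\<^sub>m n)"
    then have ij: "i < n" "j < n" by auto
    then have "ev h $$ (i, j) = 0" by (simp add: ev_def assms(2))
    then show "(char_poly_matrix M * D) $$ (i, j) = (h \<cdot>\<^sub>m 1\<^sub>m n) $$ (i, j)"
      using D(2)[rule_format, OF ij, symmetric] ij by simp
  qed (use D(1) M in \<open>auto simp: char_poly_matrix_def\<close>)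
  then have "char_poly M * det D = h ^ n"
    using det_mult[OF char_poly_matrix_closed[OF M] D(1)] by (simp add: char_poly_def)
  then show ?thesis by (metis dvd_triv_left)
qed

section \<open>Gauss's lemma\<close>

text \<open>A divisor of least positive degree is irreducible, hence prime.\<close>

lemma prime_factor_exists_poly:
  fixes a :: "'f::field poly"
  assumes "degree a > 0"
  shows "\<exists>\<pi>. prime_elem \<pi> \<and> \<pi> dvd a"
proof -
  define P where "P n \<longleftrightarrow> n > 0 \<and> (\<exists>\<pi>. degree \<pi> = n \<and> \<pi> dvd a)" for n
  have "P (degree a)" using assms by (auto simp: P_def)
  then have "P (LEAST n. P n)" by (rule LeastI)
  then obtain \<pi> where \<pi>: "degree \<pi> > 0" "degree \<pi> = (LEAST n. P n)" "\<pi> dvd a"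
    by (auto simp: P_def)
  have "\<pi> \<noteq> 0" using \<pi>(1) by auto
  have "irreducible \<pi>"
  proof (rule irreducibleI)
    show "\<not> is_unit \<pi>" using \<pi>(1) \<open>\<pi> \<noteq> 0\<close> by (simp add: is_unit_iff_degree)
    fix r s assume rs: "\<pi> = r * s"
    then have nz: "r \<noteq> 0" "s \<noteq> 0" using \<open>\<pi> \<noteq> 0\<close> by auto
    have deg: "degree \<pi> = degree r + degree s" using nz by (simp add: rs degree_mult_eq)
    have "degree r = 0 \<or> degree s = 0"
    proof (rule ccontr)
      assume pos: "\<not> ?thesis"
      have "r dvd a" using \<pi>(3) rs by (auto elim: dvd_mult_left)
      then have "P (degree r)" using pos by (auto simp: P_def)
      then have "degree \<pi> \<le> degree r" unfolding \<pi>(2) by (rule Least_le)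
      then show False using deg pos by simp
    qed
    then show "is_unit r \<or> is_unit s" using nz by (simp add: is_unit_iff_degree)
  qed fact
  then show ?thesis using field_poly_irreducible_imp_prime \<pi>(3) by blast
qed

lemma common_denominator:
  fixes u :: "'p::idom fract poly"
  shows "\<exists>a U. a \<noteq> 0 \<and> smult (to_fract a) u = map_poly to_fract U"
proof (induction u)
  case 0
  show ?case by (intro exI[of _ 1] exI[of _ 0]) simp
next
  case (pCons c u)
  then obtain a U where U: "a \<noteq> 0" "smult (to_fract a) u = map_poly to_fract U" by blast
  obtain r s where c: "c = Fract r s" "s \<noteq> 0" by (cases c) auto
  have "to_fract (s * a) * c = to_fract (a * r)"
    using c by (simp add: to_fract_def eq_fract mult_ac)
  moreover have "smult (to_fract (s * a)) u = map_poly to_fract (smult s U)"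
  proof -
    have "smult (to_fract (s * a)) u = smult (to_fract s) (map_poly to_fract U)"
      by (simp add: U(2)[symmetric])
    also have "\<dots> = map_poly to_fract (smult s U)"
      by (rule poly_eqI) (simp add: coeff_map_poly)
    finally show ?thesis .
  qed
  ultimately show ?case using U(1) c(2)
    by (intro exI[of _ "s * a"] exI[of _ "pCons (a * r) (smult s U)"]) (simp add: Polynomial.map_poly_pCons)
qed

text \<open>A denominator of least degree leaves a primitive numerator. If a prime \<pi> divided
  \<open>U\<close>, then, \<open>u\<close> being monic, \<pi> would divide the coefficient
  \<open>a\<close> of \<open>U\<close> at \<open>degree u\<close>, and cancelling \<pi> would give a
  smaller denominator.\<close>

lemma minimal_denominator:
  fixes u :: "'f::field poly fract poly"
  assumes "lead_coeff u = 1"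
  obtains a U where "a \<noteq> 0" "smult (to_fract a) u = map_poly to_fract U"
    "\<And>\<pi>. prime_elem \<pi> \<Longrightarrow> \<not> [:\<pi>:] dvd U"
proof -
  define P where "P n \<longleftrightarrow> (\<exists>a U. a \<noteq> 0 \<and> degree a = n \<and> smult (to_fract a) u = map_poly to_fract U)" for n
  have "\<exists>n. P n" using common_denominator[of u] by (auto simp: P_def)
  then have "P (LEAST n. P n)" by (rule LeastI_ex)
  then obtain a U where U: "a \<noteq> 0" "degree a = (LEAST n. P n)" "smult (to_fract a) u = map_poly to_fract U"
    by (auto simp: P_def)
  have "\<not> [:\<pi>:] dvd U" if \<pi>: "prime_elem \<pi>" for \<pi>
  proof
    assume "[:\<pi>:] dvd U"
    then obtain V where V: "U = smult \<pi> V" by (auto simp: dvd_def)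
    have \<pi>0: "\<pi> \<noteq> 0" using \<pi> by auto
    have eq: "to_fract a * coeff u i = to_fract (\<pi> * coeff V i)" for i
      using arg_cong[OF U(3), of "\<lambda>p. coeff p i"] by (simp add: V coeff_map_poly)
    define b where "b = coeff V (degree u)"
    have "to_fract a = to_fract (\<pi> * b)" using eq[of "degree u"] assms by (simp add: b_def)
    then have ab: "a = \<pi> * b" by (simp only: to_fract_eq_iff)
    have b0: "b \<noteq> 0" using ab U(1) by auto
    have "smult (to_fract b) u = map_poly to_fract V"
    proof (rule poly_eqI)
      fix i
      have "to_fract \<pi> * (to_fract b * coeff u i) = to_fract \<pi> * to_fract (coeff V i)"
        using eq[of i] by (simp add: ab mult.assoc)
      then show "coeff (smult (to_fract b) u) i = coeff (map_poly to_fract V) i"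
        using \<pi>0 by (simp add: coeff_map_poly)
    qed
    then have "P (degree b)" using b0 by (auto simp: P_def)
    then have "degree a \<le> degree b" unfolding U(2) by (rule Least_le)
    moreover have "degree a = degree \<pi> + degree b" using ab \<pi>0 b0 by (simp add: degree_mult_eq)
    ultimately have "degree \<pi> = 0" by simp
    then have "is_unit \<pi>" using \<pi>0 by (simp add: is_unit_iff_degree)
    then show False using \<pi> by (auto simp: prime_elem_def)
  qed
  then show ?thesis using that U by blast
qed

text \<open>With primitive numerators \<open>U\<close> and \<open>V\<close> of the two monic
  factors, \<open>U * V = smult (a * b) h\<close>. A prime divisor of \<open>a * b\<close> stays
  prime as a constant polynomial and would divide \<open>U\<close> or \<open>V\<close>. So
  \<open>a\<close> is a nonzero constant and can be inverted.\<close>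

lemma monic_factor_integral:
  fixes h :: "'f::field poly poly" and u :: "'f poly fract poly"
  assumes h: "lead_coeff h = 1" and u: "lead_coeff u = 1" and dvd: "u dvd map_poly to_fract h"
  shows "coeff u i \<in> range to_fract"
proof -
  obtain v where v: "map_poly to_fract h = u * v" using dvd unfolding dvd_def by blast
  have "lead_coeff (map_poly to_fract h) = 1"
    using h by (simp add: Polynomial.degree_map_poly coeff_map_poly)
  then have v1: "lead_coeff v = 1" using u by (simp add: v lead_coeff_mult)
  obtain a U where U: "a \<noteq> 0" "smult (to_fract a) u = map_poly to_fract U"
      "\<And>\<pi>. prime_elem \<pi> \<Longrightarrow> \<not> [:\<pi>:] dvd U"
    using minimal_denominator[OF u] by metis
  obtain b V where V: "b \<noteq> 0" "smult (to_fract b) v = map_poly to_fract V"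
      "\<And>\<pi>. prime_elem \<pi> \<Longrightarrow> \<not> [:\<pi>:] dvd V"
    using minimal_denominator[OF v1] by metis
  have "map_poly to_fract (U * V) = smult (to_fract a) u * smult (to_fract b) v"
    by (simp only: fract_poly_mult U(2) V(2))
  also have "\<dots> = smult (to_fract (a * b)) (map_poly to_fract h)"
    by (simp add: v mult_ac)
  also have "\<dots> = map_poly to_fract (smult (a * b) h)"
    by (rule poly_eqI) (simp add: coeff_map_poly)
  finally have "U * V = smult (a * b) h" by (simp only: fract_poly_eq_iff)
  then have UV: "U * V = [:a * b:] * h" by simp
  have "degree (a * b) = 0"
  proof (rule ccontr)
    assume "degree (a * b) \<noteq> 0"
    then obtain \<pi> where \<pi>: "prime_elem \<pi>" "\<pi> dvd a * b"
      using prime_factor_exists_poly[of "a * b"] by auto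
    then have "[:\<pi>:] dvd U * V" unfolding UV by (intro dvd_mult2) simp
    moreover have "prime_elem [:\<pi>:]" using \<pi>(1) by (rule lift_prime_elem_poly)
    ultimately show False using U(3) V(3) \<pi>(1) by (auto simp: prime_elem_dvd_mult_iff)
  qed
  then have "degree a = 0" using U(1) V(1) by (simp add: degree_mult_eq)
  then obtain r where r: "a = [:r:]" by (metis degree_eq_zeroE)
  have "r \<noteq> 0" using r U(1) by auto
  have "to_fract (1::'f poly) = to_fract [:inverse r:] * to_fract a"
    using \<open>r \<noteq> 0\<close> by (simp add: r to_fract_mult[symmetric] one_pCons)
  then have "coeff u i = to_fract [:inverse r:] * coeff (smult (to_fract a) u) i"
    by (simp add: mult.assoc[symmetric])
  also have "\<dots> = to_fract ([:inverse r:] * coeff U i)"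
    unfolding U(2) to_fract_mult by (simp add: coeff_map_poly)
  finally show ?thesis by blast
qed

section \<open>Central quotients\<close>

locale central_localization = Ring.ring R for R :: "('a, 'm) ring_scheme" (structure) +
  fixes S :: "'a set"
  assumes S_carrier: "s \<in> S \<Longrightarrow> s \<in> carrier R"
    and one_S: "\<one> \<in> S"
    and mult_S: "s \<in> S \<Longrightarrow> u \<in> S \<Longrightarrow> s \<otimes> u \<in> S"
    and S_central: "s \<in> S \<Longrightarrow> f \<in> carrier R \<Longrightarrow> s \<otimes> f = f \<otimes> s"
    and S_cancel: "s \<in> S \<Longrightarrow> f \<in> carrier R \<Longrightarrow> f \<otimes> s = \<zero> \<Longrightarrow> f = \<zero>"
begin

abbreviation Q where "Q \<equiv> central_quotients R S"
abbreviation qt where "qt \<equiv> quot R S"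

lemma S_right_cancel:
  assumes "s \<in> S" "f \<in> carrier R" "g \<in> carrier R" "f \<otimes> s = g \<otimes> s"
  shows "f = g"
proof -
  have "(f \<ominus> g) \<otimes> s = \<zero>"
    using assms S_carrier by (simp add: a_minus_def l_distr l_minus r_neg)
  then have "f \<ominus> g = \<zero>" using assms by (intro S_cancel[OF assms(1) minus_closed])
  then show ?thesis using assms by (simp add: r_right_minus_eq)
qed

lemma mult_swap:
  assumes "f \<in> carrier R" "g \<in> carrier R" "s \<in> S" "u \<in> carrier R"
  shows "f \<otimes> g \<otimes> (s \<otimes> u) = f \<otimes> s \<otimes> (g \<otimes> u)"
proof -
  have "f \<otimes> g \<otimes> (s \<otimes> u) = f \<otimes> (g \<otimes> s) \<otimes> u" using assms S_carrier by (simp add: m_assoc)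
  also have "\<dots> = f \<otimes> (s \<otimes> g) \<otimes> u" using assms by (simp add: S_central)
  also have "\<dots> = f \<otimes> s \<otimes> (g \<otimes> u)" using assms S_carrier by (simp add: m_assoc)
  finally show ?thesis .
qed

lemma qt_eqI:
  assumes f: "f \<in> carrier R" and f': "f' \<in> carrier R" and s: "s \<in> S" and s': "s' \<in> S"
    and eq: "f \<otimes> s' = f' \<otimes> s"
  shows "qt f s = qt f' s'"
proof -
  have sub: "qt f s \<subseteq> qt f' s'"
    if f: "f \<in> carrier R" and f': "f' \<in> carrier R" and s: "s \<in> S" and s': "s' \<in> S"
      and eq: "f \<otimes> s' = f' \<otimes> s" for f f' s s'
  proof
    fix y assume "y \<in> qt f s"
    then obtain g u where y: "y = (g, u)" "g \<in> carrier R" "u \<in> S" "f \<otimes> u = g \<otimes> s"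
      by (auto simp: quot_def)
    note carr = f f' y(2) s[THEN S_carrier] s'[THEN S_carrier] y(3)[THEN S_carrier]
    \<comment> \<open>Transitivity of equality of fractions: multiply by the denominator
      \<open>s\<close> in the middle, then cancel it.\<close>
    have "f' \<otimes> u \<otimes> s = f' \<otimes> s \<otimes> u"
      using carr y s by (simp add: m_assoc S_central[OF s])
    also have "\<dots> = f \<otimes> s' \<otimes> u" by (simp add: eq)
    also have "\<dots> = f \<otimes> u \<otimes> s'"
      using carr by (simp add: m_assoc S_central[OF s'])
    also have "\<dots> = g \<otimes> s \<otimes> s'" by (simp add: y)
    also have "\<dots> = g \<otimes> s' \<otimes> s"
      using carr by (simp add: m_assoc S_central[OF s])
    finally have "f' \<otimes> u \<otimes> s = g \<otimes> s' \<otimes> s" .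
    then have "f' \<otimes> u = g \<otimes> s'"
      using carr by (intro S_right_cancel[OF s, of "f' \<otimes> u" "g \<otimes> s'"] m_closed)
    then show "y \<in> qt f' s'" using y by (simp add: quot_def)
  qed
  show ?thesis by (intro equalityI sub) (use assms in auto)
qed

lemma qt_self: "f \<in> carrier R \<Longrightarrow> s \<in> S \<Longrightarrow> (f, s) \<in> qt f s"
  by (simp add: quot_def)

lemma qt_eq_iff:
  assumes "f \<in> carrier R" "f' \<in> carrier R" "s \<in> S" "s' \<in> S"
  shows "qt f s = qt f' s' \<longleftrightarrow> f \<otimes> s' = f' \<otimes> s"
proof
  assume "qt f s = qt f' s'"
  then have "(f', s') \<in> qt f s" using qt_self assms by simp
  then show "f \<otimes> s' = f' \<otimes> s" by (simp add: quot_def)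
qed (rule qt_eqI[OF assms])

lemma Q_carrier: "x \<in> carrier Q \<longleftrightarrow> (\<exists>f s. f \<in> carrier R \<and> s \<in> S \<and> x = qt f s)"
  by (auto simp: central_quotients_def)

lemma qt_in_Q [simp, intro]: "f \<in> carrier R \<Longrightarrow> s \<in> S \<Longrightarrow> qt f s \<in> carrier Q"
  by (auto simp: Q_carrier)

lemma Q_one: "\<one>\<^bsub>Q\<^esub> = qt \<one> \<one>" and Q_zero: "\<zero>\<^bsub>Q\<^esub> = qt \<zero> \<one>"
  by (simp_all add: central_quotients_def)

lemma Q_mult:
  assumes f: "f \<in> carrier R" "f' \<in> carrier R" and s: "s \<in> S" "s' \<in> S"
  shows "qt f s \<otimes>\<^bsub>Q\<^esub> qt f' s' = qt (f \<otimes> f') (s \<otimes> s')"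
proof -
  have "qt (g \<otimes> g') (u \<otimes> u') = qt (f \<otimes> f') (s \<otimes> s')"
    if "(g, u) \<in> qt f s" "(g', u') \<in> qt f' s'" for g u g' u'
  proof (rule qt_eqI)
    from that have g: "g \<in> carrier R" "g' \<in> carrier R" and u: "u \<in> S" "u' \<in> S"
      and eq: "f \<otimes> u = g \<otimes> s" "f' \<otimes> u' = g' \<otimes> s'" by (auto simp: quot_def)
    then show "g \<otimes> g' \<in> carrier R" "f \<otimes> f' \<in> carrier R" "u \<otimes> u' \<in> S" "s \<otimes> s' \<in> S"
      using f s by (auto intro: mult_S)
    have "g \<otimes> g' \<otimes> (s \<otimes> s') = g \<otimes> s \<otimes> (g' \<otimes> s')"
      using g s S_carrier by (intro mult_swap) auto
    also have "\<dots> = f \<otimes> u \<otimes> (f' \<otimes> u')" by (simp add: eq)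
    also have "\<dots> = f \<otimes> f' \<otimes> (u \<otimes> u')"
      using f u S_carrier by (intro mult_swap[symmetric]) auto
    finally show "g \<otimes> g' \<otimes> (s \<otimes> s') = f \<otimes> f' \<otimes> (u \<otimes> u')" .
  qed
  then have "(\<Union>(g, u)\<in>qt f s. \<Union>(g', u')\<in>qt f' s'. qt (g \<otimes> g') (u \<otimes> u'))
      = (\<Union>x\<in>qt f s. \<Union>y\<in>qt f' s'. qt (f \<otimes> f') (s \<otimes> s'))"
    by (intro SUP_cong refl) (auto split: prod.splits)
  also have "\<dots> = qt (f \<otimes> f') (s \<otimes> s')"
    using qt_self[OF f(1) s(1)] qt_self[OF f(2) s(2)] by blast
  finally show ?thesis by (simp add: central_quotients_def)
qed

lemma Q_add_aux:
  assumes "f \<in> carrier R" "f' \<in> carrier R" "s \<in> S" "s' \<in> S"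
  shows "qt f s \<oplus>\<^bsub>Q\<^esub> qt f' s' = qt (f \<otimes> s' \<oplus> f' \<otimes> s) (s \<otimes> s')"
proof -
  note f = assms(1,2) and s = assms(3,4)
  have half: "g \<otimes> u' \<otimes> (s \<otimes> s') = f \<otimes> s' \<otimes> (u \<otimes> u')"
    if g: "g \<in> carrier R" "f \<in> carrier R" and u: "u \<in> S" "u' \<in> S" "s \<in> S" "s' \<in> S"
      and eq: "f \<otimes> u = g \<otimes> s" for g f u u' s s'
  proof -
    have "g \<otimes> u' \<otimes> (s \<otimes> s') = g \<otimes> s \<otimes> (u' \<otimes> s')"
      using g u S_carrier by (intro mult_swap) auto
    also have "\<dots> = f \<otimes> u \<otimes> (s' \<otimes> u')" using u S_carrier by (simp add: eq S_central)
    also have "\<dots> = f \<otimes> s' \<otimes> (u \<otimes> u')"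
      using g u S_carrier by (intro mult_swap[symmetric]) auto
    finally show ?thesis .
  qed
  have "qt (g \<otimes> u' \<oplus> g' \<otimes> u) (u \<otimes> u') = qt (f \<otimes> s' \<oplus> f' \<otimes> s) (s \<otimes> s')"
    if "(g, u) \<in> qt f s" "(g', u') \<in> qt f' s'" for g u g' u'
  proof (rule qt_eqI)
    from that have g: "g \<in> carrier R" "g' \<in> carrier R" and u: "u \<in> S" "u' \<in> S"
      and eq: "f \<otimes> u = g \<otimes> s" "f' \<otimes> u' = g' \<otimes> s'" by (auto simp: quot_def)
    then show "g \<otimes> u' \<oplus> g' \<otimes> u \<in> carrier R" "f \<otimes> s' \<oplus> f' \<otimes> s \<in> carrier R" "u \<otimes> u' \<in> S" "s \<otimes> s' \<in> S"
      using f s S_carrier by (auto intro: mult_S)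
    have "g' \<otimes> u \<otimes> (s \<otimes> s') = g' \<otimes> u \<otimes> (s' \<otimes> s)" using s S_carrier by (simp add: S_central)
    also have "\<dots> = f' \<otimes> s \<otimes> (u' \<otimes> u)" by (rule half) (use g f u s eq in auto)
    also have "\<dots> = f' \<otimes> s \<otimes> (u \<otimes> u')" using u S_carrier by (simp add: S_central)
    finally have "g' \<otimes> u \<otimes> (s \<otimes> s') = f' \<otimes> s \<otimes> (u \<otimes> u')" .
    moreover have "g \<otimes> u' \<otimes> (s \<otimes> s') = f \<otimes> s' \<otimes> (u \<otimes> u')"
      by (rule half) (use g f u s eq in auto)
    ultimately show "(g \<otimes> u' \<oplus> g' \<otimes> u) \<otimes> (s \<otimes> s') = (f \<otimes> s' \<oplus> f' \<otimes> s) \<otimes> (u \<otimes> u')"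
      using g f u s S_carrier by (simp add: l_distr)
  qed
  then have "(\<Union>(g, u)\<in>qt f s. \<Union>(g', u')\<in>qt f' s'. qt (g \<otimes> u' \<oplus> g' \<otimes> u) (u \<otimes> u'))
      = (\<Union>x\<in>qt f s. \<Union>y\<in>qt f' s'. qt (f \<otimes> s' \<oplus> f' \<otimes> s) (s \<otimes> s'))"
    by (intro SUP_cong refl) (auto split: prod.splits)
  also have "\<dots> = qt (f \<otimes> s' \<oplus> f' \<otimes> s) (s \<otimes> s')"
    using qt_self[OF f(1) s(1)] qt_self[OF f(2) s(2)] by blast
  finally show ?thesis by (simp add: central_quotients_def)
qed

lemma qt_expand:
  assumes "f \<in> carrier R" "s \<in> S" "u \<in> S"
  shows "qt (f \<otimes> u) (s \<otimes> u) = qt f s"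
  using assms S_carrier by (intro qt_eqI) (auto intro: mult_S simp: m_assoc S_central)

lemma Q_add:
  assumes "f \<in> carrier R" "f' \<in> carrier R" "s \<in> S"
  shows "qt f s \<oplus>\<^bsub>Q\<^esub> qt f' s = qt (f \<oplus> f') s"
  using assms S_carrier qt_expand[of "f \<oplus> f'" s s] by (simp add: Q_add_aux l_distr)

text \<open>Over one denominator, addition is addition of numerators (\<open>Q_add\<close>); the
  ring laws of the quotients then reduce to those of R.\<close>

lemma common_denominator2:
  assumes "x \<in> carrier Q" "y \<in> carrier Q"
  obtains f g s where "f \<in> carrier R" "g \<in> carrier R" "s \<in> S" "x = qt f s" "y = qt g s"
proof -
  from assms obtain f s g u where *: "f \<in> carrier R" "s \<in> S" "x = qt f s" "g \<in> carrier R" "u \<in> S" "y = qt g u"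
    by (auto simp: Q_carrier)
  show ?thesis
  proof (rule that)
    show "x = qt (f \<otimes> u) (s \<otimes> u)" using * by (simp add: qt_expand)
    show "y = qt (g \<otimes> s) (s \<otimes> u)" using * S_carrier qt_expand[of g u s] by (simp add: S_central)
  qed (use * S_carrier in \<open>auto intro: mult_S\<close>)
qed

lemma common_denominator3:
  assumes "x \<in> carrier Q" "y \<in> carrier Q" "z \<in> carrier Q"
  obtains f g h s where "f \<in> carrier R" "g \<in> carrier R" "h \<in> carrier R" "s \<in> S"
    "x = qt f s" "y = qt g s" "z = qt h s"
proof -
  from common_denominator2[OF assms(1,2)] obtain f g s
    where *: "f \<in> carrier R" "g \<in> carrier R" "s \<in> S" "x = qt f s" "y = qt g s" .
  from assms obtain h u where **: "h \<in> carrier R" "u \<in> S" "z = qt h u" by (auto simp: Q_carrier)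
  show ?thesis
  proof (rule that)
    show "x = qt (f \<otimes> u) (s \<otimes> u)" "y = qt (g \<otimes> u) (s \<otimes> u)" using * ** by (simp_all add: qt_expand)
    show "z = qt (h \<otimes> s) (s \<otimes> u)" using * ** S_carrier qt_expand[of h u s] by (simp add: S_central)
  qed (use * ** S_carrier in \<open>auto intro: mult_S\<close>)
qed

lemma Q_zero_eq: "s \<in> S \<Longrightarrow> qt \<zero> s = \<zero>\<^bsub>Q\<^esub>"
  unfolding Q_zero using S_carrier one_S by (intro qt_eqI) auto

lemma Q_zero_iff: "f \<in> carrier R \<Longrightarrow> s \<in> S \<Longrightarrow> qt f s = \<zero>\<^bsub>Q\<^esub> \<longleftrightarrow> f = \<zero>"
  unfolding Q_zero using S_carrier one_S by (subst qt_eq_iff) auto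

lemma ring_Q: "Ring.ring Q"
proof (rule ringI)
  show "abelian_group Q"
  proof (rule abelian_groupI)
    fix x y assume "x \<in> carrier Q" "y \<in> carrier Q"
    then obtain f g s where *: "f \<in> carrier R" "g \<in> carrier R" "s \<in> S" "x = qt f s" "y = qt g s"
      by (rule common_denominator2)
    show "x \<oplus>\<^bsub>Q\<^esub> y \<in> carrier Q" using * by (simp add: Q_add)
    show "x \<oplus>\<^bsub>Q\<^esub> y = y \<oplus>\<^bsub>Q\<^esub> x" using * by (simp add: Q_add a_comm)
  next
    show "\<zero>\<^bsub>Q\<^esub> \<in> carrier Q" using one_S by (simp add: Q_zero)
  next
    fix x y z assume "x \<in> carrier Q" "y \<in> carrier Q" "z \<in> carrier Q"
    then obtain f g h s where "f \<in> carrier R" "g \<in> carrier R" "h \<in> carrier R" "s \<in> S"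
      "x = qt f s" "y = qt g s" "z = qt h s" by (rule common_denominator3)
    then show "x \<oplus>\<^bsub>Q\<^esub> y \<oplus>\<^bsub>Q\<^esub> z = x \<oplus>\<^bsub>Q\<^esub> (y \<oplus>\<^bsub>Q\<^esub> z)" by (simp add: Q_add a_assoc)
  next
    fix x assume "x \<in> carrier Q"
    then obtain f s where *: "f \<in> carrier R" "s \<in> S" "x = qt f s" by (auto simp: Q_carrier)
    show "\<zero>\<^bsub>Q\<^esub> \<oplus>\<^bsub>Q\<^esub> x = x" using * Q_add[of \<zero> f s] by (simp add: Q_zero_eq)
    show "\<exists>y\<in>carrier Q. y \<oplus>\<^bsub>Q\<^esub> x = \<zero>\<^bsub>Q\<^esub>"
      using * by (intro bexI[of _ "qt (\<ominus> f) s"]) (auto simp: Q_add l_neg Q_zero_eq)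
  qed
  show "Group.monoid Q"
  proof (rule monoidI)
    fix x y assume "x \<in> carrier Q" "y \<in> carrier Q"
    then obtain f g s where "f \<in> carrier R" "g \<in> carrier R" "s \<in> S" "x = qt f s" "y = qt g s"
      by (rule common_denominator2)
    then show "x \<otimes>\<^bsub>Q\<^esub> y \<in> carrier Q" by (simp add: Q_mult mult_S)
  next
    show "\<one>\<^bsub>Q\<^esub> \<in> carrier Q" using one_S by (simp add: Q_one)
  next
    fix x y z assume "x \<in> carrier Q" "y \<in> carrier Q" "z \<in> carrier Q"
    then obtain f g h s where "f \<in> carrier R" "g \<in> carrier R" "h \<in> carrier R" "s \<in> S"
      "x = qt f s" "y = qt g s" "z = qt h s" by (rule common_denominator3)
    then show "x \<otimes>\<^bsub>Q\<^esub> y \<otimes>\<^bsub>Q\<^esub> z = x \<otimes>\<^bsub>Q\<^esub> (y \<otimes>\<^bsub>Q\<^esub> z)"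
      using S_carrier by (simp add: Q_mult mult_S m_assoc)
  next
    fix x assume "x \<in> carrier Q"
    then obtain f s where *: "f \<in> carrier R" "s \<in> S" "x = qt f s" by (auto simp: Q_carrier)
    show "\<one>\<^bsub>Q\<^esub> \<otimes>\<^bsub>Q\<^esub> x = x" "x \<otimes>\<^bsub>Q\<^esub> \<one>\<^bsub>Q\<^esub> = x"
      using * S_carrier one_S by (simp_all add: Q_one Q_mult)
  qed
next
  fix x y z assume "x \<in> carrier Q" "y \<in> carrier Q" "z \<in> carrier Q"
  then obtain f g h s where *: "f \<in> carrier R" "g \<in> carrier R" "h \<in> carrier R" "s \<in> S"
    "x = qt f s" "y = qt g s" "z = qt h s" by (rule common_denominator3)
  show "(x \<oplus>\<^bsub>Q\<^esub> y) \<otimes>\<^bsub>Q\<^esub> z = x \<otimes>\<^bsub>Q\<^esub> z \<oplus>\<^bsub>Q\<^esub> y \<otimes>\<^bsub>Q\<^esub> z"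
    using * by (simp add: Q_mult Q_add mult_S l_distr)
  show "z \<otimes>\<^bsub>Q\<^esub> (x \<oplus>\<^bsub>Q\<^esub> y) = z \<otimes>\<^bsub>Q\<^esub> x \<oplus>\<^bsub>Q\<^esub> z \<otimes>\<^bsub>Q\<^esub> y"
    using * by (simp add: Q_mult Q_add mult_S r_distr)
qed

lemma qt_finsum:
  assumes "finite I" "f \<in> I \<rightarrow> carrier R" "s \<in> S"
  shows "(\<Oplus>\<^bsub>Q\<^esub>i\<in>I. qt (f i) s) = qt (\<Oplus>i\<in>I. f i) s"
proof -
  interpret Q: Ring.ring Q by (rule ring_Q)
  show ?thesis using assms
  proof (induction I rule: finite_induct)
    case empty
    then show ?case by (simp add: Q_zero_eq)
  next
    case (insert i I)
    then have "(\<Oplus>\<^bsub>Q\<^esub>i\<in>insert i I. qt (f i) s) = qt (f i) s \<oplus>\<^bsub>Q\<^esub> (\<Oplus>\<^bsub>Q\<^esub>i\<in>I. qt (f i) s)"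
      by (intro Q.finsum_insert) auto
    then show ?case using insert by (simp add: Q_add finsum_closed Pi_def)
  qed
qed

end

text \<open>A spanning set of least size is a basis: a nontrivial relation would allow one of its
  members to be dropped.\<close>

lemma (in scalar_algebra) alg_basis_exists:
  assumes G: "finite G" "G \<subseteq> carrier A" "\<And>x. x \<in> carrier A \<Longrightarrow> \<exists>c. x = (\<Oplus>b\<in>G. \<sigma> (c b) \<otimes> b)"
  shows "\<exists>B. is_alg_basis A \<sigma> B"
proof -
  define P where "P n \<longleftrightarrow> (\<exists>G. finite G \<and> card G = n \<and> G \<subseteq> carrier A \<and>
    (\<forall>x\<in>carrier A. \<exists>c. x = (\<Oplus>b\<in>G. \<sigma> (c b) \<otimes> b)))" for n
  have "P (card G)" using G by (auto simp: P_def)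
  then have "P (LEAST n. P n)" by (rule LeastI)
  then obtain B where B: "finite B" "card B = (LEAST n. P n)" "B \<subseteq> carrier A"
    and span: "\<And>x. x \<in> carrier A \<Longrightarrow> \<exists>c. x = (\<Oplus>b\<in>B. \<sigma> (c b) \<otimes> b)"
    by (auto simp: P_def)
  have cl: "(\<lambda>b. \<sigma> (c b) \<otimes> b) \<in> I \<rightarrow> carrier A" if "I \<subseteq> B" for c I using that B(3) by auto
  have lin: "(\<Oplus>b\<in>B. \<sigma> (c b + r * d b) \<otimes> b)
      = (\<Oplus>b\<in>B. \<sigma> (c b) \<otimes> b) \<oplus> \<sigma> r \<otimes> (\<Oplus>b\<in>B. \<sigma> (d b) \<otimes> b)" for c d r
  proof -
    have "\<sigma> r \<otimes> (\<Oplus>b\<in>B. \<sigma> (d b) \<otimes> b) = (\<Oplus>b\<in>B. \<sigma> r \<otimes> (\<sigma> (d b) \<otimes> b))"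
      using B cl by (intro finsum_rdistr) auto
    moreover have "(\<Oplus>b\<in>B. \<sigma> (c b + r * d b) \<otimes> b) = (\<Oplus>b\<in>B. \<sigma> (c b) \<otimes> b \<oplus> \<sigma> r \<otimes> (\<sigma> (d b) \<otimes> b))"
      using B(3) by (intro finsum_cong') (auto simp: scalar_add scalar_mult l_distr m_assoc subset_iff)
    moreover have "\<dots> = (\<Oplus>b\<in>B. \<sigma> (c b) \<otimes> b) \<oplus> (\<Oplus>b\<in>B. \<sigma> r \<otimes> (\<sigma> (d b) \<otimes> b))"
      using B(3) by (intro finsum_addf) auto
    ultimately show ?thesis by simp
  qed
  have indep: "d b0 = 0" if d: "(\<Oplus>b\<in>B. \<sigma> (d b) \<otimes> b) = \<zero>" and b0: "b0 \<in> B" for d b0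
  proof (rule ccontr)
    assume d0: "d b0 \<noteq> 0"
    have "\<exists>c. x = (\<Oplus>b\<in>B - {b0}. \<sigma> (c b) \<otimes> b)" if x: "x \<in> carrier A" for x
    proof -
      obtain c where c: "x = (\<Oplus>b\<in>B. \<sigma> (c b) \<otimes> b)" using span[OF x] by blast
      \<comment> \<open>Adding \<open>r\<close> times the relation \<open>d\<close> makes the
        coefficient of \<open>b0\<close> zero.\<close>
      define r where "r = - c b0 / d b0"
      let ?e = "\<lambda>b. c b + r * d b"
      have "x = (\<Oplus>b\<in>B. \<sigma> (?e b) \<otimes> b)" using lin[of c r d] c d x by simp
      also have "\<dots> = (\<Oplus>b\<in>insert b0 (B - {b0}). \<sigma> (?e b) \<otimes> b)" using b0 by (simp add: insert_absorb)
      also have "\<dots> = \<sigma> (?e b0) \<otimes> b0 \<oplus> (\<Oplus>b\<in>B - {b0}. \<sigma> (?e b) \<otimes> b)"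
        using B b0 cl by (intro finsum_insert) auto
      also have "\<sigma> (?e b0) \<otimes> b0 = \<zero>" using d0 b0 B(3) by (auto simp: r_def)
      finally have "x = (\<Oplus>b\<in>B - {b0}. \<sigma> (?e b) \<otimes> b)"
        using finsum_closed[OF cl[of "B - {b0}" ?e]] by simp
      then show ?thesis by (intro exI[of _ ?e])
    qed
    then have "P (card (B - {b0}))" using B by (auto simp: P_def)
    then have "card B \<le> card (B - {b0})" unfolding B(2) by (rule Least_le)
    then show False using card_Diff1_less[OF B(1) b0] by simp
  qed
  have "\<exists>!c. (\<forall>b. b \<notin> B \<longrightarrow> c b = 0) \<and> x = (\<Oplus>b\<in>B. \<sigma> (c b) \<otimes> b)" if x: "x \<in> carrier A" for x
  proof (rule ex_ex1I)
    obtain c where c: "x = (\<Oplus>b\<in>B. \<sigma> (c b) \<otimes> b)" using span[OF x] by blast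
    also have "\<dots> = (\<Oplus>b\<in>B. \<sigma> (if b \<in> B then c b else 0) \<otimes> b)"
      using B(3) by (intro finsum_cong') auto
    finally show "\<exists>c. (\<forall>b. b \<notin> B \<longrightarrow> c b = 0) \<and> x = (\<Oplus>b\<in>B. \<sigma> (c b) \<otimes> b)"
      by (intro exI[of _ "\<lambda>b. if b \<in> B then c b else 0"]) auto
  next
    fix c c' assume c: "(\<forall>b. b \<notin> B \<longrightarrow> c b = 0) \<and> x = (\<Oplus>b\<in>B. \<sigma> (c b) \<otimes> b)"
      and c': "(\<forall>b. b \<notin> B \<longrightarrow> c' b = 0) \<and> x = (\<Oplus>b\<in>B. \<sigma> (c' b) \<otimes> b)"
    have "(\<Oplus>b\<in>B. \<sigma> (c b + (- 1) * c' b) \<otimes> b) = x \<oplus> \<sigma> (- 1) \<otimes> x"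
      using lin[of c "- 1" c'] c c' by metis
    also have "\<dots> = (\<sigma> 1 \<oplus> \<sigma> (- 1)) \<otimes> x" using x by (simp add: l_distr)
    also have "\<dots> = \<zero>" unfolding scalar_add[symmetric] using x by simp
    finally have zero: "(\<Oplus>b\<in>B. \<sigma> (c b + (- 1) * c' b) \<otimes> b) = \<zero>" .
    have "c b + (- 1) * c' b = 0" if "b \<in> B" for b by (rule indep[OF zero that])
    then have "c b = c' b" for b using c c' by (cases "b \<in> B") simp_all
    then show "c = c'" by (rule ext)
  qed
  then show ?thesis using B(1,3) unfolding is_alg_basis_def by (intro exI[of _ B] conjI ballI)
qed

section \<open>Skew polynomials\<close>

locale derivation =
  fixes \<delta> :: "'d::division_ring \<Rightarrow> 'd"
  assumes is_derivation: "is_derivation \<delta>"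
begin

lemma deriv_add: "\<delta> (a + b) = \<delta> a + \<delta> b"
  and deriv_mult: "\<delta> (a * b) = \<delta> a * b + a * \<delta> b"
  using is_derivation by (auto simp: is_derivation_def)

lemma deriv_0 [simp]: "\<delta> 0 = 0"
  using deriv_add[of 0 0] by simp

lemma deriv_1 [simp]: "\<delta> 1 = 0"
  using deriv_mult[of 1 1] by simp

lemma deriv_minus: "\<delta> (- a) = - \<delta> a"
  using deriv_add[of a "- a"] by (simp add: eq_neg_iff_add_eq_0 add.commute)

lemma deriv_diff: "\<delta> (a - b) = \<delta> a - \<delta> b"
  using deriv_add[of a "- b"] by (simp add: deriv_minus)

lemma deriv_sum: "\<delta> (sum f I) = (\<Sum>i\<in>I. \<delta> (f i))"
  by (induction I rule: infinite_finite_induct) (auto simp: deriv_add)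

definition lscale :: "'d \<Rightarrow> 'd poly \<Rightarrow> 'd poly" where
  "lscale a = map_poly (\<lambda>b. a * b)"

abbreviation tm :: "'d poly \<Rightarrow> 'd poly" where
  "tm \<equiv> t_mult \<delta>"

abbreviation skm :: "'d poly \<Rightarrow> 'd poly \<Rightarrow> 'd poly" (infixl "\<star>" 70) where
  "f \<star> g \<equiv> skew_mult \<delta> f g"

lemma coeff_lscale: "coeff (lscale a f) n = a * coeff f n"
  by (simp add: lscale_def coeff_map_poly)

lemma coeff_tm: "coeff (tm f) n = (case n of 0 \<Rightarrow> 0 | Suc k \<Rightarrow> coeff f k) + \<delta> (coeff f n)"
  by (simp add: t_mult_def coeff_map_poly coeff_pCons)

lemma lscale_add: "lscale a (f + g) = lscale a f + lscale a g"
  and lscale_add_left: "lscale (a + b) f = lscale a f + lscale b f"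
  and lscale_lscale: "lscale a (lscale b f) = lscale (a * b) f"
  and lscale_1: "lscale 1 f = f"
  and lscale_0: "lscale 0 f = 0"
  and lscale_0_right: "lscale a 0 = 0"
  by (rule poly_eqI; simp add: coeff_lscale algebra_simps)+

lemma lscale_const: "lscale a [:b:] = [:a * b:]"
  by (simp add: lscale_def Polynomial.map_poly_pCons)

lemma lscale_sum: "lscale a (sum f I) = (\<Sum>i\<in>I. lscale a (f i))"
  by (induction I rule: infinite_finite_induct) (auto simp: lscale_add lscale_0_right)

lemma tm_add: "tm (f + g) = tm f + tm g"
  by (rule poly_eqI) (simp add: coeff_tm deriv_add split: nat.split)

lemma tm_0 [simp]: "tm 0 = 0"
  by (simp add: t_mult_def)

lemma tm_lscale: "tm (lscale a f) = lscale a (tm f) + lscale (\<delta> a) f"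
  by (rule poly_eqI) (simp add: coeff_tm coeff_lscale deriv_mult algebra_simps split: nat.split)

lemma tm_funpow_add: "(tm ^^ i) (f + g) = (tm ^^ i) f + (tm ^^ i) g"
  by (induction i) (auto simp: tm_add)

lemma degree_lscale_le: "degree (lscale a f) \<le> degree f"
  by (simp add: lscale_def map_poly_degree_leq)

lemma skm_sum: "f \<star> h = (\<Sum>i\<le>degree f. lscale (coeff f i) ((tm ^^ i) h))"
  by (simp add: skew_mult_def lscale_def)

lemma skm_bound:
  assumes "degree f \<le> N"
  shows "f \<star> h = (\<Sum>i\<le>N. lscale (coeff f i) ((tm ^^ i) h))"
  unfolding skm_sum using assms
  by (intro sum.mono_neutral_left) (auto simp: coeff_eq_0 lscale_0)

lemma skm_0 [simp]: "0 \<star> h = 0"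
  by (simp add: skm_sum lscale_0)

lemma skm_pCons: "pCons a p \<star> h = lscale a h + p \<star> tm h"
proof -
  have "pCons a p \<star> h = (\<Sum>i\<le>Suc (degree p). lscale (coeff (pCons a p) i) ((tm ^^ i) h))"
    by (rule skm_bound) (rule degree_pCons_le)
  also have "\<dots> = lscale a h + (\<Sum>i\<le>degree p. lscale (coeff p i) ((tm ^^ i) (tm h)))"
    by (subst sum.atMost_Suc_shift) (simp add: funpow_swap1)
  finally show ?thesis
    by (simp add: skm_sum)
qed

lemma skm_add_right: "f \<star> (g + h) = f \<star> g + f \<star> h"
  by (simp add: skm_sum tm_funpow_add lscale_add sum.distrib)

lemma skm_0_right [simp]: "f \<star> 0 = 0"
  using skm_add_right[of f 0 0] by simp

lemma skm_add_left: "(f + g) \<star> h = f \<star> h + g \<star> h"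
proof -
  let ?N = "max (degree f) (degree g)"
  have "(f + g) \<star> h = (\<Sum>i\<le>?N. lscale (coeff (f + g) i) ((tm ^^ i) h))"
    by (rule skm_bound) (rule degree_add_le_max)
  then show ?thesis
    by (simp add: skm_bound[of f ?N] skm_bound[of g ?N] lscale_add_left sum.distrib)
qed

lemma skm_lscale: "lscale a f \<star> h = lscale a (f \<star> h)"
  by (subst skm_bound[where N = "degree f"])
     (auto simp: skm_sum lscale_sum lscale_lscale coeff_lscale degree_lscale_le)

text \<open>This is t f = f t + \<delta>(f), with \<delta> acting on coefficients, multiplied by
  \<open>h\<close> on the right. It yields (t f) h = t (f h), from which associativity follows by
  induction.\<close>

lemma tm_skm_shift: "tm (f \<star> h) = f \<star> tm h + map_poly \<delta> f \<star> h"
  by (induction f arbitrary: h)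
     (auto simp: skm_pCons tm_add tm_lscale Polynomial.map_poly_pCons skm_0 algebra_simps)

lemma skm_tm: "tm f \<star> h = tm (f \<star> h)"
  by (simp add: tm_skm_shift) (simp add: t_mult_def skm_add_left skm_pCons lscale_0)

lemma skm_assoc: "f \<star> g \<star> h = f \<star> (g \<star> h)"
  by (induction f arbitrary: g)
     (auto simp: skm_pCons skm_add_left skm_lscale skm_tm)

lemma skm_const: "[:a:] \<star> h = lscale a h"
  by (simp add: skm_pCons)

lemma skm_1_left [simp]: "[:1:] \<star> h = h"
  by (simp add: skm_const lscale_1)

lemma tm_eq: "[:0, 1:] \<star> h = tm h"
  by (simp add: skm_pCons lscale_0 lscale_1)

lemma tm_funpow_1: "(tm ^^ i) [:1:] = Polynomial.monom 1 i"
proof (induction i)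
  case (Suc i)
  have "tm (Polynomial.monom 1 i) = Polynomial.monom 1 (Suc i)"
    by (rule poly_eqI) (auto simp: coeff_tm split: nat.split)
  with Suc show ?case by simp
qed (simp add: monom_0)

lemma skm_1_right [simp]: "f \<star> [:1:] = f"
proof -
  have "f \<star> [:1:] = (\<Sum>i\<le>degree f. Polynomial.monom (coeff f i) i)"
    unfolding skm_sum tm_funpow_1
    by (intro sum.cong refl poly_eqI) (simp add: coeff_lscale)
  then show ?thesis by (simp add: poly_as_sum_of_monoms)
qed

lemma skm_minus_left: "(- f) \<star> h = - (f \<star> h)"
  using skm_add_left[of f "- f" h] by (simp add: eq_neg_iff_add_eq_0 add.commute)

lemma skm_minus_right: "f \<star> (- h) = - (f \<star> h)"
  using skm_add_right[of f h "- h"] by (simp add: eq_neg_iff_add_eq_0 add.commute)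

lemma skm_diff_left: "(f - g) \<star> h = f \<star> h - g \<star> h"
  using skm_add_left[of f "- g" h] by (simp add: skm_minus_left)

lemma skm_diff_right: "f \<star> (g - h) = f \<star> g - f \<star> h"
  using skm_add_right[of f g "- h"] by (simp add: skm_minus_right)

lemma skm_sum_left: "sum f I \<star> h = (\<Sum>i\<in>I. f i \<star> h)"
  by (induction I rule: infinite_finite_induct) (auto simp: skm_add_left)

lemma skm_sum_right: "h \<star> sum f I = (\<Sum>i\<in>I. h \<star> f i)"
  by (induction I rule: infinite_finite_induct) (auto simp: skm_add_right)

lemma degree_tm:
  assumes "h \<noteq> 0"
  shows "degree (tm h) = Suc (degree h)" "coeff (tm h) (Suc (degree h)) = lead_coeff h"
proof -
  show *: "coeff (tm h) (Suc (degree h)) = lead_coeff h"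
    by (simp add: coeff_tm coeff_eq_0)
  have "degree (tm h) \<le> Suc (degree h)"
    by (rule degree_le) (auto simp: coeff_tm coeff_eq_0 split: nat.split)
  moreover have "Suc (degree h) \<le> degree (tm h)"
    by (rule le_degree) (use * assms in auto)
  ultimately show "degree (tm h) = Suc (degree h)" by simp
qed

lemma degree_skm_le:
  "degree (f \<star> h) \<le> degree f + degree h" (is ?A)
  and coeff_skm: "coeff (f \<star> h) (degree f + degree h) = lead_coeff f * lead_coeff h" (is ?B)
proof -
  have "?A \<and> ?B"
  proof (induction f arbitrary: h)
    case (pCons a p)
    show ?case
    proof (cases "h = 0")
      case False
      have 1: "degree (lscale a h) \<le> degree h"
        by (rule degree_lscale_le)
      show ?thesis
      proof (cases "p = 0")
        case True
        then show ?thesis using 1 by (simp add: skm_pCons coeff_lscale)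
      next
        case p: False
        have 2: "degree (p \<star> tm h) \<le> degree p + Suc (degree h)"
          "coeff (p \<star> tm h) (degree p + Suc (degree h)) = lead_coeff p * lead_coeff h"
          using pCons.IH[of "tm h"] False by (auto simp: degree_tm)
        have 3: "degree (pCons a p \<star> h) \<le> degree (pCons a p) + degree h"
          unfolding skm_pCons using 1 2 p by (intro degree_add_le) auto
        moreover have "coeff (lscale a h) (degree p + Suc (degree h)) = 0"
          using 1 by (intro coeff_eq_0) simp
        ultimately show ?thesis using 2 p by (simp add: skm_pCons)
      qed
    qed simp
  qed (simp_all)
  then show ?A ?B by auto
qed

lemma degree_skm:
  assumes "f \<noteq> 0" "h \<noteq> 0"
  shows "degree (f \<star> h) = degree f + degree h"
proof (rule antisym[OF degree_skm_le le_degree])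
  show "coeff (f \<star> h) (degree f + degree h) \<noteq> 0"
    using assms by (simp add: coeff_skm)
qed

lemma lead_coeff_skm: "lead_coeff (f \<star> h) = lead_coeff f * lead_coeff h"
  by (cases "f = 0 \<or> h = 0") (auto simp: degree_skm coeff_skm)

lemma skm_eq_0_iff: "f \<star> h = 0 \<longleftrightarrow> f = 0 \<or> h = 0"
proof
  assume "f \<star> h = 0"
  then have "lead_coeff f * lead_coeff h = 0"
    using lead_coeff_skm[of f h] by simp
  then show "f = 0 \<or> h = 0" by auto
qed auto

abbreviation R where "R \<equiv> skew_poly_ring \<delta>"

lemma R_simps [simp]:
  "carrier R = UNIV" "f \<otimes>\<^bsub>R\<^esub> g = f \<star> g" "\<one>\<^bsub>R\<^esub> = [:1:]" "\<zero>\<^bsub>R\<^esub> = 0" "f \<oplus>\<^bsub>R\<^esub> g = f + g"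
  by (simp_all add: skew_poly_ring_def)

lemma ring_skew_poly_ring: "Ring.ring R"
proof (rule ringI)
  show "abelian_group R"
    by (rule abelian_groupI) (auto simp: add.assoc add.commute intro: exI[of _ "- _"] right_minus)
  show "Group.monoid R"
    by (rule monoidI) (auto simp: skm_assoc)
qed (auto simp: skm_add_left skm_add_right)

end

section \<open>The Frobenius rule for skew polynomials\<close>

lemma prime_dvd_binomial:
  assumes "prime p" "0 < i" "i < p"
  shows "p dvd (p choose i)"
proof -
  have "p dvd i * (p choose i)"
    by (simp only: times_binomial_minus1_eq[OF assms(2)] dvd_triv_left)
  moreover have "\<not> p dvd i" using assms by (auto dest: dvd_imp_le)
  ultimately show ?thesis using assms by (simp add: prime_dvd_mult_iff)
qed

context derivation
begin

text \<open>\<open>T\<close> and \<open>D\<close> stay abstract so that the formula applies to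
  \<open>tm ^^ (p ^ k)\<close> and \<open>\<delta> ^^ (p ^ k)\<close>. In characteristic p the
  middle binomial coefficients vanish, and the p-th powers of \<open>T\<close> and \<open>D\<close>
  satisfy the same commutation rule again; this drives the induction on k.\<close>

lemma skew_leibniz:
  fixes T :: "'d poly \<Rightarrow> 'd poly" and D :: "'d \<Rightarrow> 'd"
  assumes add: "\<And>f h. T (f + h) = T f + T h"
    and comm: "\<And>z h. T (lscale z h) = lscale z (T h) + lscale (D z) h"
  shows "(T ^^ n) (lscale z h) =
    (\<Sum>i\<le>n. lscale (of_nat (n choose i)) (lscale ((D ^^ i) z) ((T ^^ (n - i)) h)))"
proof (induction n)
  case (Suc n)
  let ?a = "\<lambda>i k. lscale ((D ^^ i) z) ((T ^^ k) h)"
  have T0: "T 0 = 0" using add[of 0 0] by simp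
  have T_nat: "T (lscale (of_nat c) f) = lscale (of_nat c) (T f)" for c f
    by (induction c) (auto simp: lscale_0 T0 lscale_add_left lscale_1 add)
  have T_sum: "T (sum f I) = (\<Sum>i\<in>I. T (f i))" for f and I :: "nat set"
    by (induction I rule: infinite_finite_induct) (auto simp: T0 add)
  have step: "T (lscale (of_nat c) (?a i k)) = lscale (of_nat c) (?a i (Suc k)) + lscale (of_nat c) (?a (Suc i) k)"
    for c i k
    by (subst T_nat) (simp add: comm lscale_add)
  have "(T ^^ Suc n) (lscale z h) = (\<Sum>i\<le>n. lscale (of_nat (n choose i)) (?a i (Suc n - i)))
      + (\<Sum>i\<le>n. lscale (of_nat (n choose i)) (?a (Suc i) (n - i)))"
    by (simp add: Suc T_sum step sum.distrib Suc_diff_le)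
  also have "(\<Sum>i\<le>n. lscale (of_nat (n choose i)) (?a i (Suc n - i)))
      = ?a 0 (Suc n) + (\<Sum>i\<le>n. lscale (of_nat (n choose Suc i)) (?a (Suc i) (n - i)))"
  proof -
    have "(\<Sum>i\<le>n. lscale (of_nat (n choose i)) (?a i (Suc n - i)))
        = (\<Sum>i\<le>Suc n. lscale (of_nat (n choose i)) (?a i (Suc n - i)))"
      by (simp add: lscale_0 binomial_eq_0)
    then show ?thesis
      by (subst (asm) sum.atMost_Suc_shift) (simp add: lscale_1)
  qed
  also have "\<dots> + (\<Sum>i\<le>n. lscale (of_nat (n choose i)) (?a (Suc i) (n - i)))
      = (\<Sum>i\<le>Suc n. lscale (of_nat (Suc n choose i)) (?a i (Suc n - i)))"
    by (subst sum.atMost_Suc_shift)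
       (simp add: lscale_1 lscale_add_left sum.distrib algebra_simps)
  finally show ?case .
qed (simp add: lscale_1)

lemma lscale_of_nat_eq_0:
  assumes "of_nat c = (0::'d)"
  shows "lscale (of_nat c) f = 0"
  by (simp add: assms lscale_0)

lemma skew_frobenius:
  fixes T :: "'d poly \<Rightarrow> 'd poly" and D :: "'d \<Rightarrow> 'd"
  assumes add: "\<And>f h. T (f + h) = T f + T h"
    and comm: "\<And>z h. T (lscale z h) = lscale z (T h) + lscale (D z) h"
    and p: "prime p" "of_nat p = (0::'d)"
  shows "(T ^^ p) (lscale z h) = lscale z ((T ^^ p) h) + lscale ((D ^^ p) z) h"
proof -
  have p2: "p \<ge> 2" using p prime_ge_2_nat by auto
  have *: "lscale (of_nat (p choose i)) (lscale ((D ^^ i) z) ((T ^^ (p - i)) h)) = 0"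
    if "i \<in> {..p} - {0, p}" for i
  proof -
    have "p dvd (p choose i)"
      using that by (intro prime_dvd_binomial p) auto
    then obtain c where "p choose i = p * c" by (auto simp: dvd_def)
    then have "of_nat (p choose i) = (0::'d)" using p by simp
    then show ?thesis by (rule lscale_of_nat_eq_0)
  qed
  have "(T ^^ p) (lscale z h) = (\<Sum>i\<le>p. lscale (of_nat (p choose i)) (lscale ((D ^^ i) z) ((T ^^ (p - i)) h)))"
    by (rule skew_leibniz[OF add comm])
  also have "\<dots> = (\<Sum>i\<in>{0, p}. lscale (of_nat (p choose i)) (lscale ((D ^^ i) z) ((T ^^ (p - i)) h)))"
    by (rule sum.mono_neutral_right) (use * in auto)
  also have "\<dots> = lscale z ((T ^^ p) h) + lscale ((D ^^ p) z) h"
    using p2 by (simp add: lscale_1)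
  finally show ?thesis .
qed

lemma tm_power_prime_power:
  assumes p: "prime p" "of_nat p = (0::'d)"
  shows "(tm ^^ (p ^ k)) (lscale z h) = lscale z ((tm ^^ (p ^ k)) h) + lscale ((\<delta> ^^ (p ^ k)) z) h"
proof (induction k arbitrary: z h)
  case 0
  then show ?case by (simp add: tm_lscale)
next
  case (Suc k)
  have "((tm ^^ (p ^ k)) ^^ p) (lscale z h)
      = lscale z (((tm ^^ (p ^ k)) ^^ p) h) + lscale (((\<delta> ^^ (p ^ k)) ^^ p) z) h"
    by (rule skew_frobenius[OF tm_funpow_add Suc p])
  then show ?case by (simp add: funpow_mult mult.commute)
qed

lemma skm_t: "p \<star> [:0, 1:] = pCons 0 p"
proof -
  have "[:0, 1:] = tm [:1:]" using tm_eq[of "[:1:]"] by simp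
  moreover have "p \<star> tm [:1:] = tm p - map_poly \<delta> p"
    using tm_skm_shift[of p "[:1:]"] by simp
  ultimately show ?thesis by (simp add: t_mult_def)
qed

lemma pCons_eq_skm: "pCons a p = [:a:] + p \<star> [:0, 1:]"
  by (simp add: skm_t)

lemma central_if_commutes:
  assumes c: "\<And>a. z \<star> [:a:] = [:a:] \<star> z" and t: "z \<star> [:0, 1:] = [:0, 1:] \<star> z"
  shows "z \<star> f = f \<star> z"
proof (induction f)
  case (pCons a f)
  have "z \<star> (f \<star> [:0, 1:]) = f \<star> [:0, 1:] \<star> z"
    by (metis pCons.IH t skm_assoc)
  then show ?case by (simp add: pCons_eq_skm[of a f] skm_add_left skm_add_right c del: pCons_eq_skm)
qed simp

lemma coeff_tm_funpow_const: "coeff ((tm ^^ i) [:c:]) 0 = (\<delta> ^^ i) c"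
  by (induction i) (auto simp: coeff_tm)

text \<open>\<delta> preserves the center: when z a = a z is differentiated, the terms with \<delta>
  a cancel.\<close>

lemma funpow_deriv_commute:
  assumes "\<forall>a. z * a = a * z"
  shows "\<forall>a. (\<delta> ^^ i) z * a = a * (\<delta> ^^ i) z"
proof (induction i)
  case (Suc i)
  let ?y = "(\<delta> ^^ i) z"
  show ?case
  proof
    fix a
    have "\<delta> (?y * a) = \<delta> (a * ?y)" using Suc by simp
    then have "\<delta> ?y * a + ?y * \<delta> a = \<delta> a * ?y + a * \<delta> ?y" by (simp add: deriv_mult)
    moreover have "?y * \<delta> a = \<delta> a * ?y" using Suc by simp
    ultimately show "(\<delta> ^^ Suc i) z * a = a * (\<delta> ^^ Suc i) z" by (simp add: add.commute)
  qed
qed (use assms in simp)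

end

section \<open>The central element x\<close>

locale algebraic_derivation = derivation \<delta> for \<delta> :: "'d::division_ring \<Rightarrow> 'd" +
  fixes j :: "'f::field \<Rightarrow> 'd" and Z :: "'d set" and p :: nat and g :: "'f poly" and d0 :: 'd
  assumes j_hom: "Ring_Hom.ring_hom j"
    and Z_def: "Z = {z. \<forall>a. z * a = a * z}"
    and range_j: "range j = Const \<delta> \<inter> Z"
    and p: "prime p" "of_nat p = (0::'d)"
    and g_additive: "\<And>n. coeff g n \<noteq> 0 \<Longrightarrow> \<exists>k. n = p ^ k"
    and min_poly: "is_min_poly_on j \<delta> Z g"
    and inner: "poly_op j \<delta> g z = d0 * z - z * d0"
    and d0_const: "\<delta> d0 = 0"
begin

sublocale j: Ring_Hom.ring_hom j by (rule j_hom)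

lemma j_central: "j a * z = z * j a"
proof -
  have "j a \<in> Z" using range_j by blast
  then show ?thesis by (simp add: Z_def)
qed

lemma deriv_j [simp]: "\<delta> (j a) = 0"
proof -
  have "j a \<in> Const \<delta>" using range_j by blast
  then show ?thesis by (simp add: Const_def)
qed

lemma j_eq_0_iff [simp]: "j a = 0 \<longleftrightarrow> a = 0"
proof
  assume "j a = 0"
  show "a = 0"
  proof (rule ccontr)
    assume "a \<noteq> 0"
    then have "j (inverse a * a) = 1" by simp
    with \<open>j a = 0\<close> show False by (simp only: j.hom_mult) simp
  qed
qed simp

lemma in_range_j: "a \<in> Z \<Longrightarrow> \<delta> a = 0 \<Longrightarrow> a \<in> range j"
  using range_j by (auto simp: Const_def)

definition m :: nat where "m = degree g"

definition x :: "'d poly" where "x = map_poly j g - [:d0:]"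

lemma g_monic: "lead_coeff g = 1" and g_annihilates: "z \<in> Z \<Longrightarrow> poly_op j \<delta> g z = 0"
  and g_minimal: "h \<noteq> 0 \<Longrightarrow> (\<And>z. z \<in> Z \<Longrightarrow> poly_op j \<delta> h z = 0) \<Longrightarrow> m \<le> degree h"
  using min_poly by (auto simp: is_min_poly_on_def m_def)

lemma m_pos: "m > 0"
proof -
  have "\<exists>k. m = p ^ k" unfolding m_def by (rule g_additive) (use g_monic in simp)
  then show ?thesis using p prime_gt_0_nat by auto
qed

lemma degree_x: "degree x = m" and lead_coeff_x: "coeff x m = 1"
proof -
  have c: "coeff x m = 1"
    using m_pos g_monic by (auto simp: x_def coeff_map_poly m_def coeff_pCons split: nat.split)
  moreover have "degree x \<le> m"
    unfolding x_def m_def by (intro degree_diff_le map_poly_degree_leq) auto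
  ultimately show "degree x = m" "coeff x m = 1"
    using le_degree[of x m] by auto
qed

lemma x_nz: "x \<noteq> 0"
  using lead_coeff_x by auto

text \<open>Only exponents i = p^k occur in \<open>g\<close>, and for these t^i z = z t^i +
  \<delta>^i(z). Hence g(t) z = z g(t) + g(\<delta>)(z), and subtracting \<open>d0\<close> from g(t)
  absorbs the inner derivation g(\<delta>).\<close>

lemma x_commutes_const: "x \<star> [:z:] = [:z:] \<star> x"
proof -
  have z: "[:z:] = lscale z [:1:]" by (simp add: lscale_const)
  have "map_poly j g \<star> [:z:] = (\<Sum>i\<le>m. lscale (j (coeff g i)) ((tm ^^ i) [:z:]))"
    by (subst skm_bound[where N = m]) (auto simp: m_def map_poly_degree_leq coeff_map_poly)
  also have "\<dots> = (\<Sum>i\<le>m. lscale z (Polynomial.monom (j (coeff g i)) i) + [:j (coeff g i) * (\<delta> ^^ i) z:])"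
  proof (rule sum.cong)
    fix i
    show "lscale (j (coeff g i)) ((tm ^^ i) [:z:])
        = lscale z (Polynomial.monom (j (coeff g i)) i) + [:j (coeff g i) * (\<delta> ^^ i) z:]"
    proof (cases "coeff g i = 0")
      case False
      then obtain k where k: "i = p ^ k" using g_additive by blast
      have "(tm ^^ i) [:z:] = lscale z (Polynomial.monom 1 i) + [:(\<delta> ^^ i) z:]"
        unfolding z k tm_power_prime_power[OF p] tm_funpow_1
        by (simp add: lscale_const)
      moreover have "lscale (j (coeff g i)) (lscale z (Polynomial.monom 1 i))
          = lscale z (Polynomial.monom (j (coeff g i)) i)"
        by (rule poly_eqI) (simp add: coeff_lscale j_central)
      ultimately show ?thesis by (simp add: lscale_add) (simp add: lscale_const)
    qed (simp add: lscale_0 lscale_0_right)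
  qed simp
  also have "\<dots> = lscale z (map_poly j g) + [:poly_op j \<delta> g z:]"
  proof -
    have "(\<Sum>i\<le>m. Polynomial.monom (j (coeff g i)) i) = map_poly j g"
      by (rule poly_eqI) (auto simp: coeff_sum coeff_map_poly m_def coeff_eq_0)
    moreover have "(\<Sum>i\<le>m. [:j (coeff g i) * (\<delta> ^^ i) z:]) = [:poly_op j \<delta> g z:]"
      by (rule poly_eqI) (auto simp: coeff_sum poly_op_def m_def coeff_pCons split: nat.split)
    ultimately show ?thesis by (simp add: sum.distrib lscale_sum[symmetric])
  qed
  finally have "x \<star> [:z:] = lscale z (map_poly j g) + [:poly_op j \<delta> g z:] - [:d0 * z:]"
    by (simp add: x_def skm_diff_left skm_const) (simp add: lscale_const)
  also have "\<dots> = [:z:] \<star> x"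
    by (simp add: x_def skm_diff_right skm_const inner) (simp add: lscale_const)
  finally show ?thesis .
qed

lemma x_central: "x \<star> f = f \<star> x"
proof (rule central_if_commutes)
  \<comment> \<open>All coefficients of x are constants of \<delta>, so t commutes with x.\<close>
  have "map_poly \<delta> x = 0"
    by (rule poly_eqI)
       (auto simp: x_def coeff_map_poly deriv_diff d0_const coeff_pCons split: nat.split)
  then have "tm x = pCons 0 x" by (simp add: t_mult_def)
  then show "x \<star> [:0, 1:] = [:0, 1:] \<star> x"
    by (simp add: tm_eq skm_t)
qed (rule x_commutes_const)

section \<open>The polynomial ring F[x] inside R\<close>

definition \<epsilon> :: "'f poly \<Rightarrow> 'd poly" where "\<epsilon> = skew_eval j \<delta> x"

lemma eps_bound:
  assumes "degree h \<le> N"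
  shows "\<epsilon> h = (\<Sum>i\<le>N. lscale (j (coeff h i)) (x [^]\<^bsub>R\<^esub> i))"
  unfolding \<epsilon>_def skew_eval_def skm_const using assms
  by (intro sum.mono_neutral_left) (auto simp: coeff_eq_0 lscale_0)

lemma x_pow_Suc: "x [^]\<^bsub>R\<^esub> Suc i = x \<star> (x [^]\<^bsub>R\<^esub> i)"
proof -
  interpret Ring.ring R by (rule ring_skew_poly_ring)
  show ?thesis using nat_pow_Suc2[of x i] by simp
qed

lemma x_lscale: "x \<star> lscale a f = lscale a (x \<star> f)"
  by (metis skm_const skm_assoc x_central)

lemma eps_pCons: "\<epsilon> (pCons a h) = [:j a:] + x \<star> \<epsilon> h"
proof -
  have "\<epsilon> (pCons a h) = (\<Sum>i\<le>Suc (degree h). lscale (j (coeff (pCons a h) i)) (x [^]\<^bsub>R\<^esub> i))"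
    by (rule eps_bound) (rule degree_pCons_le)
  also have "\<dots> = [:j a:] + (\<Sum>i\<le>degree h. lscale (j (coeff h i)) (x \<star> (x [^]\<^bsub>R\<^esub> i)))"
    by (subst sum.atMost_Suc_shift, simp only: x_pow_Suc)
       (simp add: lscale_const)
  also have "\<dots> = [:j a:] + x \<star> \<epsilon> h"
    by (simp add: eps_bound[OF order_refl] skm_sum_right x_lscale)
  finally show ?thesis .
qed

lemma eps_0 [simp]: "\<epsilon> 0 = 0"
  by (simp add: eps_bound[where N = 0] lscale_0)

lemma eps_const: "\<epsilon> [:a:] = [:j a:]"
  by (simp add: eps_pCons)

lemma eps_1 [simp]: "\<epsilon> 1 = [:1:]"
  by (simp add: one_pCons eps_const)

lemma eps_add: "\<epsilon> (h + k) = \<epsilon> h + \<epsilon> k"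
proof (induction h k rule: poly_induct2)
  case (pCons a p b q)
  then show ?case by (simp add: eps_pCons j.hom_add skm_add_right)
qed simp

lemma eps_smult: "\<epsilon> (smult a h) = lscale (j a) (\<epsilon> h)"
  by (induction h) (auto simp: eps_pCons lscale_0_right lscale_add x_lscale j.hom_mult lscale_const)

lemma eps_mult: "\<epsilon> (h * k) = \<epsilon> h \<star> \<epsilon> k"
  by (induction h) (auto simp: eps_add eps_smult eps_pCons skm_add_left skm_const skm_assoc)

lemma eps_minus: "\<epsilon> (- h) = - \<epsilon> h"
  using eps_add[of h "- h"] by (simp add: eq_neg_iff_add_eq_0 add.commute)

lemma eps_diff: "\<epsilon> (h - k) = \<epsilon> h - \<epsilon> k"
  using eps_add[of h "- k"] by (simp add: eps_minus)

lemma eps_sum: "\<epsilon> (sum f I) = (\<Sum>i\<in>I. \<epsilon> (f i))"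
  by (induction I rule: infinite_finite_induct) (auto simp: eps_add)

lemma eps_central: "\<epsilon> h \<star> f = f \<star> \<epsilon> h"
proof (induction h)
  case (pCons a h)
  have "[:j a:] \<star> f = f \<star> [:j a:]"
  proof (rule central_if_commutes[symmetric, of "[:j a:]" for f, THEN sym])
    show "[:j a:] \<star> [:b:] = [:b:] \<star> [:j a:]" for b
      by (simp add: skm_const lscale_const j_central)
    show "[:j a:] \<star> [:0, 1:] = [:0, 1:] \<star> [:j a:]"
      by (simp add: skm_t tm_eq) (simp add: t_mult_def Polynomial.map_poly_pCons)
  qed
  moreover have "x \<star> \<epsilon> h \<star> f = f \<star> (x \<star> \<epsilon> h)"
    by (metis pCons.IH x_central skm_assoc)
  ultimately show ?case by (simp add: eps_pCons skm_add_left skm_add_right)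
qed simp

text \<open>Each factor x raises the degree by m > 0, so x is transcendental over F and \<epsilon>
  is injective.\<close>

lemma degree_eps: "h \<noteq> 0 \<Longrightarrow> degree (\<epsilon> h) = m * degree h \<and> \<epsilon> h \<noteq> 0"
proof (induction h)
  case (pCons a h)
  show ?case
  proof (cases "h = 0")
    case True
    then show ?thesis using pCons by (auto simp: eps_pCons)
  next
    case False
    then have *: "degree (x \<star> \<epsilon> h) = m * degree (pCons a h)" "degree (pCons a h) > 0"
      using pCons x_nz by (auto simp: degree_skm degree_x)
    then have "degree [:j a:] < degree (x \<star> \<epsilon> h)" using m_pos by simp
    then have "degree (\<epsilon> (pCons a h)) = m * degree (pCons a h)"
      using * by (simp only: eps_pCons degree_add_eq_right)
    moreover have "m * degree (pCons a h) > 0" using * m_pos by simp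
    ultimately show ?thesis by (metis degree_0 less_numeral_extra(3))
  qed
qed simp

lemma eps_eq_0_iff [simp]: "\<epsilon> h = 0 \<longleftrightarrow> h = 0"
  using degree_eps by auto

section \<open>Division with remainder by x\<close>

lemma division: "\<exists>q r. f = q \<star> x + r \<and> degree r < m \<and> degree q \<le> degree f"
proof (induction "degree f" arbitrary: f rule: less_induct)
  case less
  show ?case
  proof (cases "degree f < m")
    case True
    then show ?thesis by (intro exI[of _ 0] exI[of _ f]) simp
  next
    case False
    let ?q = "Polynomial.monom (lead_coeff f) (degree f - m)"
    have f0: "f \<noteq> 0" using False m_pos by auto
    have dq: "degree ?q = degree f - m" using f0 by (simp add: degree_monom_eq)
    let ?h = "f - ?q \<star> x"
    have q0: "?q \<noteq> 0" using f0 by simp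
    have dqx: "degree (?q \<star> x) = degree f"
      using False q0 x_nz by (simp add: degree_skm dq degree_x)
    have "lead_coeff (?q \<star> x) = lead_coeff f"
      using lead_coeff_skm[of ?q x] dq by (simp add: degree_x lead_coeff_x)
    then have c: "coeff ?h (degree f) = 0" using dqx by simp
    have le: "degree ?h \<le> degree f"
      using dqx by (intro degree_diff_le) auto
    have "degree ?h < degree f"
    proof (rule ccontr)
      assume "\<not> degree ?h < degree f"
      then have "degree ?h = degree f" using le by simp
      then have "?h = 0" using c by (metis leading_coeff_0_iff)
      then show False using \<open>degree ?h = degree f\<close> False m_pos by simp
    qed
    then obtain q r where "?h = q \<star> x + r" "degree r < m" "degree q \<le> degree ?h"
      using less by blast
    then show ?thesis
      using le dq by (intro exI[of _ "?q + q"] exI[of _ r])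
        (auto simp: skm_add_left algebra_simps intro!: degree_add_le)
  qed
qed

lemma division_degree:
  assumes "f = q \<star> x + r" "degree r < m" "q \<noteq> 0"
  shows "degree f = degree q + m"
proof -
  have "degree (q \<star> x) = degree q + m" using assms x_nz by (simp add: degree_skm degree_x)
  then show ?thesis using assms by (simp add: degree_add_eq_left)
qed

section \<open>Independence of the powers of \<delta>, and the center of R\<close>

lemma funpow_Z: "c \<in> Z \<Longrightarrow> (\<delta> ^^ i) c \<in> Z"
  using funpow_deriv_commute[of c i] by (auto simp: Z_def)

lemma Z_commute: "c \<in> Z \<Longrightarrow> c * a = a * c"
  by (simp add: Z_def)

lemma Z_mult: "a \<in> Z \<Longrightarrow> b \<in> Z \<Longrightarrow> a * b \<in> Z"
  unfolding Z_def mem_Collect_eq by (metis mult.assoc)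

lemma Z_inverse:
  assumes "a \<in> Z"
  shows "inverse a \<in> Z"
proof (cases "a = 0")
  case False
  have "inverse a * c = c * inverse a" for c
  proof -
    have "inverse a * c = inverse a * (c * a) * inverse a"
      using False by (simp add: mult.assoc)
    also have "\<dots> = inverse a * (a * c) * inverse a"
      using Z_commute[OF assms] by simp
    also have "\<dots> = c * inverse a"
      using False by (simp add: mult.assoc[symmetric])
    finally show ?thesis .
  qed
  then show ?thesis by (simp add: Z_def)
qed (use assms in simp)

text \<open>Normalise the last coefficient to 1. Differentiating the relation and subtracting the
  relation at \<delta> c leaves a shorter one with coefficients \<delta>(b i); the commutator with
  \<open>u\<close> leaves one with coefficients \<open>b i * u - u * b i\<close>. So all
  \<open>b i\<close> lie in F, and the relation contradicts the minimality of
  \<open>g\<close>.\<close>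

lemma deriv_powers_independent:
  assumes "n \<le> m" "\<And>c. c \<in> Z \<Longrightarrow> (\<Sum>i<n. a i * (\<delta> ^^ i) c) = 0"
  shows "\<forall>i<n. a i = 0"
  using assms
proof (induction n arbitrary: a)
  case (Suc n)
  show ?case
  proof (cases "a n = 0")
    case True
    then have "\<forall>i<n. a i = 0" using Suc.prems by (intro Suc.IH) auto
    then show ?thesis using True less_Suc_eq by auto
  next
    case False
    define b where "b i = inverse (a n) * a i" for i
    have b_n: "b n = 1" using False by (simp add: b_def)
    have b: "(\<Sum>i<Suc n. b i * (\<delta> ^^ i) c) = 0" if "c \<in> Z" for c
      using Suc.prems(2)[OF that]
      by (simp only: b_def mult.assoc sum_distrib_left[symmetric]) simp
    have const: "\<forall>i<n. \<delta> (b i) = 0"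
    proof (rule Suc.IH)
      fix c assume c: "c \<in> Z"
      have "0 = \<delta> (\<Sum>i<Suc n. b i * (\<delta> ^^ i) c)" using b[OF c] by simp
      also have "\<dots> = (\<Sum>i<Suc n. \<delta> (b i) * (\<delta> ^^ i) c) + (\<Sum>i<Suc n. b i * (\<delta> ^^ i) (\<delta> c))"
        by (simp only: deriv_sum deriv_mult sum.distrib funpow_swap1)
      also have "(\<Sum>i<Suc n. b i * (\<delta> ^^ i) (\<delta> c)) = 0"
        using b[OF funpow_Z[OF c, of 1]] by simp
      finally show "(\<Sum>i<n. \<delta> (b i) * (\<delta> ^^ i) c) = 0" using b_n by simp
    qed (use Suc.prems in simp)
    have cent: "b i * u - u * b i = 0" if "i < n" for i u
    proof -
      have "\<forall>i<n. b i * u - u * b i = 0"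
      proof (rule Suc.IH)
        fix c assume c: "c \<in> Z"
        have "0 = (\<Sum>i<Suc n. b i * (\<delta> ^^ i) c) * u - u * (\<Sum>i<Suc n. b i * (\<delta> ^^ i) c)"
          using b[OF c] by simp
        also have "\<dots> = (\<Sum>i<Suc n. (b i * u - u * b i) * (\<delta> ^^ i) c)"
          by (simp only: sum_distrib_left sum_distrib_right sum_subtractf[symmetric])
             (intro sum.cong refl, simp add: algebra_simps Z_commute[OF funpow_Z[OF c]])
        finally show "(\<Sum>i<n. (b i * u - u * b i) * (\<delta> ^^ i) c) = 0" using b_n by simp
      qed (use Suc.prems in simp)
      then show ?thesis using that by simp
    qed
    have "\<forall>i<Suc n. b i \<in> range j"
    proof (intro allI impI)
      fix i assume "i < Suc n"
      then consider "i < n" | "i = n" by linarith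
      then show "b i \<in> range j"
      proof cases
        case 1
        then show ?thesis using const cent by (intro in_range_j) (auto simp: Z_def)
      next
        case 2
        then have "b i = j 1" using b_n by simp
        then show ?thesis by blast
      qed
    qed
    then have "\<forall>i. \<exists>k. i < Suc n \<longrightarrow> b i = j k" by blast
    then obtain k where k: "\<And>i. i < Suc n \<Longrightarrow> b i = j (k i)" by metis
    define h where "h = (\<Sum>i<Suc n. Polynomial.monom (k i) i)"
    have ch: "coeff h i = (if i < Suc n then k i else 0)" for i
      unfolding h_def by (simp add: coeff_sum)
    have "k n \<noteq> 0" using k[of n] b_n by auto
    then have dh: "degree h = n"
      by (intro antisym degree_le le_degree) (auto simp: ch)
    have "h \<noteq> 0" using ch[of n] \<open>k n \<noteq> 0\<close> by auto
    then have "m \<le> degree h"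
    proof (rule g_minimal)
      fix c assume "c \<in> Z"
      have "poly_op j \<delta> h c = (\<Sum>i<Suc n. b i * (\<delta> ^^ i) c)"
        unfolding poly_op_def dh lessThan_Suc_atMost[symmetric] by (rule sum.cong) (auto simp: ch k)
      then show "poly_op j \<delta> h c = 0" using b[OF \<open>c \<in> Z\<close>] by simp
    qed
    then have "m \<le> n" by (simp only: dh)
    then show ?thesis using Suc.prems by simp
  qed
qed simp

lemma central_low_degree:
  assumes central: "\<And>f. r \<star> f = f \<star> r" and deg: "degree r < m"
  shows "\<exists>a. r = [:j a:]"
proof -
  \<comment> \<open>Index 0 is removed because its term \<open>coeff r 0 * c\<close> cancels against
    the constant coefficient of c r when \<open>c\<close> is central.\<close>
  define a where "a i = (if i = 0 then 0 else coeff r i)" for i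
  have "(\<Sum>i<m. a i * (\<delta> ^^ i) c) = 0" if c: "c \<in> Z" for c
  proof -
    have "r \<star> [:c:] = (\<Sum>i\<le>m - 1. lscale (coeff r i) ((tm ^^ i) [:c:]))"
      using deg by (intro skm_bound) simp
    then have "coeff (r \<star> [:c:]) 0 = (\<Sum>i\<le>m - 1. coeff r i * (\<delta> ^^ i) c)"
      by (simp add: coeff_sum coeff_lscale coeff_tm_funpow_const)
    also have "{..m - 1} = {..<m}" using m_pos by auto
    also have "(\<Sum>i<m. coeff r i * (\<delta> ^^ i) c) = (\<Sum>i<m. a i * (\<delta> ^^ i) c) + coeff r 0 * c"
    proof -
      have "(\<Sum>i<m. coeff r i * (\<delta> ^^ i) c)
          = (\<Sum>i<m. a i * (\<delta> ^^ i) c + (if i = 0 then coeff r 0 * c else 0))"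
        by (intro sum.cong) (auto simp: a_def)
      also have "\<dots> = (\<Sum>i<m. a i * (\<delta> ^^ i) c) + coeff r 0 * c"
        using m_pos by (subst sum.distrib) (simp add: sum.delta)
      finally show ?thesis .
    qed
    finally have "coeff ([:c:] \<star> r) 0 = (\<Sum>i<m. a i * (\<delta> ^^ i) c) + coeff r 0 * c"
      using central[of "[:c:]"] by simp
    then show ?thesis using Z_commute[OF c] by (simp add: skm_const coeff_lscale)
  qed
  then have "\<forall>i<m. a i = 0" by (intro deriv_powers_independent) auto
  then have r: "r = [:coeff r 0:]"
    using deg by (intro poly_eqI) (metis a_def coeff_eq_0 coeff_pCons_0 degree_pCons_0 not_gr_zero not_less order.strict_trans2)
  define b where "b = coeff r 0"
  have r: "r = [:b:]" using r by (simp add: b_def)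
  have "b * z = z * b" for z
    using central[of "[:z:]"] by (simp add: r skm_const) (simp add: lscale_const)
  moreover have "\<delta> b = 0"
    using central[of "[:0, 1:]"] by (simp add: r skm_t tm_eq) (simp add: t_mult_def Polynomial.map_poly_pCons)
  ultimately show ?thesis using in_range_j[of b] r by (auto simp: Z_def)
qed

text \<open>For z = q x + r the commutator with f is (q f - f q) x + (r f - f r). If r f - f r has
  degree below m, both parts vanish. This holds for constants f and for f = t, where r t - t r = -
  \<delta>(r), and these generate R. So \<open>q\<close> and \<open>r\<close> are central, and the
  induction continues with \<open>q\<close>.\<close>

lemma center_eq_range_eps:
  assumes "\<And>f. z \<star> f = f \<star> z"
  shows "\<exists>h. z = \<epsilon> h"
  using assms
proof (induction "degree z" arbitrary: z rule: less_induct)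
  case less
  obtain q r where qr: "z = q \<star> x + r" "degree r < m" using division by blast
  have *: "q \<star> f = f \<star> q \<and> r \<star> f = f \<star> r" if d: "degree (r \<star> f - f \<star> r) < m" for f
  proof -
    have "q \<star> x \<star> f = q \<star> f \<star> x" by (simp add: skm_assoc x_central)
    then have eq: "0 = (q \<star> f - f \<star> q) \<star> x + (r \<star> f - f \<star> r)"
      using less.prems[of f]
      by (simp add: qr skm_add_left skm_add_right skm_diff_left skm_assoc algebra_simps)
    then have "q \<star> f - f \<star> q = 0"
      using division_degree[OF eq d] m_pos by auto
    then show ?thesis using eq by simp
  qed
  have const: "degree (r \<star> [:a:] - [:a:] \<star> r) < m" for a
    using degree_skm_le[of r "[:a:]"] degree_skm_le[of "[:a:]" r] qr(2)
    by (intro le_less_trans[OF degree_diff_le[of _ "degree r"]]) auto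
  have "r \<star> [:0, 1:] - [:0, 1:] \<star> r = - map_poly \<delta> r"
    by (simp add: skm_t tm_eq t_mult_def)
  then have t: "degree (r \<star> [:0, 1:] - [:0, 1:] \<star> r) < m"
    using qr(2) by (simp add: le_less_trans[OF map_poly_degree_leq])
  have "r \<star> f = f \<star> r" for f
    by (rule central_if_commutes) (use * const t in auto)
  then obtain a where a: "r = [:j a:]" using central_low_degree qr(2) by blast
  show ?case
  proof (cases "q = 0")
    case True
    then have "z = \<epsilon> [:a:]" using qr a by (simp add: eps_const)
    then show ?thesis by blast
  next
    case False
    have "q \<star> f = f \<star> q" for f
      by (rule central_if_commutes) (use * const t in auto)
    moreover have "degree q < degree z"
      using division_degree[OF qr False] m_pos by simp
    ultimately obtain h where "q = \<epsilon> h" using less.hyps by blast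
    then have "z = \<epsilon> (pCons a h)" using qr a by (simp add: eps_pCons x_central add.commute)
    then show ?thesis by blast
  qed
qed

text \<open>Remainders modulo x are combinations of the a t^i with i < m, and the quotient has
  smaller degree. Its factor x is central and moves into the coefficients, which is the shift
  \<open>pCons 0\<close>.\<close>

lemma finitely_generated:
  assumes G: "finite G" "\<And>z. \<exists>k. z = (\<Sum>a\<in>G. j (k a) * a)"
  shows "\<exists>h. f = (\<Sum>(a, i)\<in>G \<times> {..<m}. \<epsilon> (h (a, i)) \<star> Polynomial.monom a i)"
proof (induction "degree f" arbitrary: f rule: less_induct)
  case less
  let ?I = "G \<times> {..<m}"
  obtain q r where qr: "f = q \<star> x + r" "degree r < m" using division by blast
  obtain k where k: "\<And>z. z = (\<Sum>a\<in>G. j (k z a) * a)" using G(2) by metis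
  have "r = (\<Sum>i<m. Polynomial.monom (coeff r i) i)"
    using qr(2) poly_as_sum_of_monoms'[of r "m - 1"] m_pos
    by (simp add: lessThan_Suc_atMost[symmetric])
  also have "\<dots> = (\<Sum>i<m. \<Sum>a\<in>G. \<epsilon> [:k (coeff r i) a:] \<star> Polynomial.monom a i)"
  proof (rule sum.cong)
    fix i
    show "Polynomial.monom (coeff r i) i = (\<Sum>a\<in>G. \<epsilon> [:k (coeff r i) a:] \<star> Polynomial.monom a i)"
      by (rule poly_eqI) (use k[of "coeff r i"] in \<open>auto simp: eps_const skm_const coeff_sum coeff_lscale\<close>)
  qed simp
  also have "\<dots> = (\<Sum>(a, i)\<in>?I. \<epsilon> [:k (coeff r i) a:] \<star> Polynomial.monom a i)"
    by (subst sum.swap) (simp add: sum.cartesian_product)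
  finally have r: "r = \<dots>" .
  obtain h where h: "q \<star> x = (\<Sum>(a, i)\<in>?I. \<epsilon> (h (a, i)) \<star> Polynomial.monom a i)"
  proof (cases "q = 0")
    case True
    then show ?thesis by (intro that[of "\<lambda>_. 0"]) (simp add: case_prod_unfold)
  next
    case False
    then have "degree q < degree f" using division_degree[OF qr] m_pos by simp
    then obtain h where h: "q = (\<Sum>(a, i)\<in>?I. \<epsilon> (h (a, i)) \<star> Polynomial.monom a i)"
      using less by blast
    have "q \<star> x = x \<star> q" by (simp add: x_central)
    also have "\<dots> = (\<Sum>(a, i)\<in>?I. x \<star> (\<epsilon> (h (a, i)) \<star> Polynomial.monom a i))"
      by (subst h) (simp add: skm_sum_right case_prod_unfold)
    also have "\<dots> = (\<Sum>(a, i)\<in>?I. \<epsilon> (pCons 0 (h (a, i))) \<star> Polynomial.monom a i)"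
      by (simp add: eps_pCons skm_assoc)
    finally show ?thesis by (intro that)
  qed
  show ?case
    by (rule exI[of _ "\<lambda>(a, i). h (a, i) + [:k (coeff r i) a:]"], subst qr(1), subst h, subst r)
       (simp add: sum.distrib[symmetric] case_prod_unfold eps_add skm_add_left)
qed

text \<open>
  The vectors \<open>(c, \<delta> c, \<dots>, \<delta>\<^bsup>m-1\<^esup> c)\<close> of elements \<open>c\<close> independent over the constants are independent:
  differentiating a relation with one coefficient \<open>1\<close> gives a shorter relation.
\<close>
lemma wronskian_independent:
  assumes "finite I" "I \<subseteq> Z"
    and indep: "\<And>k. (\<Sum>c\<in>I. j (k c) * c) = 0 \<Longrightarrow> \<forall>c\<in>I. k c = 0"
    and "u ` I \<subseteq> Z" "\<And>i. i < m \<Longrightarrow> (\<Sum>c\<in>I. u c * (\<delta> ^^ i) c) = 0"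
  shows "\<forall>c\<in>I. u c = 0"
  using assms
proof (induction I arbitrary: u rule: finite_induct)
  case (insert c0 I)
  have IH_indep: "\<forall>c\<in>I. k c = 0" if "(\<Sum>c\<in>I. j (k c) * c) = 0" for k
  proof -
    have "(\<Sum>c\<in>insert c0 I. j ((k(c0 := 0)) c) * c) = (\<Sum>c\<in>I. j (k c) * c)"
      using insert.hyps by (auto intro!: sum.cong)
    then have "\<forall>c\<in>insert c0 I. (k(c0 := 0)) c = 0"
      using that by (intro insert.prems(2)) simp
    then show ?thesis using insert.hyps by (auto split: if_splits)
  qed
  note IH = insert.IH[OF _ IH_indep]
  show ?case
  proof (cases "u c0 = 0")
    case True
    have "\<forall>c\<in>I. u c = 0"
    proof (rule IH)
      show "(\<Sum>c\<in>I. u c * (\<delta> ^^ i) c) = 0" if "i < m" for i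
        using insert.prems(4)[OF that] insert.hyps True by simp
    qed (use insert.prems(1,3) in auto)
    then show ?thesis using True by simp
  next
    case False
    define b where "b c = inverse (u c0) * u c" for c
    have "inverse (u c0) \<in> Z" using insert.prems(3) by (auto intro: Z_inverse)
    then have bZ: "b c \<in> Z" if "c \<in> insert c0 I" for c
      unfolding b_def using insert.prems(3) that by (intro Z_mult) auto
    have b0: "b c0 = 1" using False by (simp add: b_def)
    have rel: "(\<Sum>c\<in>insert c0 I. b c * (\<delta> ^^ i) c) = 0" if "i < m" for i
      using insert.prems(4)[OF that]
      by (simp only: b_def mult.assoc sum_distrib_left[symmetric]) simp
    \<comment> \<open>On Z the operator \<delta>^m is a combination of lower powers, so the relation
      extends to order m. This makes the derivative of the relation of order m - 1 usable.\<close>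
    have rel_m: "(\<Sum>c\<in>insert c0 I. b c * (\<delta> ^^ m) c) = 0"
    proof -
      have dm: "(\<delta> ^^ m) c = - (\<Sum>i<m. j (coeff g i) * (\<delta> ^^ i) c)" if "c \<in> Z" for c
        using g_annihilates[OF that] g_monic
        by (simp add: poly_op_def lessThan_Suc_atMost[symmetric] m_def eq_neg_iff_add_eq_0 add.commute)
      have "(\<Sum>c\<in>insert c0 I. b c * (\<delta> ^^ m) c)
          = - (\<Sum>c\<in>insert c0 I. \<Sum>i<m. j (coeff g i) * (b c * (\<delta> ^^ i) c))"
      proof (subst sum_negf[symmetric], rule sum.cong)
        fix c assume c: "c \<in> insert c0 I"
        then have "c \<in> Z" using insert.prems(1) by auto
        then have "b c * (\<delta> ^^ m) c = - (\<Sum>i<m. b c * (j (coeff g i) * (\<delta> ^^ i) c))"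
          by (simp add: dm sum_distrib_left)
        also have "\<dots> = - (\<Sum>i<m. j (coeff g i) * (b c * (\<delta> ^^ i) c))"
        proof -
          have "b c * (j a * y) = j a * (b c * y)" for a y
            by (simp add: mult.assoc[symmetric] j_central[of a "b c"])
          then show ?thesis by simp
        qed
        finally show "b c * (\<delta> ^^ m) c = - (\<Sum>i<m. j (coeff g i) * (b c * (\<delta> ^^ i) c))" .
      qed simp
      also have "\<dots> = - (\<Sum>i<m. j (coeff g i) * (\<Sum>c\<in>insert c0 I. b c * (\<delta> ^^ i) c))"
        by (subst sum.swap) (simp only: sum_distrib_left)
      also have "\<dots> = - (\<Sum>i<m. j (coeff g i) * 0)"
        by (intro arg_cong[of _ _ uminus] sum.cong refl) (simp only: lessThan_iff rel)
      finally show ?thesis by simp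
    qed
    have const: "\<forall>c\<in>I. \<delta> (b c) = 0"
    proof (rule IH)
      fix i assume i: "i < m"
      have "0 = \<delta> (\<Sum>c\<in>insert c0 I. b c * (\<delta> ^^ i) c)" by (simp only: rel[OF i] deriv_0)
      also have "\<dots> = (\<Sum>c\<in>insert c0 I. \<delta> (b c) * (\<delta> ^^ i) c) + (\<Sum>c\<in>insert c0 I. b c * (\<delta> ^^ Suc i) c)"
        by (simp only: deriv_sum deriv_mult sum.distrib funpow.simps o_apply)
      also have "(\<Sum>c\<in>insert c0 I. b c * (\<delta> ^^ Suc i) c) = 0"
        using i rel[of "Suc i"] rel_m by (cases "Suc i = m") (simp_all only: Suc_lessI)
      finally show "(\<Sum>c\<in>I. \<delta> (b c) * (\<delta> ^^ i) c) = 0"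
        using b0 insert.hyps by simp
    next
      show "(\<lambda>c. \<delta> (b c)) ` I \<subseteq> Z"
        using bZ funpow_Z[of _ 1] by auto
    qed (use insert.prems(1) in auto)
    have b_range: "\<forall>c\<in>insert c0 I. b c \<in> range j"
    proof
      fix c assume c: "c \<in> insert c0 I"
      then have "\<delta> (b c) = 0" using const b0 by auto
      with bZ[OF c] show "b c \<in> range j" by (rule in_range_j)
    qed
    have "\<forall>c. \<exists>k. c \<in> insert c0 I \<longrightarrow> b c = j k" using b_range by blast
    then obtain k where k: "\<And>c. c \<in> insert c0 I \<Longrightarrow> b c = j (k c)" by metis
    have "(\<Sum>c\<in>insert c0 I. j (k c) * c) = 0"
      using rel[OF m_pos] by (simp only: k funpow_0 cong: sum.cong)
    then have "k c0 = 0" using insert.prems(2) by blast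
    then show ?thesis using k[of c0] b0 by simp
  qed
qed simp

end

section \<open>Finiteness of D over F\<close>

context algebraic_derivation
begin

text \<open>More than m elements of C independent over F would admit a nonzero solution
  \<open>u\<close> in C of the m equations saying that the sum of the \<open>u c\<close> times
  \<delta>^i(c) is 0, against \<open>wronskian_independent\<close>. So C is finite over F, and
  products of an F-basis of C with a C-basis of D span D.\<close>

lemma finite_over_constants:
  fixes \<iota>C :: "'c::field \<Rightarrow> 'd" and \<iota>F :: "'f \<Rightarrow> 'c"
  assumes C: "Ring_Hom.ring_hom \<iota>C" and F: "Ring_Hom.ring_hom \<iota>F"
    and j: "j = \<iota>C \<circ> \<iota>F" and Z: "range \<iota>C = Z" and dim: "alg_dim \<iota>C UNIV > 0"
  shows "\<exists>G. finite G \<and> (\<forall>z. \<exists>k. z = (\<Sum>a\<in>G. j (k a) * a))"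
proof -
  interpret C: Ring_Hom.ring_hom \<iota>C by (rule C)
  interpret F: Ring_Hom.ring_hom \<iota>F by (rule F)
  interpret VF: vector_space "\<lambda>a z. \<iota>F a * z"
    by unfold_locales (auto simp: algebra_simps F.hom_add F.hom_mult)
  interpret VC: vector_space "\<lambda>a z. \<iota>C a * z"
    by unfold_locales (auto simp: algebra_simps C.hom_add C.hom_mult)
  have C0: "\<iota>C a = 0 \<Longrightarrow> a = 0" for a
    by (metis C.hom_mult C.hom_one field_class.field_inverse mult_zero_right zero_neq_one)
  have inj: "inj \<iota>C"
    by (rule injI) (metis C0 C.hom_minus eq_iff_diff_eq_0)
  have VF_bound: "card I \<le> m" if I: "finite I" "VF.independent I" for I
  proof (rule ccontr)
    assume "\<not> card I \<le> m"
    \<comment> \<open>The derivatives are pulled back to the type of C, because the linear system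
      has to be solved in a commutative field.\<close>
    define Y where "Y i c = inv_into UNIV \<iota>C ((\<delta> ^^ i) (\<iota>C c))" for i c
    have Y: "\<iota>C (Y i c) = (\<delta> ^^ i) (\<iota>C c)" for i c
      unfolding Y_def using Z funpow_Z[of "\<iota>C c" i] by (intro f_inv_into_f) auto
    obtain u where u: "\<exists>c\<in>I. u c \<noteq> 0" "\<And>i. i < m \<Longrightarrow> (\<Sum>c\<in>I. u c * Y i c) = 0"
      using homogeneous_system_solution[of "{..<m}" I Y] I \<open>\<not> card I \<le> m\<close> by auto
    have "\<forall>c\<in>\<iota>C ` I. \<iota>C (u (inv_into UNIV \<iota>C c)) = 0"
    proof (rule wronskian_independent)
      fix k assume k: "(\<Sum>c\<in>\<iota>C ` I. j (k c) * c) = 0"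
      have "\<iota>C (\<Sum>c\<in>I. \<iota>F (k (\<iota>C c)) * c) = 0"
        using k by (simp add: sum.reindex inj_on_subset[OF inj] j C.hom_sum C.hom_mult)
      then have "(\<Sum>c\<in>I. \<iota>F (k (\<iota>C c)) * c) = 0" by (rule C0)
      then show "\<forall>c\<in>\<iota>C ` I. k c = 0"
        using VF.independentD[OF I(2) I(1), of "\<lambda>c. k (\<iota>C c)"] by auto
    next
      fix i assume "i < m"
      then have "\<iota>C (\<Sum>c\<in>I. u c * Y i c) = 0" using u by simp
      then show "(\<Sum>c\<in>\<iota>C ` I. \<iota>C (u (inv_into UNIV \<iota>C c)) * (\<delta> ^^ i) c) = 0"
        by (simp add: sum.reindex inj_on_subset[OF inj] C.hom_sum C.hom_mult Y inv_f_f[OF inj])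
    qed (use I Z in auto)
    then show False using u(1) C0 by (auto simp: inv_f_f[OF inj])
  qed
  obtain I where I: "VF.independent I" "UNIV \<subseteq> VF.span I"
    using VF.maximal_independent_subset[of UNIV] by metis
  have fin_I: "finite I"
  proof (rule ccontr)
    assume "infinite I"
    then obtain J where "J \<subseteq> I" "finite J" "card J = Suc m"
      using infinite_arbitrarily_large by blast
    then show False using VF_bound[of J] VF.independent_mono[OF I(1), of J] by simp
  qed
  obtain B where B: "VC.independent B" "UNIV \<subseteq> VC.span B"
    using VC.maximal_independent_subset[of UNIV] by metis
  have span_B: "VC.span B = UNIV" using B(2) by (rule top.extremum_uniqueI)
  have "VC.span B = VC.span UNIV" by (simp only: span_B VC.span_UNIV)
  from VC.dim_eq_card[OF this B(1)] have "card B > 0" using dim by (simp only: alg_dim_def)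
  \<comment> \<open>\<open>card\<close> is 0 on infinite sets, so a positive dimension makes the
    basis finite.\<close>
  then have fin_B: "finite B" by (rule card_ge_0_finite)
  let ?G = "(\<lambda>(c, b). \<iota>C c * b) ` (I \<times> B)"
  have fin_G: "finite ?G" using fin_I fin_B by (intro finite_imageI finite_cartesian_product)
  have "\<exists>k. z = (\<Sum>a\<in>?G. j (k a) * a)" for z
  proof -
    interpret V: vector_space "\<lambda>a z. j a * z"
      by unfold_locales (auto simp: algebra_simps j.hom_add j.hom_mult)
    have "z \<in> V.span ?G"
    proof -
      have "z \<in> range (\<lambda>u. \<Sum>b\<in>B. \<iota>C (u b) * b)"
        using span_B VC.span_finite[OF fin_B] by simp
      then obtain u where u: "z = (\<Sum>b\<in>B. \<iota>C (u b) * b)" by (rule rangeE)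
      have "\<iota>C (u b) * b \<in> V.span ?G" if b: "b \<in> B" for b
      proof -
        have "u b \<in> range (\<lambda>v. \<Sum>c\<in>I. \<iota>F (v c) * c)"
          using I(2) VF.span_finite[OF fin_I] by blast
        then obtain v where v: "u b = (\<Sum>c\<in>I. \<iota>F (v c) * c)" by (rule rangeE)
        have "\<iota>C (u b) * b = (\<Sum>c\<in>I. j (v c) * (\<iota>C c * b))"
          by (simp only: v C.hom_sum C.hom_mult j o_apply sum_distrib_right mult.assoc)
        also have "\<dots> \<in> V.span ?G"
        proof (rule V.span_sum)
          fix c assume "c \<in> I"
          then have "\<iota>C c * b \<in> ?G" using b by auto
          then show "j (v c) * (\<iota>C c * b) \<in> V.span ?G" by (rule V.span_scale[OF V.span_base])
        qed
        finally show ?thesis .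
      qed
      then show ?thesis unfolding u by (rule V.span_sum)
    qed
    moreover have "V.span ?G = range (\<lambda>k. \<Sum>a\<in>?G. j (k a) * a)"
      by (rule V.span_finite[OF fin_G])
    ultimately have "z \<in> range (\<lambda>k. \<Sum>a\<in>?G. j (k a) * a)" by (simp only:)
    then obtain k where "z = (\<Sum>a\<in>?G. j (k a) * a)" by (rule rangeE)
    then show ?thesis by (rule exI[where x = k])
  qed
  then show ?thesis using fin_G by (intro exI[of _ ?G] conjI allI)
qed

end

context algebraic_derivation
begin

section \<open>The reduced norm of a skew polynomial\<close>

text \<open>\<open>R\<close> as a module over \<open>F[x][y]\<close>, with \<open>y\<close> acting as left multiplication by \<open>f\<close>.\<close>

definition ev :: "'d poly \<Rightarrow> 'f poly poly \<Rightarrow> 'd poly \<Rightarrow> 'd poly" where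
  "ev f H r = (\<Sum>i\<le>degree H. \<epsilon> (coeff H i) \<star> ((skew_mult \<delta> f ^^ i) r))"

lemma ev_pCons: "ev f (pCons h H) r = \<epsilon> h \<star> r + f \<star> ev f H r"
proof -
  have "ev f (pCons h H) r = (\<Sum>i\<le>Suc (degree H). \<epsilon> (coeff (pCons h H) i) \<star> ((skew_mult \<delta> f ^^ i) r))"
    unfolding ev_def
    by (intro sum.mono_neutral_left) (auto simp: coeff_eq_0 intro: degree_pCons_le[THEN le_trans])
  also have "\<dots> = \<epsilon> h \<star> r + (\<Sum>i\<le>degree H. \<epsilon> (coeff H i) \<star> (f \<star> (skew_mult \<delta> f ^^ i) r))"
    by (subst sum.atMost_Suc_shift) simp
  also have "(\<Sum>i\<le>degree H. \<epsilon> (coeff H i) \<star> (f \<star> (skew_mult \<delta> f ^^ i) r)) = f \<star> ev f H r"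
    unfolding ev_def skm_sum_right by (intro sum.cong refl) (metis eps_central skm_assoc)
  finally show ?thesis .
qed

lemma ev_0 [simp]: "ev f 0 r = 0"
  by (simp add: ev_def)

lemma ev_1: "ev f 1 r = r"
  unfolding one_pCons[where 'a = "'f poly"] ev_pCons by simp

lemma ev_right: "ev f H (r \<star> s) = ev f H r \<star> s"
  by (induction H) (simp_all add: ev_pCons skm_add_left skm_assoc)

lemma ev_add_right: "ev f H (r + s) = ev f H r + ev f H s"
  by (induction H) (simp_all add: ev_pCons skm_add_right)

lemma ev_sum_right: "ev f H (sum r I) = (\<Sum>i\<in>I. ev f H (r i))"
proof (induction I rule: infinite_finite_induct)
  case (insert i I)
  show ?case by (simp only: sum.insert[OF insert.hyps] ev_add_right insert.IH)
qed (use ev_right[of f H 0 0] in simp_all)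

lemma ev_eps: "ev f H (\<epsilon> h \<star> r) = \<epsilon> h \<star> ev f H r"
proof (induction H)
  case (pCons a H)
  have "\<epsilon> a \<star> (\<epsilon> h \<star> r) = \<epsilon> h \<star> (\<epsilon> a \<star> r)" "f \<star> (\<epsilon> h \<star> ev f H r) = \<epsilon> h \<star> (f \<star> ev f H r)"
    by (metis eps_central skm_assoc)+
  then show ?case by (simp add: ev_pCons pCons.IH skm_add_right)
qed simp

lemma ev_add: "ev f (H + K) r = ev f H r + ev f K r"
proof (induction H K rule: poly_induct2)
  case (pCons a p b q)
  then show ?case by (simp add: ev_pCons eps_add skm_add_left skm_add_right)
qed simp

lemma ev_smult: "ev f (smult h H) r = \<epsilon> h \<star> ev f H r"
proof (induction H)
  case (pCons a H)
  have "f \<star> (\<epsilon> h \<star> ev f H r) = \<epsilon> h \<star> (f \<star> ev f H r)" by (metis eps_central skm_assoc)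
  then show ?case by (simp add: ev_pCons pCons.IH skm_add_right eps_mult skm_assoc)
qed simp

lemma ev_mult: "ev f (H * K) r = ev f H (ev f K r)"
proof (induction H)
  case (pCons h H)
  then show ?case by (simp add: ev_add ev_smult ev_pCons)
qed simp

lemma ev_sum: "ev f (sum H I) r = (\<Sum>i\<in>I. ev f (H i) r)"
proof (induction I rule: infinite_finite_induct)
  case (insert i I)
  show ?case by (simp only: sum.insert[OF insert.hyps] ev_add insert.IH)
qed simp_all

text \<open>The identities
  \<open>f \<star> e k = (\<Sum>l<N. \<epsilon> (h k l) \<star> e l)\<close> say that y - Mt kills
  the vector of generators. Multiplying by the adjugate shows that the characteristic polynomial
  kills each generator, hence also the unit. The commutativity behind the determinant is that of
  F[x][y], which acts through \<open>ev\<close>.\<close>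

lemma integral_equation:
  assumes G: "finite G" "\<And>z. \<exists>k. z = (\<Sum>a\<in>G. j (k a) * a)"
  shows "\<exists>H. lead_coeff H = 1 \<and> ev f H [:1:] = 0"
proof -
  let ?I = "G \<times> {..<m}"
  define N where "N = card ?I"
  have "finite ?I" using G(1) by simp
  then obtain b where "bij_betw b {0..<card ?I} ?I" using ex_bij_betw_nat_finite by blast
  then have b: "bij_betw b {..<N} ?I" by (simp add: N_def lessThan_atLeast0)
  define e where "e k = (case b k of (a, i) \<Rightarrow> Polynomial.monom a i)" for k
  have span: "\<exists>h. r = (\<Sum>k<N. \<epsilon> (h k) \<star> e k)" for r
  proof -
    obtain h where "r = (\<Sum>(a, i)\<in>?I. \<epsilon> (h (a, i)) \<star> Polynomial.monom a i)"
      using finitely_generated[OF G] by blast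
    also have "\<dots> = (\<Sum>k<N. case b k of (a, i) \<Rightarrow> \<epsilon> (h (a, i)) \<star> Polynomial.monom a i)"
      by (rule sum.reindex_bij_betw[OF b, symmetric])
    also have "\<dots> = (\<Sum>k<N. \<epsilon> (h (b k)) \<star> e k)"
      by (intro sum.cong refl) (simp add: e_def split: prod.split)
    finally show ?thesis by (intro exI[of _ "\<lambda>k. h (b k)"])
  qed
  then have "\<forall>k. \<exists>h. f \<star> e k = (\<Sum>l<N. \<epsilon> (h l) \<star> e l)" by blast
  then obtain h where h: "\<And>k. f \<star> e k = (\<Sum>l<N. \<epsilon> (h k l) \<star> e l)" by metis
  define Mt where "Mt = mat N N (\<lambda>(k, l). h k l)"
  have Mt: "Mt \<in> carrier_mat N N" by (simp add: Mt_def)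
  have Mt_index: "Mt $$ (k, l) = h k l" if "k < N" "l < N" for k l using that by (simp add: Mt_def)
  let ?C = "char_poly_matrix Mt" and ?\<chi> = "char_poly Mt"
  have C: "?C \<in> carrier_mat N N" using Mt by simp
  have adj: "adj_mat ?C \<in> carrier_mat N N" "adj_mat ?C * ?C = ?\<chi> \<cdot>\<^sub>m 1\<^sub>m N"
    using adj_mat[OF C] by (auto simp: char_poly_def)
  have rows: "(\<Sum>l<N. ev f (?C $$ (k, l)) (e l)) = 0" if k: "k < N" for k
  proof -
    have "(\<Sum>l<N. ev f (?C $$ (k, l)) (e l)) = (\<Sum>l<N. (if l = k then f \<star> e k else 0) - \<epsilon> (h k l) \<star> e l)"
      by (intro sum.cong refl)
         (use k in \<open>auto simp: char_poly_matrix_index[OF Mt] Mt_index ev_pCons eps_minus skm_minus_left\<close>)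
    also have "\<dots> = 0" using k by (simp add: sum_subtractf h)
    finally show ?thesis .
  qed
  have kill: "ev f ?\<chi> (e s) = 0" if s: "s < N" for s
  proof -
    have "0 = (\<Sum>k<N. ev f (adj_mat ?C $$ (s, k)) (\<Sum>l<N. ev f (?C $$ (k, l)) (e l)))"
      by (rule sum.neutral[symmetric], rule ballI) (use ev_right[of f _ 0 0] in \<open>simp add: rows\<close>)
    also have "\<dots> = (\<Sum>l<N. \<Sum>k<N. ev f (adj_mat ?C $$ (s, k) * ?C $$ (k, l)) (e l))"
      unfolding ev_sum_right ev_mult by (rule sum.swap)
    also have "\<dots> = (\<Sum>l<N. ev f ((adj_mat ?C * ?C) $$ (s, l)) (e l))"
      by (intro sum.cong refl) (use s in \<open>simp add: mult_mat_index[OF adj(1) C] ev_sum\<close>)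
    also have "\<dots> = (\<Sum>l<N. if l = s then ev f ?\<chi> (e s) else 0)"
      by (intro sum.cong refl) (use s in \<open>auto simp: adj(2)\<close>)
    also have "\<dots> = ev f ?\<chi> (e s)" using s by simp
    finally show ?thesis by simp
  qed
  obtain u where u: "[:1:] = (\<Sum>k<N. \<epsilon> (u k) \<star> e k)" using span by blast
  have "ev f ?\<chi> [:1:] = 0"
    unfolding u ev_sum_right ev_eps by (rule sum.neutral) (simp add: kill)
  moreover have "lead_coeff ?\<chi> = 1" using degree_monic_char_poly[OF Mt] by simp
  ultimately show ?thesis by blast
qed

lemma ev_commute: "f \<star> ev f H [:1:] = ev f H [:1:] \<star> f"
proof -
  have "f \<star> ev f H [:1:] = ev f (pCons 0 H) [:1:]" by (simp add: ev_pCons)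
  also have "\<dots> = ev f (H * pCons 0 1) [:1:]" by simp
  also have "\<dots> = ev f H (f \<star> [:1:])" unfolding ev_mult by (simp add: ev_pCons ev_1)
  also have "\<dots> = ev f H ([:1:] \<star> f)" by simp
  also have "\<dots> = ev f H [:1:] \<star> f" by (rule ev_right)
  finally show ?thesis .
qed

text \<open>Since R has no zero divisors, factors y can be stripped from \<open>H\<close> until its
  constant term is nonzero. That term is then a multiple of \<open>f\<close>.\<close>

lemma multiple_in_range_eps:
  assumes f: "f \<noteq> 0" and H: "H \<noteq> 0" "ev f H [:1:] = 0"
  shows "\<exists>g h. h \<noteq> 0 \<and> g \<star> f = \<epsilon> h"
  using H
proof (induction H)
  case (pCons h H)
  show ?case
  proof (cases "h = 0")
    case True
    then have "f \<star> ev f H [:1:] = 0" using pCons.prems by (simp add: ev_pCons)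
    then have "ev f H [:1:] = 0" using f skm_eq_0_iff by blast
    moreover have "H \<noteq> 0" using pCons.prems True by auto
    ultimately show ?thesis using pCons.IH by blast
  next
    case False
    have "\<epsilon> h + ev f H [:1:] \<star> f = 0" using pCons.prems by (simp add: ev_pCons ev_commute)
    then have "- ev f H [:1:] \<star> f = \<epsilon> h" by (simp add: skm_minus_left neg_eq_iff_add_eq_0 add.commute)
    then show ?thesis using False by blast
  qed
qed simp

section \<open>The quotients of R as an algebra over F(x)\<close>

definition S :: "'d poly set" where "S = range \<epsilon> - {0}"

lemma S_iff: "s \<in> S \<longleftrightarrow> (\<exists>h. h \<noteq> 0 \<and> s = \<epsilon> h)"
  by (auto simp: S_def)

lemma eps_in_S [simp]: "h \<noteq> 0 \<Longrightarrow> \<epsilon> h \<in> S"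
  by (auto simp: S_iff)

sublocale loc: central_localization R S
proof (intro central_localization.intro central_localization_axioms.intro ring_skew_poly_ring)
  show "\<one>\<^bsub>R\<^esub> \<in> S" unfolding S_iff by (intro exI[of _ 1]) simp
  show "s \<otimes>\<^bsub>R\<^esub> u \<in> S" if su: "s \<in> S" "u \<in> S" for s u
  proof -
    obtain h k where "h \<noteq> 0" "s = \<epsilon> h" "k \<noteq> 0" "u = \<epsilon> k" using su unfolding S_iff by blast
    then have "h * k \<noteq> 0" "s \<otimes>\<^bsub>R\<^esub> u = \<epsilon> (h * k)" by (simp_all add: eps_mult)
    then show ?thesis by simp
  qed
  show "s \<otimes>\<^bsub>R\<^esub> f = f \<otimes>\<^bsub>R\<^esub> s" if "s \<in> S" for s f
    using that eps_central by (auto simp: S_iff)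
  show "f = \<zero>\<^bsub>R\<^esub>" if "s \<in> S" "f \<otimes>\<^bsub>R\<^esub> s = \<zero>\<^bsub>R\<^esub>" for s f
    using that by (auto simp: S_iff skm_eq_0_iff)
qed simp

abbreviation qf :: "'d poly \<Rightarrow> 'd poly \<Rightarrow> ('d poly \<times> 'd poly) set" where
  "qf \<equiv> quot R S"

abbreviation Q where "Q \<equiv> central_quotients R S"

definition \<sigma> :: "'f poly fract \<Rightarrow> ('d poly \<times> 'd poly) set" where "\<sigma> = fract_hom R S \<epsilon>"

lemma sigma_Fract:
  assumes b: "b \<noteq> 0"
  shows "\<sigma> (Fract a b) = qf (\<epsilon> a) (\<epsilon> b)"
proof -
  have "qf (\<epsilon> a') (\<epsilon> b') = qf (\<epsilon> a) (\<epsilon> b)" if "b' \<noteq> 0" "Fract a b = Fract a' b'" for a' b'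
  proof -
    have "a * b' = a' * b" using that b by (simp add: eq_fract)
    then have "\<epsilon> a' \<star> \<epsilon> b = \<epsilon> a \<star> \<epsilon> b'" by (simp only: eps_mult[symmetric])
    then show ?thesis using that b by (intro loc.qt_eqI) auto
  qed
  then have "{quot R S (\<epsilon> a') (\<epsilon> b') | a' b'. b' \<noteq> 0 \<and> Fract a b = Fract a' b'} = {qf (\<epsilon> a) (\<epsilon> b)}"
    using b by blast
  then show ?thesis unfolding \<sigma>_def fract_hom_def by simp
qed

lemma fract_cases2:
  obtains a b c where "k = Fract a c" "l = Fract b c" "c \<noteq> (0 :: 'f poly)"
proof -
  obtain a c where k: "k = Fract a c" "c \<noteq> 0" by (cases k) auto
  obtain b d where l: "l = Fract b d" "d \<noteq> 0" by (cases l) auto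
  show ?thesis
    by (rule that[of "a * d" "c * d" "b * c"]) (use k l in \<open>simp_all add: eq_fract\<close>)
qed

sublocale sc: scalar_algebra Q \<sigma>
proof (intro scalar_algebra.intro scalar_algebra_axioms.intro loc.ring_Q)
  fix k :: "'f poly fract"
  obtain a c where k: "k = Fract a c" "c \<noteq> 0" by (cases k) auto
  show "\<sigma> k \<in> carrier Q" using k by (simp add: sigma_Fract)
  fix x assume "x \<in> carrier Q"
  then obtain f s where x: "s \<in> S" "x = qf f s" by (auto simp: loc.Q_carrier)
  obtain h where h: "h \<noteq> 0" "s = \<epsilon> h" using x(1) by (auto simp: S_iff)
  have "\<epsilon> a \<star> f = f \<star> \<epsilon> a" "\<epsilon> c \<star> \<epsilon> h = \<epsilon> h \<star> \<epsilon> c" by (rule eps_central)+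
  then show "\<sigma> k \<otimes>\<^bsub>Q\<^esub> x = x \<otimes>\<^bsub>Q\<^esub> \<sigma> k" using k x h by (simp add: sigma_Fract loc.Q_mult)
next
  fix k l :: "'f poly fract"
  obtain a b c where kl: "k = Fract a c" "l = Fract b c" "c \<noteq> 0" by (rule fract_cases2)
  have "k + l = Fract (a + b) c"
    using kl by (simp add: eq_fract algebra_simps)
  then show "\<sigma> (k + l) = \<sigma> k \<oplus>\<^bsub>Q\<^esub> \<sigma> l"
    using kl by (simp add: sigma_Fract loc.Q_add eps_add)
  show "\<sigma> (k * l) = \<sigma> k \<otimes>\<^bsub>Q\<^esub> \<sigma> l"
    using kl by (simp add: sigma_Fract loc.Q_mult eps_mult)
next
  show "\<sigma> 1 = \<one>\<^bsub>Q\<^esub>"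
    using sigma_Fract[of 1 1] by (simp add: One_fract_def loc.Q_one)
  show "\<one>\<^bsub>Q\<^esub> \<noteq> \<zero>\<^bsub>Q\<^esub>"
    using loc.Q_zero_iff[of "[:1:]" "[:1:]"] loc.one_S by (simp add: loc.Q_one)
qed

definition \<eta> :: "'d poly \<Rightarrow> ('d poly \<times> 'd poly) set" where "\<eta> f = qf f [:1:]"

lemma one_in_S [simp]: "[:1:] \<in> S"
  using loc.one_S by simp

lemma eta_closed [simp]: "\<eta> f \<in> carrier Q"
  by (simp add: \<eta>_def)

lemma eta_mult: "\<eta> (f \<star> r) = \<eta> f \<otimes>\<^bsub>Q\<^esub> \<eta> r"
  and eta_add: "\<eta> (f + r) = \<eta> f \<oplus>\<^bsub>Q\<^esub> \<eta> r"
  and eta_one: "\<eta> [:1:] = \<one>\<^bsub>Q\<^esub>"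
  and eta_eps: "\<eta> (\<epsilon> h) = \<sigma> (to_fract h)"
  by (simp_all add: \<eta>_def loc.Q_mult loc.Q_add loc.Q_one sigma_Fract to_fract_def)

lemma finsum_R: "finite I \<Longrightarrow> finsum R f I = sum f I"
proof (induction I rule: finite_induct)
  case (insert i I)
  have "finsum R f (insert i I) = f i \<oplus>\<^bsub>R\<^esub> finsum R f I"
    using insert.hyps by (intro loc.finsum_insert) auto
  then show ?case using insert by simp
next
  case empty
  show ?case using loc.finsum_empty by simp
qed

lemma Q_spanned:
  assumes G: "finite G" "\<And>z. \<exists>k. z = (\<Sum>a\<in>G. j (k a) * a)"
  shows "\<exists>E. finite E \<and> E \<subseteq> carrier Q \<and>
    (\<forall>y\<in>carrier Q. \<exists>c. y = (\<Oplus>\<^bsub>Q\<^esub>b\<in>E. \<sigma> (c b) \<otimes>\<^bsub>Q\<^esub> b))"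
proof -
  let ?I = "G \<times> {..<m}" and ?e = "\<lambda>(a, i). Polynomial.monom a i :: 'd poly"
  define E where "E = ?e ` ?I"
  have fin: "finite E" using G(1) by (simp add: E_def)
  have span: "\<exists>h. f = (\<Sum>b\<in>E. \<epsilon> (h b) \<star> b)" for f
  proof -
    obtain h where "f = (\<Sum>(a, i)\<in>?I. \<epsilon> (h (a, i)) \<star> Polynomial.monom a i)"
      using finitely_generated[OF G] by blast
    also have "\<dots> = (\<Sum>k\<in>?I. \<epsilon> (h k) \<star> ?e k)" by (intro sum.cong) auto
    \<comment> \<open>The pairs need not give distinct monomials, as 0 may belong to
      \<open>G\<close>; coefficients of equal monomials are collected.\<close>
    also have "\<dots> = (\<Sum>b\<in>E. \<Sum>k\<in>{k\<in>?I. ?e k = b}. \<epsilon> (h k) \<star> ?e k)"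
      unfolding E_def using G(1) by (intro sum.image_gen) simp
    also have "\<dots> = (\<Sum>b\<in>E. \<epsilon> (\<Sum>k\<in>{k\<in>?I. ?e k = b}. h k) \<star> b)"
      by (intro sum.cong refl) (simp add: eps_sum skm_sum_left)
    finally show ?thesis by (intro exI[of _ "\<lambda>b. \<Sum>k\<in>{k\<in>?I. ?e k = b}. h k"])
  qed
  have inj: "inj_on \<eta> E"
  proof (rule inj_onI)
    fix f g assume "\<eta> f = \<eta> g"
    then show "f = g" by (simp add: \<eta>_def loc.qt_eq_iff)
  qed
  have "\<exists>c. y = (\<Oplus>\<^bsub>Q\<^esub>b\<in>\<eta> ` E. \<sigma> (c b) \<otimes>\<^bsub>Q\<^esub> b)" if "y \<in> carrier Q" for y
  proof -
    obtain f s where y: "s \<in> S" "y = qf f s" using \<open>y \<in> carrier Q\<close> by (auto simp: loc.Q_carrier)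
    obtain k where k: "k \<noteq> 0" "s = \<epsilon> k" using y(1) by (auto simp: S_iff)
    obtain h where h: "f = (\<Sum>b\<in>E. \<epsilon> (h b) \<star> b)" using span by blast
    define c where "c y = Fract (h (the_inv_into E \<eta> y)) k" for y
    have cl: "(\<lambda>b. \<sigma> (c b) \<otimes>\<^bsub>Q\<^esub> b) \<in> \<eta> ` E \<rightarrow> carrier Q"
      using sc.m_closed sc.scalar_closed by auto
    have "(\<Oplus>\<^bsub>Q\<^esub>b\<in>\<eta> ` E. \<sigma> (c b) \<otimes>\<^bsub>Q\<^esub> b) = (\<Oplus>\<^bsub>Q\<^esub>b\<in>E. \<sigma> (c (\<eta> b)) \<otimes>\<^bsub>Q\<^esub> \<eta> b)"
      by (rule sc.add.finprod_reindex[OF cl inj])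
    also have "\<dots> = (\<Oplus>\<^bsub>Q\<^esub>b\<in>E. qf (\<epsilon> (h b) \<star> b) s)"
    proof (rule sc.finsum_cong')
      fix b assume b: "b \<in> E"
      then have "c (\<eta> b) = Fract (h b) k" using inj by (simp add: c_def the_inv_into_f_f)
      then show "\<sigma> (c (\<eta> b)) \<otimes>\<^bsub>Q\<^esub> \<eta> b = qf (\<epsilon> (h b) \<star> b) s"
        using k by (simp add: sigma_Fract \<eta>_def loc.Q_mult)
    qed (use y in auto)
    also have "\<dots> = qf (finsum R (\<lambda>b. \<epsilon> (h b) \<star> b) E) s"
      by (rule loc.qt_finsum) (use fin y in auto)
    also have "\<dots> = y" using h y by (simp add: finsum_R[OF fin])
    finally show ?thesis by blast
  qed
  then show ?thesis using fin by (intro exI[of _ "\<eta> ` E"]) auto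
qed


text \<open>If \<open>r \<star> f = \<epsilon> h\<close> with \<open>h \<noteq> 0\<close>, then (r
  s) / \<epsilon> h is a left inverse of f / s.\<close>

lemma fract_division:
  assumes "\<And>f. \<exists>H. lead_coeff H = 1 \<and> ev f H [:1:] = 0" and y: "y \<in> carrier Q" "y \<noteq> \<zero>\<^bsub>Q\<^esub>"
  shows "\<exists>z\<in>carrier Q. z \<otimes>\<^bsub>Q\<^esub> y = \<one>\<^bsub>Q\<^esub>"
proof -
  obtain f s where fs: "s \<in> S" "y = qf f s" using y(1) by (auto simp: loc.Q_carrier)
  obtain k where k: "k \<noteq> 0" "s = \<epsilon> k" using fs(1) by (auto simp: S_iff)
  have "f \<noteq> 0" using y(2) fs by (simp add: loc.Q_zero_iff)
  moreover obtain H where "lead_coeff H = 1" "ev f H [:1:] = 0" using assms(1) by blast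
  moreover from this have "H \<noteq> 0" by auto
  ultimately obtain r h where r: "h \<noteq> 0" "r \<star> f = \<epsilon> h" using multiple_in_range_eps by blast
  have "qf (r \<star> s) (\<epsilon> h) \<otimes>\<^bsub>Q\<^esub> y = qf (r \<star> s \<star> f) (\<epsilon> h \<star> s)"
    using fs r by (simp add: loc.Q_mult)
  also have "r \<star> s \<star> f = \<epsilon> h \<star> s" using k r(2) by (metis eps_central skm_assoc)
  also have "qf (\<epsilon> h \<star> s) (\<epsilon> h \<star> s) = \<one>\<^bsub>Q\<^esub>"
    using fs r loc.mult_S[of "\<epsilon> h" s] by (simp add: loc.Q_one loc.qt_eq_iff)
  finally show ?thesis using r by (intro bexI[of _ "qf (r \<star> s) (\<epsilon> h)"]) auto
qed

lemma fract_center: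
  assumes y: "y \<in> carrier Q" and central: "\<And>z. z \<in> carrier Q \<Longrightarrow> y \<otimes>\<^bsub>Q\<^esub> z = z \<otimes>\<^bsub>Q\<^esub> y"
  shows "\<exists>k. y = \<sigma> k"
proof -
  obtain f s where fs: "s \<in> S" "y = qf f s" using y by (auto simp: loc.Q_carrier)
  obtain k where k: "k \<noteq> 0" "s = \<epsilon> k" using fs(1) by (auto simp: S_iff)
  have "f \<star> r = r \<star> f" for r
  proof -
    have "qf (f \<star> r) s = qf (r \<star> f) s"
      using central[of "\<eta> r"] fs by (simp add: \<eta>_def loc.Q_mult)
    then have "f \<star> r \<star> s = r \<star> f \<star> s" using fs(1) by (simp add: loc.qt_eq_iff)
    then show ?thesis using loc.S_right_cancel[OF fs(1), of "f \<star> r" "r \<star> f"] by simp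
  qed
  then obtain h where "f = \<epsilon> h" using center_eq_range_eps by blast
  then have "y = \<sigma> (Fract h k)" using fs k by (simp add: sigma_Fract)
  then show ?thesis by blast
qed

theorem reduced_norm_integral_and_divisible:
  assumes G: "finite G" "\<And>z. \<exists>k. z = (\<Sum>a\<in>G. j (k a) * a)"
  shows "\<exists>h q. reduced_norm Q \<sigma> (\<eta> f) = to_fract h \<and> \<epsilon> h = q \<star> f \<and> \<epsilon> h = f \<star> q"
proof -
  let ?K = "UNIV :: 'f poly fract set"
  define \<tau> :: "'f poly fract \<Rightarrow> 'f poly fract alg_closure" where "\<tau> = to_ac"
  have hom: "field_hom \<tau>" by unfold_locales (auto simp: \<tau>_def)
  interpret \<tau>: field_hom \<tau> by (rule hom)
  interpret mp: map_poly_comm_ring_hom \<tau> ..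
  have integral: "\<exists>H. lead_coeff H = 1 \<and> ev f H [:1:] = 0" for f
    by (rule integral_equation[OF G])
  have inf: "infinite ?K"
  proof -
    have "inj (\<lambda>n. to_fract (Polynomial.monom (1::'f) n))"
      by (rule injI) (simp add: monom_eq_iff')
    then have "infinite (range (\<lambda>n. to_fract (Polynomial.monom (1::'f) n)))"
      by (rule range_inj_infinite)
    then show ?thesis by (rule infinite_super[OF subset_UNIV])
  qed
  from Q_spanned[OF G] obtain E where E: "finite E \<and> E \<subseteq> carrier Q \<and>
      (\<forall>y\<in>carrier Q. \<exists>c. y = (\<Oplus>\<^bsub>Q\<^esub>b\<in>E. \<sigma> (c b) \<otimes>\<^bsub>Q\<^esub> b))" by (rule exE)
  obtain B where B: "is_alg_basis Q \<sigma> B"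
    using sc.alg_basis_exists[of E] E by blast
  have "central_division_fd_algebra Q \<sigma> B \<tau>"
    by (intro central_division_fd_algebra.intro fd_algebra_ext.intro fd_algebra.intro
        fd_algebra_axioms.intro central_division_fd_algebra_axioms.intro hom B
        sc.scalar_algebra_axioms fract_division integral fract_center)
  then obtain n \<phi> where split: "is_splitting Q \<sigma> \<tau> n \<phi>"
    using central_division_fd_algebra.splitting_exists by blast
  \<comment> \<open>The basis inside \<open>is_splitting\<close> is existentially quantified and may
    differ from \<open>B\<close>; from here on \<open>B'\<close> is used.\<close>
  then obtain B' where B': "is_alg_basis Q \<sigma> B'" "is_mat_basis n \<phi> B'"
    by (auto simp: is_splitting_def)
  have "fd_algebra_hom Q \<sigma> B' \<tau>"
    by (intro fd_algebra_hom.intro fd_algebra.intro fd_algebra_axioms.intro hom B'(1)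
        sc.scalar_algebra_axioms)
  then interpret A: fd_algebra_hom Q \<sigma> B' \<tau> .
  have rep: "A.rep n \<phi>" using split by (simp add: A.rep_def is_splitting_def)
  have n: "n > 0" by (rule A.splitting_pos[OF rep B'(2)])
  define \<theta> where "\<theta> r = \<phi> (\<eta> r)" for r
  define \<kappa> where "\<kappa> h = \<tau> (to_fract h)" for h
  have \<theta>_carrier: "\<theta> r \<in> carrier_mat n n" for r unfolding \<theta>_def by (rule A.rep_carrier[OF rep]) simp
  have \<theta>_mult: "\<theta> (r \<star> s) = \<theta> r * \<theta> s" and \<theta>_add: "\<theta> (r + s) = \<theta> r + \<theta> s" for r s
    unfolding \<theta>_def eta_mult eta_add by (simp_all add: A.rep_mult[OF rep] A.rep_add[OF rep])
  have \<theta>_eps: "\<theta> (\<epsilon> h) = \<kappa> h \<cdot>\<^sub>m 1\<^sub>m n" for h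
    unfolding \<theta>_def eta_eps \<kappa>_def by (rule A.rep_scalar[OF rep])
  have \<theta>_0: "\<theta> 0 $$ (u, v) = 0" if "u < n" "v < n" for u v
    using that \<theta>_eps[of 0] by (simp add: \<kappa>_def)
  have \<kappa>_0: "\<kappa> h = 0 \<longleftrightarrow> h = 0" for h by (simp add: \<kappa>_def)
  let ?M = "\<theta> f"
  have M: "?M \<in> carrier_mat n n" by (rule \<theta>_carrier)
  have \<theta>_pow: "\<theta> ((skew_mult \<delta> f ^^ i) [:1:]) = ?M ^\<^sub>m i" for i
  proof (induction i)
    case 0
    have "\<theta> [:1:] = 1\<^sub>m n" unfolding \<theta>_def eta_one by (rule A.rep_one[OF rep])
    then show ?case using M by simp
  next
    case (Suc i)
    then show ?case by (simp add: \<theta>_mult pow_mat_Suc_left[OF M] del: pow_mat.simps(2))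
  qed
  have \<theta>_sum: "\<theta> (sum r I) $$ (u, v) = (\<Sum>i\<in>I. \<theta> (r i) $$ (u, v))"
    if "u < n" "v < n" "finite I" for r u v and I :: "nat set"
    using that(3)
  proof (induction I rule: finite_induct)
    case (insert i I)
    then show ?case using that(1,2) \<theta>_carrier[of "sum r I"] by (simp add: \<theta>_add)
  qed (simp add: \<theta>_0 that)
  have \<theta>_ev: "\<theta> (ev f H [:1:]) $$ (u, v) = (\<Sum>i\<le>degree H. \<kappa> (coeff H i) * (?M ^\<^sub>m i) $$ (u, v))"
    if uv: "u < n" "v < n" for H u v
  proof -
    have "\<theta> (\<epsilon> h \<star> (skew_mult \<delta> f ^^ i) [:1:]) = \<kappa> h \<cdot>\<^sub>m ?M ^\<^sub>m i" for h i
      using mult_smult_assoc_mat[OF one_carrier_mat pow_carrier_mat[OF M, of i], of "\<kappa> h"]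
        left_mult_one_mat[OF pow_carrier_mat[OF M, of i]]
      by (simp add: \<theta>_mult \<theta>_eps \<theta>_pow)
    moreover have "(b \<cdot>\<^sub>m ?M ^\<^sub>m i) $$ (u, v) = b * (?M ^\<^sub>m i) $$ (u, v)" for b i
      using uv carrier_matD[OF pow_carrier_mat[OF M, of i]] by (intro index_smult_mat(1)) simp_all
    ultimately show ?thesis
      unfolding ev_def using uv by (simp add: \<theta>_sum)
  qed
  \<comment> \<open>A nonzero \<open>r\<close> has a nonzero multiple in F[x], which is mapped to a
    nonzero scalar matrix. Injectivity lets identities between matrices be pulled back to R.\<close>
  have \<theta>_inj: "r = 0" if zero: "\<And>u v. u < n \<Longrightarrow> v < n \<Longrightarrow> \<theta> r $$ (u, v) = 0" for r
  proof (rule ccontr)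
    assume "r \<noteq> 0"
    moreover obtain H where "lead_coeff H = 1" "ev r H [:1:] = 0" using integral by blast
    moreover from this have "H \<noteq> 0" by auto
    ultimately obtain s h where s: "h \<noteq> 0" "s \<star> r = \<epsilon> h" using multiple_in_range_eps by blast
    have "\<theta> r = 0\<^sub>m n n" using \<theta>_carrier[of r] zero by (intro eq_matI) auto
    then have "\<theta> (s \<star> r) = 0\<^sub>m n n" using \<theta>_carrier[of s] by (simp add: \<theta>_mult)
    then have "(\<kappa> h \<cdot>\<^sub>m 1\<^sub>m n) $$ (0, 0) = 0" using n by (simp add: s(2) \<theta>_eps)
    then show False using n s(1) by (simp add: \<kappa>_0)
  qed
  let ?\<chi> = "char_poly ?M"
  have "poly.coeff ?\<chi> i \<in> range \<tau>" for i
    unfolding \<theta>_def by (rule A.char_poly_rational[OF rep B'(2) inf]) simp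
  then have "\<forall>i. \<exists>k. poly.coeff ?\<chi> i = \<tau> k" by blast
  then obtain k where k: "\<And>i. poly.coeff ?\<chi> i = \<tau> (k i)" by metis
  have \<chi>: "degree ?\<chi> = n" "poly.coeff ?\<chi> n = 1" using degree_monic_char_poly[OF M] by auto
  define X0 where "X0 = (\<Sum>i\<le>n. Polynomial.monom (k i) i)"
  have kn: "k i = 0" if "i > n" for i
    using k[of i] \<chi>(1) that by (simp add: coeff_eq_0)
  have cX0: "poly.coeff X0 i = k i" for i
    using kn[of i] by (simp add: X0_def coeff_sum)
  have \<chi>_X0: "?\<chi> = map_poly \<tau> X0" by (rule poly_eqI) (simp add: k cX0)
  have "k n = 1" using k[of n] \<chi>(2) by simp
  have "degree X0 = n"
    by (rule antisym[OF degree_le le_degree]) (use kn \<open>k n = 1\<close> in \<open>auto simp: cX0\<close>)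
  then have X0_monic: "lead_coeff X0 = 1" using \<open>k n = 1\<close> by (simp add: cX0)
  obtain H where H: "lead_coeff H = 1" "ev f H [:1:] = 0" using integral by blast
  have inj: "\<kappa> a \<noteq> 0" if "a \<noteq> 0" for a using that by (simp add: \<kappa>_0)
  have deg_H: "degree (map_poly \<kappa> H) = degree H" by (rule Polynomial.degree_map_poly) (rule inj)
  \<comment> \<open>The equation H(f) = 0 in R is carried by \<theta> to H(M) = 0.\<close>
  have "?\<chi> dvd map_poly \<kappa> H ^ n"
  proof (rule char_poly_dvd_power[OF M])
    fix u v assume uv: "u < n" "v < n"
    show "(\<Sum>r\<le>degree (map_poly \<kappa> H). poly.coeff (map_poly \<kappa> H) r * (?M ^\<^sub>m r) $$ (u, v)) = 0"
      using \<theta>_ev[OF uv, of H] \<theta>_0[OF uv] H(2) by (simp add: deg_H coeff_map_poly \<kappa>_0)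
  qed
  also have "map_poly \<kappa> H = map_poly \<tau> (map_poly to_fract H)"
    by (rule poly_eqI) (simp add: coeff_map_poly \<kappa>_def)
  also have "map_poly \<tau> (map_poly to_fract H) ^ n = map_poly \<tau> (map_poly to_fract H ^ n)"
    by (rule mp.hom_power[symmetric])
  \<comment> \<open>Divisibility between polynomials over K may be tested over L.\<close>
  finally have "X0 dvd map_poly to_fract H ^ n"
    unfolding \<chi>_X0 by (rule \<tau>.dvd_map_poly_hom_imp_dvd)
  also have "map_poly to_fract H ^ n = map_poly to_fract (H ^ n)"
    by (induction n) simp_all
  finally have "poly.coeff X0 i \<in> range to_fract" for i
    using H(1) X0_monic by (intro monic_factor_integral[of "H ^ n"]) (simp_all add: lead_coeff_power)
  then have "\<forall>i. \<exists>a. k i = to_fract a" unfolding cX0 by blast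
  then obtain a where a: "\<And>i. k i = to_fract (a i)" by metis
  have \<chi>_a: "poly.coeff ?\<chi> i = \<kappa> (a i)" for i by (simp add: k a \<kappa>_def)
  define H1 where "H1 = (\<Sum>i\<le>n. Polynomial.monom (a i) i)"
  have cH1: "poly.coeff H1 i = (if i \<le> n then a i else 0)" for i by (simp add: H1_def coeff_sum)
  have "to_fract (a n) = to_fract 1" using \<open>k n = 1\<close> a[of n] by simp
  then have "a n = 1" by (simp only: to_fract_eq_iff)
  then have dH1: "degree H1 = n"
    by (intro antisym[OF degree_le le_degree]) (auto simp: cH1)
  \<comment> \<open>Cayley-Hamilton for \<open>\<theta> f\<close>, pulled back to R now that the
    coefficients lie in F[x].\<close>
  have "ev f H1 [:1:] = 0"
  proof (rule \<theta>_inj)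
    fix u v assume uv: "u < n" "v < n"
    have "\<theta> (ev f H1 [:1:]) $$ (u, v) = (\<Sum>i\<le>n. poly.coeff ?\<chi> i * (?M ^\<^sub>m i) $$ (u, v))"
      unfolding \<theta>_ev[OF uv] dH1 by (intro sum.cong refl) (simp add: cH1 \<chi>_a)
    then show "\<theta> (ev f H1 [:1:]) $$ (u, v) = 0" using cayley_hamilton[OF M uv] by simp
  qed
  moreover obtain K where K: "H1 = pCons (a 0) K" by (metis cH1 coeff_pCons_0 le0 pCons_cases)
  ultimately have rel: "\<epsilon> (a 0) + f \<star> ev f K [:1:] = 0" by (simp add: ev_pCons)
  \<comment> \<open>The sign comes from \<chi>(0) = det (- M) = (-1)^n det M.\<close>
  define s where "s = (- 1 :: 'f poly) ^ n"
  \<comment> \<open>Splitting off the constant term of \<open>H1\<close> gives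
    \<open>\<epsilon> (a 0)\<close> = - f K(f). As K(f) commutes with f, the same \<open>q\<close>
    is a cofactor on both sides.\<close>
  define q where "q = - (\<epsilon> s \<star> ev f K [:1:])"
  have eps_a0: "\<epsilon> (a 0) = - (f \<star> ev f K [:1:])" using rel by (simp add: eq_neg_iff_add_eq_0)
  have fq: "f \<star> q = \<epsilon> (s * a 0)"
  proof -
    have "f \<star> (\<epsilon> s \<star> ev f K [:1:]) = \<epsilon> s \<star> (f \<star> ev f K [:1:])" by (metis eps_central skm_assoc)
    then show ?thesis by (simp add: q_def eps_mult eps_a0 skm_minus_right)
  qed
  have qf: "q \<star> f = \<epsilon> (s * a 0)"
    by (simp add: q_def eps_mult eps_a0 skm_minus_right skm_minus_left skm_assoc ev_commute)
  have det: "\<tau> (to_fract (s * a 0)) = det ?M"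
  proof -
    have "poly ?\<chi> 0 = det (- ?M)"
      unfolding char_poly_def
      by (rule poly_det_cong) (use M in \<open>auto simp: char_poly_matrix_index\<close>)
    also have "- ?M = (- 1) \<cdot>\<^sub>m ?M" using M by (intro eq_matI) auto
    also have "det \<dots> = (- 1) ^ n * det ?M" using M by (simp add: det_smult)
    finally have "\<kappa> (a 0) = (- 1) ^ n * det ?M" by (simp add: poly_0_coeff_0 \<chi>_a)
    then have "(- 1) ^ n * \<kappa> (a 0) = det ?M" by (simp add: power_mult_distrib[symmetric] mult.assoc[symmetric])
    moreover have "\<kappa> (s * a 0) = (- 1) ^ n * \<kappa> (a 0)"
      by (cases "even n") (simp_all add: s_def \<kappa>_def \<tau>.hom_uminus)
    ultimately show ?thesis by (simp add: \<kappa>_def)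
  qed
  have "reduced_norm Q \<sigma> (\<eta> f) = to_fract (s * a 0)"
    unfolding reduced_norm_def
  proof (rule the_equality)
    show "\<exists>n \<phi>. is_splitting Q \<sigma> to_ac n \<phi> \<and> to_ac (to_fract (s * a 0)) = det (\<phi> (\<eta> f))"
      using split det unfolding \<tau>_def \<theta>_def by blast
  next
    \<comment> \<open>Another splitting, of whatever size, has the same determinant, and
      \<open>to_ac\<close> is injective.\<close>
    fix c assume "\<exists>n \<phi>. is_splitting Q \<sigma> to_ac n \<phi> \<and> to_ac c = det (\<phi> (\<eta> f))"
    then obtain n' \<phi>' where c: "is_splitting Q \<sigma> \<tau> n' \<phi>'" "\<tau> c = det (\<phi>' (\<eta> f))"
      unfolding \<tau>_def by blast
    have "\<tau> c = det (\<phi> (\<eta> f))"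
      unfolding c(2) by (rule sc.splitting_det_unique[OF hom c(1) split]) simp
    then have "\<tau> c = \<tau> (to_fract (s * a 0))" using det unfolding \<theta>_def by (simp only:)
    then show "c = to_fract (s * a 0)" unfolding \<tau>_def by (simp only: to_ac_eq_iff)
  qed
  then show ?thesis using fq qf by metis
qed

end

theorem theorem25:
  fixes \<iota>C :: "'c::field \<Rightarrow> 'd::division_ring"
    and \<iota>F :: "'f::field \<Rightarrow> 'c"
    and \<delta> :: "'d \<Rightarrow> 'd"
    and p d e :: nat
    and c :: "nat \<Rightarrow> 'f"
    and g :: "'f poly"
    and d0 :: 'd
    and E :: "'d set"
  defines "j \<equiv> \<iota>C \<circ> \<iota>F"
    and "R \<equiv> skew_poly_ring \<delta>"
  defines "x \<equiv> map_poly j g - [:d0:]"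
  defines "\<epsilon> \<equiv> skew_eval j \<delta> x"
  defines "S \<equiv> range \<epsilon> - {0}"
  defines "Q \<equiv> central_quotients R S"
    and "\<sigma> \<equiv> fract_hom R S \<epsilon>"
    and "\<eta> \<equiv> (\<lambda>f. quot R S f \<one>\<^bsub>R\<^esub>)"
  defines "N \<equiv> (\<lambda>f. reduced_norm Q \<sigma> (\<eta> f))"
  assumes "prime p" and "CHAR('c) = p"
    and "central_division_algebra \<iota>C d"
    and "is_derivation \<delta>"
    and "Ring_Hom.ring_hom \<iota>F" and "range j = Const \<delta> \<inter> range \<iota>C"
    and "g = Polynomial.monom 1 (p ^ e) + (\<Sum>i = 1..e. Polynomial.monom (c i) (p ^ (e - i)))"
    and "is_min_poly_on j \<delta> (range \<iota>C) g"
    and "\<forall>z. poly_op j \<delta> g z = d0 * z - z * d0"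
    and "\<delta> d0 = 0"
    and "subfield_of_degree \<iota>C E d"
  shows "(\<forall>f\<in>carrier R. N f \<in> range to_fract) \<and>
    (\<forall>f\<in>carrier R. \<exists>q\<in>carrier R. \<sigma> (N f) = \<eta> (q \<otimes>\<^bsub>R\<^esub> f) \<and> \<sigma> (N f) = \<eta> (f \<otimes>\<^bsub>R\<^esub> q))"
proof -
  have C: "Ring_Hom.ring_hom \<iota>C" "range \<iota>C = {z. \<forall>a. z * a = a * z}" "alg_dim \<iota>C UNIV > 0"
    using assms(12) by (auto simp: central_division_algebra_def)
  interpret C: Ring_Hom.ring_hom \<iota>C by (rule C(1))
  interpret F: Ring_Hom.ring_hom \<iota>F by fact
  have j_hom: "Ring_Hom.ring_hom j"
    by unfold_locales (simp_all add: j_def C.hom_add C.hom_mult F.hom_add F.hom_mult)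
  have char: "of_nat p = (0::'d)"
    using C.hom_of_nat[of p] assms(11) of_nat_CHAR[where 'a = 'c] by simp
  have exponents: "\<exists>k. n = p ^ k" if "poly.coeff g n \<noteq> 0" for n
  proof (rule ccontr)
    assume "\<nexists>k. n = p ^ k"
    then have "p ^ k \<noteq> n" for k by metis
    then have "poly.coeff g n = 0" by (simp add: assms(16) coeff_sum)
    then show False using that by simp
  qed
  have "derivation \<delta>" by (rule derivation.intro) fact
  then interpret A: algebraic_derivation \<delta> j "range \<iota>C" p g d0
  proof (intro algebraic_derivation.intro algebraic_derivation_axioms.intro)
  qed (use assms(10,15,17,18,19) j_hom C(2) char exponents in auto)
  have eqs: "A.x = x" "A.\<epsilon> = \<epsilon>" "A.S = S" "A.\<sigma> = \<sigma>" "A.\<eta> = \<eta>"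
    unfolding A.x_def A.\<epsilon>_def A.S_def A.\<sigma>_def A.\<eta>_def x_def \<epsilon>_def S_def \<sigma>_def \<eta>_def R_def
    by (simp_all add: fun_eq_iff)
  \<comment> \<open>A finite spanning set of D over F, from the finite dimension of D over C and the
    Wronskian bound for C over F.\<close>
  obtain G where G: "finite G" "\<And>z. \<exists>k. z = (\<Sum>a\<in>G. j (k a) * a)"
    using A.finite_over_constants[OF C(1) assms(14) _ refl C(3)] by (auto simp: j_def)
  have "\<exists>h q. N f = to_fract h \<and> \<sigma> (N f) = \<eta> (q \<otimes>\<^bsub>R\<^esub> f) \<and> \<sigma> (N f) = \<eta> (f \<otimes>\<^bsub>R\<^esub> q)" for f
  proof -
    obtain h q where *: "N f = to_fract h" "A.\<epsilon> h = skew_mult \<delta> q f" "A.\<epsilon> h = skew_mult \<delta> f q"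
      using A.reduced_norm_integral_and_divisible[OF G, of f]
      unfolding eqs N_def Q_def R_def by blast
    have "\<sigma> (N f) = \<eta> (A.\<epsilon> h)" using A.eta_eps[of h] unfolding eqs *(1) by simp
    then show ?thesis using * by (intro exI[of _ h] exI[of _ q]) (simp add: R_def)
  qed
  then show ?thesis by (metis (no_types, lifting) R_def A.R_simps(1) UNIV_I rangeI)
qed

end
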